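(* Let $b_1,b_2\ge0$ and let $\gamma_1,\gamma_2$ be simple curves in $\overline{\mathbb H}$ with $\gamma_j(0)\in\mathbb R$ and $\Gamma_j:=\gamma_j(0,T]\subset\mathbb H$, such that $\overline{\Gamma_1}\cap\overline{\Gamma_2}=\{p\}\subset\mathbb R$, and such that $\Gamma_j$ approaches $\mathbb R$ at $p$ in $\alpha_j$-direction ($j=1,2$) with $0<\alpha_1\le\alpha_2<\pi$. Let $h_j(t):=\operatorname{hcap}(\gamma_j(0,t])$ and $c(t):=\operatorname{hcap}(\gamma_1(0,t]\cup\gamma_2(0,t])$, and assume $h_1,h_2$ are differentiable at $t=0$ with $b_j=\dot h_j(0)$. Then $c$ is differentiable at $t=0$, and: (i) if $b_1=0$ or $b_2=0$, then $\dot c(0)=\max\{b_1,b_2\}$; if $b_1,b_2>0$, then (ii) $\max\{b_1,b_2\}\le\dot c(0)<b_1+b_2$; (iii) $\dot c(0)=\max\{b_1,b_2\}$ if and only if $\alpha_1=\alpha_2$; (iv) $\dot c(0)\to b_1+b_2$ as $(\alpha_1,\alpha_2)\to(0,\pi)$.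
   Context: $\mathbb H:=\{z:\operatorname{Im}z>0\}$. A bounded set $A\subset\mathbb H$ is a (compact) hull if $A=\mathbb H\cap\overline A$ and $\mathbb H\setminus A$ is simply connected. $g_A$ denotes the unique conformal map of $\mathbb H\setminus A$ onto $\mathbb H$ with $g_A(z)=z+\frac{b}{z}+O(|z|^{-2})$ as $z\to\infty$; the half-plane capacity is $\operatorname{hcap}(A):=b$. For $\varphi\in(0,\pi)$, a slit $\Gamma=\gamma(0,T]$ approaches $\mathbb R$ at $x\in\mathbb R$ in $\varphi$-direction if for every $\varepsilon>0$ there is $t_0>0$ with $\gamma(0,t_0]\subset\{z\in\mathbb H:\varphi-\varepsilon<\arg(z-x)<\varphi+\varepsilon\}$. *)

theory Defs
  imports "HOL-Complex_Analysis.Complex_Analysis"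
begin

definition upper_hp :: "complex set" where
  "upper_hp = {z. Im z > 0}"

definition is_hull :: "complex set \<Rightarrow> bool" where
  "is_hull A \<longleftrightarrow> bounded A \<and> A \<subseteq> upper_hp \<and> A = upper_hp \<inter> closure A
      \<and> simply_connected (upper_hp - A)"

text \<open>Half-plane capacity: the coefficient b in the hydrodynamic expansion
  g_A(z) = z + b/z + O(|z|^(-2)) at infinity of the conformal map g_A of H minus A onto H.\<close>
definition hcap :: "complex set \<Rightarrow> real" where
  "hcap A = (THE b::real. \<exists>g. g holomorphic_on (upper_hp - A) \<and> inj_on g (upper_hp - A)
      \<and> g ` (upper_hp - A) = upper_hp
      \<and> (\<exists>M R. \<forall>z\<in>upper_hp - A. R < norm z \<longrightarrow>
             norm (g z - z - complex_of_real b / z) \<le> M / (norm z)^2))"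

definition simple_slit :: "(real \<Rightarrow> complex) \<Rightarrow> real \<Rightarrow> bool" where
  "simple_slit \<gamma> T \<longleftrightarrow> 0 < T \<and> continuous_on {0..T} \<gamma> \<and> inj_on \<gamma> {0..T}
      \<and> Im (\<gamma> 0) = 0 \<and> \<gamma> ` {0<..T} \<subseteq> upper_hp"

definition approaches_in_dir :: "(real \<Rightarrow> complex) \<Rightarrow> real \<Rightarrow> real \<Rightarrow> real \<Rightarrow> bool" where
  "approaches_in_dir \<gamma> T x \<phi> \<longleftrightarrow>
     (\<forall>\<epsilon>>0. \<exists>t0>0. \<forall>t\<in>{0<..min t0 T}.
        \<phi> - \<epsilon> < Arg (\<gamma> t - complex_of_real x) \<and> Arg (\<gamma> t - complex_of_real x) < \<phi> + \<epsilon>)"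

definition two_slit_config ::
  "(real \<Rightarrow> complex) \<Rightarrow> (real \<Rightarrow> complex) \<Rightarrow> real \<Rightarrow> real \<Rightarrow> real \<Rightarrow> real
     \<Rightarrow> real \<Rightarrow> real \<Rightarrow> bool" where
  "two_slit_config \<gamma>1 \<gamma>2 T p \<alpha>1 \<alpha>2 b1 b2 \<longleftrightarrow>
     0 \<le> b1 \<and> 0 \<le> b2 \<and> simple_slit \<gamma>1 T \<and> simple_slit \<gamma>2 T
     \<and> closure (\<gamma>1 ` {0<..T}) \<inter> closure (\<gamma>2 ` {0<..T}) = {complex_of_real p}
     \<and> 0 < \<alpha>1 \<and> \<alpha>1 \<le> \<alpha>2 \<and> \<alpha>2 < pi
     \<and> approaches_in_dir \<gamma>1 T p \<alpha>1 \<and> approaches_in_dir \<gamma>2 T p \<alpha>2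
     \<and> ((\<lambda>t. hcap (\<gamma>1 ` {0<..t})) has_real_derivative b1) (at 0 within {0..T})
     \<and> ((\<lambda>t. hcap (\<gamma>2 ` {0<..t})) has_real_derivative b2) (at 0 within {0..T})"

definition joint_hcap :: "(real \<Rightarrow> complex) \<Rightarrow> (real \<Rightarrow> complex) \<Rightarrow> real \<Rightarrow> real" where
  "joint_hcap \<gamma>1 \<gamma>2 t = hcap (\<gamma>1 ` {0<..t} \<union> \<gamma>2 ` {0<..t})"

end

theory Submission
  imports Defs
begin

text \<open>All slits are treated through their mapping-out functions \<open>g\<close>. The imaginary part of
  \<open>g(z)\<close> vanishes on the boundary and is comparable to \<open>Im z\<close> at infinity, so the maximum principle
  yields monotonicity and subadditivity of the capacity, and Schwarz-Pick comparison with points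
  tending to \<open>\<i>\<infinity>\<close> turns these inequalities into strict and quantitative ones. This already
  settles the case where one of the rates vanishes. If both are positive, rescaling by \<open>1 / \<surd>t\<close> lets
  the two slits converge to straight segments with directions \<open>\<alpha>1\<close>, \<open>\<alpha>2\<close> and capacities \<open>b1\<close>, \<open>b2\<close>;
  since the capacity is continuous under this (kernel) convergence, the derivative of the joint
  capacity is the capacity of the union of the two segments. The segments are nested if and only if
  their directions agree, which gives the equality case. When the directions tend to \<open>0\<close> and \<open>\<pi>\<close>, the
  explicit map onto the complement of a segment shows that the segments become long but flat, so
  that they interact less and less.\<close>

section \<open>Schwarz-Pick estimates in the upper half-plane\<close>

text \<open>\<open>hcap\<close> is a definite description over conformal maps, so a capacity has a
  usable value only once a map is exhibited; for slits this takes a Riemann map, and hence the fact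
  that a slit and its mirror image do not separate the plane. The maps obtained this way come
  without any boundary extension. Its substitute is sequential: if points \<open>x\<close> of the
  domain tend to a point outside it, \<open>Im (g x)\<close> tends to 0. This follows from
  Schwarz-Pick at infinity alone, which keeps \<open>g x\<close> near \<open>x\<close> as long as
  \<open>Im (g x)\<close> stays away from 0, and the maximum principle is phrased for just such
  sequences. The comparisons then share one shape: a combination of mapping-out functions has
  nonnegative imaginary part, and the sign of its coefficient at infinity is read off at a single
  point. The scale is \<open>sqrt t\<close> because capacity is quadratic in length: a slit of
  capacity about \<open>b * t\<close> has radius about \<open>sqrt (b * t / C)\<close>, where
  \<open>C\<close> is the capacity of the unit segment in its direction. The limiting segments
  depend only on the angles and rates, which makes the limit in (iv) uniform over all
  curves.\<close>

lemma mem_upper_hp [simp]: "z \<in> upper_hp \<longleftrightarrow> Im z > 0"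
  by (simp add: upper_hp_def)

lemma open_upper_hp: "open upper_hp"
  unfolding upper_hp_def by (rule open_halfspace_Im_gt)

lemma convex_upper_hp: "convex upper_hp"
  unfolding upper_hp_def by (rule convex_halfspace_Im_gt)

lemma connected_upper_hp: "connected upper_hp"
  by (simp add: convex_upper_hp convex_connected)

text \<open>Trades the pseudohyperbolic quotient \<open>norm (z - a) / norm (z - cnj a)\<close> for
  a product of imaginary parts, so that Schwarz-Pick can be stated without division.\<close>

lemma norm_diff_cnj_sq: "(norm (z - cnj a))\<^sup>2 = (norm (z - a))\<^sup>2 + 4 * Im z * Im a"
  unfolding cmod_power2 by (simp add: power2_eq_square algebra_simps)

lemma norm_diff_less_cnj:
  assumes "Im z > 0" "Im a > 0"
  shows "norm (z - a) < norm (z - cnj a)"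
  by (rule power2_less_imp_less) (use assms in \<open>simp_all add: norm_diff_cnj_sq\<close>)

text \<open>Composing \<open>F\<close> with the Cayley transform that sends \<open>F c\<close> to 0
  gives a map into the unit disc vanishing at the centre, to which Schwarz's lemma applies.\<close>

lemma schwarz_pick_ball:
  assumes F: "F holomorphic_on ball c r" "\<And>z. z \<in> ball c r \<Longrightarrow> Im (F z) > 0"
      and z: "z \<in> ball c r"
  shows "norm (F z - F c) \<le> norm (z - c) / r * norm (F z - cnj (F c))"
proof -
  have r: "r > 0" using z by (metis ball_empty empty_iff linorder_not_less)
  define h where "h = (\<lambda>x. (F (c + of_real r * x) - F c) / (F (c + of_real r * x) - cnj (F c)))"
  have inb: "c + of_real r * x \<in> ball c r" if "norm x < 1" for x
    using that r by (simp add: dist_norm norm_mult)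
  have c: "Im (F c) > 0" using F(2)[of c] r by simp
  have nz: "F (c + of_real r * x) - cnj (F c) \<noteq> 0" if "norm x < 1" for x
    using F(2)[OF inb[OF that]] c by (auto simp: complex_eq_iff)
  have comp: "(\<lambda>x. F (c + of_real r * x)) holomorphic_on ball 0 1"
    using inb by (intro holomorphic_on_compose_gen[OF _ F(1), unfolded o_def] holomorphic_intros) auto
  have "h holomorphic_on ball 0 1"
    unfolding h_def using nz by (intro holomorphic_intros comp) auto
  moreover have "h 0 = 0" by (simp add: h_def)
  moreover have "norm (h x) < 1" if "norm x < 1" for x
    using norm_diff_less_cnj[OF F(2)[OF inb[OF that]] c] nz[OF that]
    by (simp add: h_def norm_divide divide_simps)
  moreover define x where "x = (z - c) / of_real r"
  moreover have nx: "norm x < 1"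
    using z r by (simp add: x_def norm_divide dist_norm norm_minus_commute)
  ultimately have "norm (h x) \<le> norm x"
    using Schwarz_Lemma(1) by blast
  moreover have "c + of_real r * x = z" using r by (simp add: x_def)
  ultimately show ?thesis
    using nz[OF nx] r by (simp add: h_def x_def norm_divide divide_simps mult.commute)
qed

text \<open>\<open>m\<close> is the Moebius map of the unit disc onto the half-plane with
  \<open>m 0 = a\<close>, and \<open>x\<close> is the preimage of \<open>z\<close>, which reduces
  the claim to the disc. The polynomial form passes to limits on both sides.\<close>

lemma schwarz_pick_upper_hp_strict:
  assumes F: "F holomorphic_on upper_hp" "\<And>z. z \<in> upper_hp \<Longrightarrow> Im (F z) > 0"
      and z: "Im z > 0" and a: "Im a > 0"
  shows "(norm (F z - F a))\<^sup>2 * Im z * Im a \<le> Im (F z) * Im (F a) * (norm (z - a))\<^sup>2"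
proof -
  define m where "m = (\<lambda>x. (a - cnj a * x) / (1 - x))"
  have n1: "1 - x \<noteq> 0" if "norm x < 1" for x :: complex using that by auto
  have m_pos: "Im (m x) > 0" if "norm x < 1" for x
  proof -
    have "Im ((a - cnj a * x) * cnj (1 - x)) = Im a * (1 - (norm x)\<^sup>2)"
      unfolding cmod_power2 by (simp add: power2_eq_square algebra_simps)
    also have "\<dots> > 0" using a that by (simp add: power_less_one_iff abs_square_less_1)
    finally show ?thesis
      using n1[OF that] by (simp add: m_def Im_complex_div_gt_0)
  qed
  have holm: "m holomorphic_on ball 0 1"
    unfolding m_def using n1 by (intro holomorphic_intros) auto
  have hol: "(F \<circ> m) holomorphic_on ball 0 1"
    using m_pos by (intro holomorphic_on_compose_gen[OF holm F(1)]) auto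
  define x where "x = (z - a) / (z - cnj a)"
  have nz: "z - cnj a \<noteq> 0" using z a by (auto simp: complex_eq_iff)
  have nx: "norm x < 1"
    using norm_diff_less_cnj[OF z a] nz by (simp add: x_def norm_divide divide_simps)
  have ia: "a - cnj a \<noteq> 0" using a by (auto simp: complex_eq_iff)
  have mx: "m x = z"
  proof -
    have "1 - x = (a - cnj a) / (z - cnj a)"
      using nz by (simp add: x_def field_simps)
    moreover have "a - cnj a * x = z * (a - cnj a) / (z - cnj a)"
      using nz by (simp add: x_def field_simps)
    ultimately show ?thesis using nz ia by (simp add: m_def)
  qed
  have "norm ((F \<circ> m) x - (F \<circ> m) 0) \<le> norm (x - 0) / 1 * norm ((F \<circ> m) x - cnj ((F \<circ> m) 0))"
    using nx m_pos F(2) by (intro schwarz_pick_ball[OF hol]) auto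
  moreover have "m 0 = a" by (simp add: m_def)
  ultimately have "norm (F z - F a) \<le> norm x * norm (F z - cnj (F a))"
    by (simp add: mx)
  hence "norm (F z - F a) * norm (z - cnj a) \<le> norm (z - a) * norm (F z - cnj (F a))"
    using nz by (simp add: x_def norm_divide divide_simps mult_ac)
  hence "(norm (F z - F a) * norm (z - cnj a))\<^sup>2 \<le> (norm (z - a) * norm (F z - cnj (F a)))\<^sup>2"
    by (intro power_mono) auto
  thus ?thesis
    by (simp add: power_mult_distrib norm_diff_cnj_sq algebra_simps)
qed

text \<open>Adding \<open>\<i> * e\<close> restores strict positivity, and both sides are continuous
  in \<open>e\<close>. The weak hypothesis is the one that differences of mapping-out functions
  satisfy.\<close>

lemma schwarz_pick_upper_hp:
  assumes F: "F holomorphic_on upper_hp" "\<And>z. z \<in> upper_hp \<Longrightarrow> Im (F z) \<ge> 0"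
      and z: "Im z > 0" and a: "Im a > 0"
  shows "(norm (F z - F a))\<^sup>2 * Im z * Im a \<le> Im (F z) * Im (F a) * (norm (z - a))\<^sup>2"
proof -
  define L where "L = (\<lambda>e::real. (Im (F z) + e) * (Im (F a) + e) * (norm (z - a))\<^sup>2)"
  have "(norm (F z - F a))\<^sup>2 * Im z * Im a \<le> L e" if "e > 0" for e
  proof -
    have "Im (F z + of_real e * \<i>) > 0" if "z \<in> upper_hp" for z
      using F(2)[OF that] \<open>e > 0\<close> by simp
    from schwarz_pick_upper_hp_strict[OF _ this z a] F(1) show ?thesis
      by (force intro!: holomorphic_intros simp: L_def)
  qed
  moreover have "(L \<longlongrightarrow> Im (F z) * Im (F a) * (norm (z - a))\<^sup>2) (at_right 0)"
    unfolding L_def by (rule tendsto_eq_intros refl | simp)+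
  ultimately show ?thesis
    by (intro tendsto_lowerbound) (auto simp: eventually_at_right_less eventually_mono[OF eventually_at_right_less])
qed

lemma Im_zero_imp_constant:
  assumes F: "F holomorphic_on upper_hp" "\<And>z. z \<in> upper_hp \<Longrightarrow> Im (F z) \<ge> 0"
      and a: "Im a > 0" "Im (F a) = 0" and z: "Im z > 0"
  shows "F z = F a"
  using schwarz_pick_upper_hp[OF F z a(1)] a z
  by (simp add: mult_le_0_iff)

lemma filterlim_of_real_at_infinity':
  assumes "filterlim Y at_top G"
  shows "filterlim (\<lambda>n. complex_of_real (Y n)) at_infinity G"
  unfolding filterlim_at_infinity_conv_norm_at_top
  by (rule filterlim_at_top_mono[OF assms], rule always_eventually) (simp add: abs_ge_self)

lemma tendsto_const_over_at_top:
  fixes c :: complex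
  assumes "filterlim Y at_top G"
  shows "((\<lambda>n. c / of_real (Y n)) \<longlongrightarrow> 0) G"
  by (rule tendsto_divide_0[OF tendsto_const filterlim_of_real_at_infinity'[OF assms]])

text \<open>Julia's inequality with infinity as boundary fixed point. Asymptotics along a single
  path suffice, which allows \<open>z n\<close> to be the image of the imaginary axis under another
  map.\<close>

lemma julia_upper_hp:
  assumes F: "F holomorphic_on upper_hp" "\<And>z. z \<in> upper_hp \<Longrightarrow> Im (F z) > 0"
      and lim: "filterlim Y at_top G" "((\<lambda>n. z n / of_real (Y n)) \<longlongrightarrow> \<i>) G"
               "((\<lambda>n. F (z n) / of_real (Y n)) \<longlongrightarrow> \<i>) G"
      and G: "G \<noteq> bot" and w: "Im w > 0"
  shows "Im w \<le> Im (F w)"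
proof -
  have Y0: "eventually (\<lambda>n. Y n > 0) G" using lim(1) by (simp add: filterlim_at_top_dense)
  have c0: "((\<lambda>n. c / of_real (Y n)) \<longlongrightarrow> 0) G" for c :: complex
    by (rule tendsto_const_over_at_top[OF lim(1)])
  have l1: "((\<lambda>n. (norm (F w / of_real (Y n) - F (z n) / of_real (Y n)))\<^sup>2 * Im w * Im (z n / of_real (Y n)))
        \<longlongrightarrow> (norm (0 - \<i>))\<^sup>2 * Im w * Im \<i>) G"
    by (intro tendsto_intros c0 lim)
  have l2: "((\<lambda>n. Im (F w) * Im (F (z n) / of_real (Y n)) * (norm (w / of_real (Y n) - z n / of_real (Y n)))\<^sup>2)
        \<longlongrightarrow> Im (F w) * Im \<i> * (norm (0 - \<i>))\<^sup>2) G"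
    by (intro tendsto_intros c0 lim)
  have "eventually (\<lambda>n. Im (z n / of_real (Y n)) > 0) G"
    using order_tendstoD(1)[OF tendsto_Im[OF lim(2)], of 0] by simp
  with Y0 have "eventually (\<lambda>n. (norm (F w / of_real (Y n) - F (z n) / of_real (Y n)))\<^sup>2 * Im w * Im (z n / of_real (Y n))
      \<le> Im (F w) * Im (F (z n) / of_real (Y n)) * (norm (w / of_real (Y n) - z n / of_real (Y n)))\<^sup>2) G"
  proof eventually_elim
    case (elim n)
    hence zn: "Im (z n) > 0" by (simp add: zero_less_divide_iff)
    have "(norm (F w - F (z n)))\<^sup>2 * Im w * Im (z n) \<le> Im (F w) * Im (F (z n)) * (norm (w - z n))\<^sup>2"
      using F(2) by (intro schwarz_pick_upper_hp F w zn) (auto intro: less_imp_le)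
    \<comment> \<open>Both sides grow like the cube of \<open>Y n\<close>: one factor comes from an
      imaginary part at \<open>z n\<close>, two from the squared distance.\<close>
    hence "(norm (F w - F (z n)))\<^sup>2 * Im w * Im (z n) / (Y n)^3 \<le> Im (F w) * Im (F (z n)) * (norm (w - z n))\<^sup>2 / (Y n)^3"
      using elim by (intro divide_right_mono) auto
    thus ?case using elim
      by (simp flip: diff_divide_distrib add: norm_divide power_divide power2_eq_square power3_eq_cube mult_ac)
  qed
  from tendsto_le[OF G l2 l1 this] show ?thesis by simp
qed

text \<open>The limit of the Schwarz-Pick inequalities between \<open>w\<close> and the points \<open>z n\<close>.\<close>
lemma pick_function_bound:
  assumes P: "P holomorphic_on upper_hp" "\<And>z. z \<in> upper_hp \<Longrightarrow> Im (P z) \<ge> 0"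
      and lim: "filterlim Y at_top G" "((\<lambda>n. z n / of_real (Y n)) \<longlongrightarrow> \<i>) G"
               "((\<lambda>n. of_real (Y n) * P (z n)) \<longlongrightarrow> \<i> * of_real b) G"
      and G: "G \<noteq> bot" and w: "Im w > 0"
  shows "(norm (P w))\<^sup>2 * Im w \<le> b * Im (P w)"
proof -
  have Y0: "eventually (\<lambda>n. Y n > 0) G" using lim(1) by (simp add: filterlim_at_top_dense)
  have c0: "((\<lambda>n. c / of_real (Y n)) \<longlongrightarrow> 0) G" for c :: complex
    by (rule tendsto_const_over_at_top[OF lim(1)])
  have "((\<lambda>n. (of_real (Y n) * P (z n)) * (1 / of_real (Y n))) \<longlongrightarrow> \<i> * of_real b * 0) G"
    by (intro tendsto_intros lim c0)
  hence "((\<lambda>n. (of_real (Y n) * P (z n)) * (1 / of_real (Y n))) \<longlongrightarrow> 0) G" by simp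
  hence Pz: "((\<lambda>n. P (z n)) \<longlongrightarrow> 0) G"
    by (rule Lim_transform_eventually) (use Y0 in \<open>auto elim!: eventually_mono\<close>)
  have l1: "((\<lambda>n. (norm (P w - P (z n)))\<^sup>2 * Im w * Im (z n / of_real (Y n)))
        \<longlongrightarrow> (norm (P w - 0))\<^sup>2 * Im w * Im \<i>) G"
    by (intro tendsto_intros Pz lim)
  have l2: "((\<lambda>n. Im (P w) * Im (of_real (Y n) * P (z n)) * (norm (w / of_real (Y n) - z n / of_real (Y n)))\<^sup>2)
        \<longlongrightarrow> Im (P w) * Im (\<i> * of_real b) * (norm (0 - \<i>))\<^sup>2) G"
    by (intro tendsto_intros c0 lim)
  have "eventually (\<lambda>n. Im (z n / of_real (Y n)) > 0) G"
    using order_tendstoD(1)[OF tendsto_Im[OF lim(2)], of 0] by simp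
  with Y0 have "eventually (\<lambda>n. (norm (P w - P (z n)))\<^sup>2 * Im w * Im (z n / of_real (Y n))
      \<le> Im (P w) * Im (of_real (Y n) * P (z n)) * (norm (w / of_real (Y n) - z n / of_real (Y n)))\<^sup>2) G"
  proof eventually_elim
    case (elim n)
    hence zn: "Im (z n) > 0" by (simp add: zero_less_divide_iff)
    have "(norm (P w - P (z n)))\<^sup>2 * Im w * Im (z n) \<le> Im (P w) * Im (P (z n)) * (norm (w - z n))\<^sup>2"
      by (intro schwarz_pick_upper_hp P w zn)
    \<comment> \<open>A single factor \<open>Y n\<close> is divided out here: on the right,
      \<open>Im (P (z n))\<close> behaves like \<open>b / Y n\<close> against the square from the
      distance.\<close>
    hence "(norm (P w - P (z n)))\<^sup>2 * Im w * Im (z n) / Y n \<le> Im (P w) * Im (P (z n)) * (norm (w - z n))\<^sup>2 / Y n"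
      using elim by (intro divide_right_mono) auto
    thus ?case using elim
      by (simp flip: diff_divide_distrib add: norm_divide power_divide power2_eq_square mult_ac)
  qed
  from tendsto_le[OF G l2 l1 this] show ?thesis by (simp add: mult_ac)
qed

section \<open>Mapping-out functions\<close>

text \<open>Map and coefficient are arguments rather than the result of a choice. The comparisons
  below hold for every witness, and uniqueness of the coefficient becomes one of them
  (\<open>hcap_eq\<close>).\<close>

definition mapping_out :: "complex set \<Rightarrow> (complex \<Rightarrow> complex) \<Rightarrow> real \<Rightarrow> bool" where
  "mapping_out A g b \<longleftrightarrow> bounded A \<and> A \<subseteq> upper_hp \<and> open (upper_hp - A)
     \<and> g holomorphic_on (upper_hp - A) \<and> inj_on g (upper_hp - A) \<and> g ` (upper_hp - A) = upper_hp
     \<and> (\<exists>M R. \<forall>z\<in>upper_hp - A. R < norm z \<longrightarrow>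
          norm (g z - z - complex_of_real b / z) \<le> M / (norm z)^2)"

lemma mapping_outD:
  assumes "mapping_out A g b"
  shows "bounded A" "A \<subseteq> upper_hp" "open (upper_hp - A)" "g holomorphic_on (upper_hp - A)"
    "inj_on g (upper_hp - A)" "g ` (upper_hp - A) = upper_hp"
  using assms by (auto simp: mapping_out_def)

lemma mapping_out_Im_pos:
  assumes "mapping_out A g b" "Im z > 0" "z \<notin> A"
  shows "Im (g z) > 0"
  using mapping_outD(6)[OF assms(1)] assms(2,3) by force

lemma mapping_out_continuous:
  assumes "mapping_out A g b" "Im z > 0" "z \<notin> A"
  shows "isCont g z"
proof -
  have "continuous_on (upper_hp - A) g"
    using mapping_outD(4)[OF assms(1)] by (rule holomorphic_on_imp_continuous_on)
  thus ?thesis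
    using assms(2,3) mapping_outD(3)[OF assms(1)] by (simp add: continuous_on_eq_continuous_at)
qed

lemma mapping_out_inverse:
  assumes "mapping_out A g b"
  obtains f where "f holomorphic_on upper_hp" "f ` upper_hp = upper_hp - A"
    "\<And>z. Im z > 0 \<Longrightarrow> z \<notin> A \<Longrightarrow> f (g z) = z" 
    "\<And>w. Im w > 0 \<Longrightarrow> Im (f w) > 0 \<and> f w \<notin> A \<and> g (f w) = w"
proof -
  note m = mapping_outD[OF assms]
  obtain f where "f holomorphic_on (g ` (upper_hp - A))" 
      and f2: "\<And>z. z \<in> upper_hp - A \<Longrightarrow> deriv g z * deriv f (g z) = 1 \<and> f (g z) = z"
    using holomorphic_has_inverse[OF m(4,3,5)] by metis
  hence f: "f holomorphic_on upper_hp" "\<And>z. z \<in> upper_hp - A \<Longrightarrow> f (g z) = z"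
    by (simp_all only: m(6))
  have "f ` (g ` (upper_hp - A)) = upper_hp - A"
    using f(2) by (force simp: image_image)
  hence im: "f ` upper_hp = upper_hp - A"
    by (simp only: m(6))
  have gf: "Im (f w) > 0 \<and> f w \<notin> A \<and> g (f w) = w" if "Im w > 0" for w
  proof -
    have "w \<in> g ` (upper_hp - A)" by (simp only: m(6)) (simp add: that)
    then obtain z where "z \<in> upper_hp - A" "w = g z" by (rule imageE)
    thus ?thesis using f(2)[of z] by simp
  qed
  show ?thesis by (rule that[OF f(1) im]) (simp add: f(2), erule gf)
qed

lemma bounded_eventually_notin:
  fixes z :: "'b \<Rightarrow> complex"
  assumes "bounded A" "filterlim z at_infinity G"
  shows "eventually (\<lambda>n. z n \<notin> A) G"
proof -
  obtain B where "\<And>x. x \<in> A \<Longrightarrow> norm x \<le> B" using assms(1) by (auto simp: bounded_iff)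
  moreover have "eventually (\<lambda>n. B + 1 \<le> norm (z n)) G"
    using assms(2) by (auto simp: filterlim_at_infinity_conv_norm_at_top filterlim_at_top)
  ultimately show ?thesis by (force elim: eventually_mono)
qed

lemma mapping_out_asymp:
  assumes m: "mapping_out A g b" and z: "filterlim z at_infinity G" "eventually (\<lambda>n. Im (z n) > 0) G"
  shows "((\<lambda>n. z n * (g (z n) - z n)) \<longlongrightarrow> of_real b) G"
proof -
  obtain M R where MR: "\<And>z. z\<in>upper_hp - A \<Longrightarrow> R < norm z \<Longrightarrow>
          norm (g z - z - complex_of_real b / z) \<le> M / (norm z)^2"
    using m unfolding mapping_out_def by blast
  have "eventually (\<lambda>n. max 0 R + 1 \<le> norm (z n)) G"
    using z(1) by (auto simp: filterlim_at_infinity_conv_norm_at_top filterlim_at_top)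
  with bounded_eventually_notin[OF mapping_outD(1)[OF m] z(1)] z(2)
  have ev: "eventually (\<lambda>n. norm (z n * (g (z n) - z n) - of_real b) \<le> norm (of_real M / z n)) G"
  proof eventually_elim
    case (elim n)
    hence nz: "z n \<noteq> 0" by auto
    have "norm (z n * (g (z n) - z n) - of_real b) = norm (z n) * norm (g (z n) - z n - of_real b / z n)"
      using nz by (simp flip: norm_mult add: algebra_simps)
    also have "\<dots> \<le> norm (z n) * (M / (norm (z n))\<^sup>2)"
      using elim by (intro mult_left_mono MR) auto
    also have "\<dots> \<le> \<bar>M\<bar> / norm (z n)"
      using nz by (simp add: power2_eq_square divide_right_mono)
    finally show ?case by (simp add: norm_divide)
  qed
  have "((\<lambda>n. z n * (g (z n) - z n) - of_real b) \<longlongrightarrow> 0) G"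
    by (rule Lim_null_comparison[OF ev]) (intro tendsto_norm_zero tendsto_divide_0[OF tendsto_const z(1)])
  thus ?thesis by (simp add: LIM_zero_iff)
qed

lemma filterlim_at_infinity_ray:
  assumes "filterlim Y at_top G" "((\<lambda>n. z n / of_real (Y n)) \<longlongrightarrow> \<i>) G"
  shows "filterlim z at_infinity G" "eventually (\<lambda>n. Im (z n) > 0) G"
proof -
  have Y0: "eventually (\<lambda>n. Y n > 0) G" using assms(1) by (simp add: filterlim_at_top_dense)
  have "eventually (\<lambda>n. Im (z n / of_real (Y n)) > 1 / 2) G"
    using order_tendstoD(1)[OF tendsto_Im[OF assms(2)], of "1/2"] by simp
  with Y0 have ev: "eventually (\<lambda>n. Im (z n) \<ge> Y n / 2 \<and> Im (z n) > 0) G"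
    by eventually_elim (simp add: field_simps)
  thus "eventually (\<lambda>n. Im (z n) > 0) G" by (rule eventually_mono) simp
  have "filterlim (\<lambda>n. Y n / 2) at_top G"
    using filterlim_tendsto_pos_mult_at_top[OF tendsto_const, of "1/2" "Y" G] assms(1) by simp
  hence "filterlim (\<lambda>n. norm (z n)) at_top G"
    by (rule filterlim_at_top_mono)
       (use ev in \<open>rule eventually_mono, meson abs_ge_self abs_Im_le_cmod order_trans\<close>)
  thus "filterlim z at_infinity G" by (simp add: filterlim_at_infinity_conv_norm_at_top)
qed

text \<open>Paths merely asymptotic to the imaginary axis are allowed, since later arguments follow
  images such as \<open>f (\<i> * y)\<close> that leave the axis.\<close>

lemma mapping_out_ray:
  assumes m: "mapping_out A g b" and Y: "filterlim Y at_top G"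
    and z: "((\<lambda>n. z n / of_real (Y n)) \<longlongrightarrow> \<i>) G"
  shows "((\<lambda>n. of_real (Y n) * (g (z n) - z n)) \<longlongrightarrow> - \<i> * of_real b) G"
    and "((\<lambda>n. g (z n) / of_real (Y n)) \<longlongrightarrow> \<i>) G"
proof -
  note zi = filterlim_at_infinity_ray[OF Y z]
  have Y0: "eventually (\<lambda>n. Y n > 0) G" using Y by (simp add: filterlim_at_top_dense)
  have "((\<lambda>n. z n * (g (z n) - z n) / (z n / of_real (Y n))) \<longlongrightarrow> of_real b / \<i>) G"
    by (intro tendsto_intros mapping_out_asymp[OF m zi] z) auto
  moreover have "eventually (\<lambda>n. z n * (g (z n) - z n) / (z n / of_real (Y n)) = of_real (Y n) * (g (z n) - z n)) G"
    using Y0 zi(2)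
  proof eventually_elim
    case (elim n)
    hence "z n \<noteq> 0" by auto
    thus ?case using elim by (simp add: field_simps)
  qed
  ultimately show 1: "((\<lambda>n. of_real (Y n) * (g (z n) - z n)) \<longlongrightarrow> - \<i> * of_real b) G"
    by (auto dest: Lim_transform_eventually simp: divide_i)
  have "((\<lambda>n. of_real (Y n) * (g (z n) - z n) * (1 / of_real (Y n)) * (1 / of_real (Y n)) + z n / of_real (Y n))
      \<longlongrightarrow> (- \<i> * of_real b) * 0 * 0 + \<i>) G"
    by (intro tendsto_intros 1 z tendsto_const_over_at_top Y)
  moreover have "eventually (\<lambda>n. of_real (Y n) * (g (z n) - z n) * (1 / of_real (Y n)) * (1 / of_real (Y n)) + z n / of_real (Y n)
      = g (z n) / of_real (Y n)) G"
    using Y0 by eventually_elim (auto simp: field_simps)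
  ultimately show "((\<lambda>n. g (z n) / of_real (Y n)) \<longlongrightarrow> \<i>) G"
    by (auto dest: Lim_transform_eventually)
qed

lemma tendsto_ray_ident:
  "filterlim (\<lambda>y::real. y) at_top at_top" "((\<lambda>y. (\<i> * of_real y) / of_real y) \<longlongrightarrow> \<i>) at_top"
proof -
  show "filterlim (\<lambda>y::real. y) at_top at_top" by (rule filterlim_ident)
  have "eventually (\<lambda>y::real. \<i> = (\<i> * of_real y) / of_real y) at_top"
    using eventually_gt_at_top[of 0] by eventually_elim simp
  thus "((\<lambda>y. (\<i> * of_real y) / of_real y) \<longlongrightarrow> \<i>) at_top"
    by (rule Lim_transform_eventually[OF tendsto_const])
qed

lemmas mapping_out_axis = mapping_out_ray[OF _ tendsto_ray_ident]

text \<open>Julia's inequality for the inverse \<open>f\<close> along the path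
  \<open>g (\<i> * y)\<close>, which \<open>f\<close> brings back to the axis. No boundary values
  enter; they are derived from this lemma.\<close>

lemma mapping_out_Im_le:
  assumes m: "mapping_out A g b" and z: "Im z > 0" "z \<notin> A"
  shows "Im (g z) \<le> Im z"
proof -
  obtain f where f: "f holomorphic_on upper_hp" "f ` upper_hp = upper_hp - A"
    "\<And>z. Im z > 0 \<Longrightarrow> z \<notin> A \<Longrightarrow> f (g z) = z"
    "\<And>w. Im w > 0 \<Longrightarrow> Im (f w) > 0 \<and> f w \<notin> A \<and> g (f w) = w"
    using mapping_out_inverse[OF m] by metis
  have ev: "eventually (\<lambda>y::real. \<i> * of_real y \<notin> A \<and> y > 0) at_top"
    using bounded_eventually_notin[OF mapping_outD(1)[OF m] filterlim_at_infinity_ray(1)[OF tendsto_ray_ident]]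
      eventually_gt_at_top by (rule eventually_conj)
  have "((\<lambda>y. (\<i> * of_real y) / of_real y) \<longlongrightarrow> \<i>) at_top" by (rule tendsto_ray_ident)
  moreover have "eventually (\<lambda>y. (\<i> * of_real y) / of_real y = f (g (\<i> * of_real y)) / of_real y) at_top"
    using ev by eventually_elim (simp add: f)
  ultimately have "((\<lambda>y. f (g (\<i> * of_real y)) / of_real y) \<longlongrightarrow> \<i>) at_top"
    by (rule Lim_transform_eventually)
  hence "Im (g z) \<le> Im (f (g z))"
    using f mapping_out_Im_pos[OF m z]
    by (intro julia_upper_hp[OF f(1) _ tendsto_ray_ident(1) mapping_out_axis(2)[OF m]]) auto
  thus ?thesis using f z by simp
qed

text \<open>Pulling \<open>P\<close> back by the inverse of \<open>gB\<close> reduces this to the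
  half-plane, since \<open>gB (\<i> * y)\<close> is still asymptotic to the axis. If
  \<open>Im (P z)\<close> vanishes, \<open>P\<close> is constant; the bound then makes the constant
  0, and with it \<open>b\<close>.\<close>

lemma mapping_out_pick:
  assumes mB: "mapping_out B gB bB" and hol: "P holomorphic_on upper_hp - B"
    and pos: "\<And>z. Im z > 0 \<Longrightarrow> z \<notin> B \<Longrightarrow> Im (P z) \<ge> 0"
    and lim: "((\<lambda>y. of_real y * P (\<i> * of_real y)) \<longlongrightarrow> \<i> * of_real b) at_top"
    and z: "Im z > 0" "z \<notin> B"
  shows "(norm (P z))\<^sup>2 * Im (gB z) \<le> b * Im (P z)"
    and "Im (P z) = 0 \<Longrightarrow> b = 0" 
proof -
  obtain f where f: "f holomorphic_on upper_hp" "f ` upper_hp = upper_hp - B"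
    "\<And>z. Im z > 0 \<Longrightarrow> z \<notin> B \<Longrightarrow> f (gB z) = z"
    "\<And>w. Im w > 0 \<Longrightarrow> Im (f w) > 0 \<and> f w \<notin> B \<and> gB (f w) = w"
    using mapping_out_inverse[OF mB] by metis
  have ev: "eventually (\<lambda>y::real. \<i> * of_real y \<notin> B \<and> y > 0) at_top"
    using bounded_eventually_notin[OF mapping_outD(1)[OF mB] filterlim_at_infinity_ray(1)[OF tendsto_ray_ident]]
      eventually_gt_at_top by (rule eventually_conj)
  have h: "(P \<circ> f) holomorphic_on upper_hp"
    using f by (intro holomorphic_on_compose[OF f(1)]) (simp add: hol)
  have p: "Im ((P \<circ> f) w) \<ge> 0" if "w \<in> upper_hp" for w
    using that f(4) pos by simp
  have "eventually (\<lambda>y. of_real y * P (\<i> * of_real y) = of_real y * (P \<circ> f) (gB (\<i> * of_real y))) at_top"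
    using ev by eventually_elim (simp add: f)
  from Lim_transform_eventually[OF lim this]
  have l: "((\<lambda>y. of_real y * (P \<circ> f) (gB (\<i> * of_real y))) \<longlongrightarrow> \<i> * of_real b) at_top" .
  have *: "(norm ((P \<circ> f) w))\<^sup>2 * Im w \<le> b * Im ((P \<circ> f) w)" if "Im w > 0" for w
    using h p l that by (intro pick_function_bound[OF h p tendsto_ray_ident(1) mapping_out_axis(2)[OF mB]]) auto
  from *[of "gB z"] show "(norm (P z))\<^sup>2 * Im (gB z) \<le> b * Im (P z)"
    using mapping_out_Im_pos[OF mB z] f(3)[OF z] by simp
  assume 0: "Im (P z) = 0"
  have const: "(P \<circ> f) w = P z" if "Im w > 0" for w
    using Im_zero_imp_constant[OF h p, of "gB z" w] mapping_out_Im_pos[OF mB z] f(3)[OF z] 0 that by simp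
  hence "(norm (P z))\<^sup>2 * Im \<i> \<le> b * Im (P z)" using *[of \<i>] by simp
  hence "P z = 0" using 0 by simp
  moreover have "eventually (\<lambda>y. of_real y * (P \<circ> f) (gB (\<i> * of_real y)) = of_real y * P z) at_top"
    using ev
  proof eventually_elim
    case (elim y)
    hence "Im (gB (\<i> * of_real y)) > 0" using mapping_out_Im_pos[OF mB] by simp
    thus ?case using const by simp
  qed
  from Lim_transform_eventually[OF l this] \<open>P z = 0\<close>
  have "((\<lambda>y::real. 0::complex) \<longlongrightarrow> \<i> * of_real b) at_top" by simp
  thus "b = 0" by (simp add: tendsto_const_iff)
qed

text \<open>If \<open>Im (g (x n))\<close> stayed above \<open>e\<close> on a subsequence, the Pick
  bound for \<open>z - g z\<close> would keep \<open>x n - g (x n)\<close> bounded. A limit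
  \<open>w0\<close> of the images would then lie in the open half-plane, and continuity of the
  inverse would make \<open>l = f w0\<close> a point of the domain.\<close>

lemma mapping_out_vanish:
  assumes m: "mapping_out A g b" and x: "\<And>n::nat. Im (x n) > 0 \<and> x n \<notin> A" and l: "x \<longlonglongrightarrow> l" "l \<notin> upper_hp - A"
  shows "(\<lambda>n. Im (g (x n))) \<longlonglongrightarrow> 0"
proof (rule ccontr)
  assume "\<not> ?thesis"
  then obtain e where e: "e > 0" "\<not> (\<forall>\<^sub>F n in sequentially. \<bar>Im (g (x n))\<bar> < e)"
    by (auto simp: tendsto_iff)
  hence "infinite {n. e \<le> \<bar>Im (g (x n))\<bar>}"
    by (simp add: frequently_cofinite[symmetric] cofinite_eq_sequentially frequently_def not_le)
  then obtain r :: "nat \<Rightarrow> nat" where r: "strict_mono r" "\<And>n. e \<le> \<bar>Im (g (x (r n)))\<bar>"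
    using infinite_enumerate by blast
  obtain f where f: "f holomorphic_on upper_hp" "f ` upper_hp = upper_hp - A"
    "\<And>z. Im z > 0 \<Longrightarrow> z \<notin> A \<Longrightarrow> f (g z) = z"
    "\<And>w. Im w > 0 \<Longrightarrow> Im (f w) > 0 \<and> f w \<notin> A \<and> g (f w) = w"
    using mapping_out_inverse[OF m] by metis
  define w where "w = (\<lambda>n. g (x (r n)))"
  have wpos: "Im (w n) > 0" for n using mapping_out_Im_pos[OF m] x by (simp add: w_def)
  have we: "e \<le> Im (w n)" for n using r(2)[of n] wpos[of n] by (simp add: w_def)
  have b: "norm (x (r n) - w n) \<le> \<bar>b\<bar> / e" for n
  proof -
    have "(norm (x (r n) - w n))\<^sup>2 * Im (w n) \<le> b * Im (x (r n) - w n)"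
      unfolding w_def
    proof (rule mapping_out_pick(1)[OF m])
      show "(\<lambda>z. z - g z) holomorphic_on upper_hp - A"
        using mapping_outD(4)[OF m] by (intro holomorphic_intros)
      show "Im (z - g z) \<ge> 0" if "Im z > 0" "z \<notin> A" for z
        using mapping_out_Im_le[OF m that] by simp
      show "((\<lambda>y. of_real y * (\<i> * of_real y - g (\<i> * of_real y))) \<longlongrightarrow> \<i> * of_real b) at_top"
        using tendsto_minus[OF mapping_out_axis(1)[OF m]] by (simp add: algebra_simps)
    qed (use x in auto)
    also have "\<dots> \<le> \<bar>b * Im (x (r n) - w n)\<bar>" by (rule abs_ge_self)
    also have "\<dots> \<le> \<bar>b\<bar> * norm (x (r n) - w n)"
      unfolding abs_mult by (intro mult_left_mono abs_Im_le_cmod) auto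
    finally have "(norm (x (r n) - w n))\<^sup>2 * Im (w n) \<le> \<bar>b\<bar> * norm (x (r n) - w n)" .
    hence "norm (x (r n) - w n) * (norm (x (r n) - w n) * Im (w n)) \<le> norm (x (r n) - w n) * \<bar>b\<bar>"
      by (simp only: power2_eq_square mult_ac)
    hence 1: "norm (x (r n) - w n) * Im (w n) \<le> \<bar>b\<bar>"
      by (cases "x (r n) = w n") simp_all
    have "norm (x (r n) - w n) * e \<le> norm (x (r n) - w n) * Im (w n)"
      by (intro mult_left_mono we) auto
    with 1 have "norm (x (r n) - w n) * e \<le> \<bar>b\<bar>" by (rule order_trans[rotated])
    thus ?thesis using e(1) by (simp only: pos_le_divide_eq)
  qed
  have xr: "(\<lambda>n. x (r n)) \<longlonglongrightarrow> l" using LIMSEQ_subseq_LIMSEQ[OF l(1) r(1)] by (simp add: o_def)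
  hence "bounded (range (\<lambda>n. x (r n)))" by (rule convergent_imp_bounded)
  then obtain B where B: "\<And>n. norm (x (r n)) \<le> B" by (auto simp: bounded_iff)
  have "norm (w n) \<le> B + \<bar>b\<bar> / e" for n
    using B[of n] b[of n] norm_triangle_sub[of "w n" "x (r n)"] by (simp add: norm_minus_commute)
  hence "bounded (range w)" by (auto simp: bounded_iff)
  then obtain w0 s where s: "strict_mono s" "(w \<circ> s) \<longlonglongrightarrow> w0"
    using bounded_imp_convergent_subsequence by blast
  have "Im w0 \<ge> e"
    by (rule LIMSEQ_le_const[OF tendsto_Im[OF s(2)]]) (use we in auto)
  hence w0: "Im w0 > 0" using e by simp
  hence "isCont f w0"
    using holomorphic_on_imp_continuous_on[OF f(1)] open_upper_hp
    by (simp add: continuous_on_eq_continuous_at)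
  from isCont_tendsto_compose[OF this s(2)] have "(\<lambda>n. f (w (s n))) \<longlonglongrightarrow> f w0" by simp
  moreover have "f (w (s n)) = x (r (s n))" for n using f(3) x by (simp add: w_def)
  moreover have "(\<lambda>n. x (r (s n))) \<longlonglongrightarrow> l" using LIMSEQ_subseq_LIMSEQ[OF xr s(1)] by (simp add: o_def)
  ultimately have "l = f w0" using LIMSEQ_unique by auto
  thus False using f(4)[OF w0] l(2) by auto
qed

section \<open>Maximum principle and comparison of capacities\<close>

lemma not_open_compact:
  fixes K :: "complex set"
  assumes "open K" "compact K" "K \<noteq> {}"
  shows False
  using assms clopen[of K] compact_imp_closed[OF assms(2)] compact_imp_bounded[OF assms(2)] not_bounded_UNIV
  by auto

text \<open>\<open>bd\<close> only has to refute boundary sequences along which \<open>Im P\<close>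
  stays above a positive level. Together with \<open>far\<close> it makes the sets
  \<open>c \<le> Im P\<close> compact for \<open>c > 0\<close>. The set of maximum points is then
  compact, nonempty and, by the maximum modulus principle, open, which is impossible in the
  plane.\<close>

lemma Im_maximum_principle:
  assumes D: "open D" and P: "P holomorphic_on D"
    and far: "\<And>e::real. e > 0 \<Longrightarrow> \<exists>R. \<forall>z\<in>D. R < norm z \<longrightarrow> Im (P z) < e"
    and bd: "\<And>x l e. (\<And>n::nat. x n \<in> D) \<Longrightarrow> x \<longlonglongrightarrow> l \<Longrightarrow> l \<notin> D \<Longrightarrow> e > 0 \<Longrightarrow> (\<And>n. e \<le> Im (P (x n))) \<Longrightarrow> False"
    and z: "z \<in> D"
  shows "Im (P z) \<le> 0"
proof (rule ccontr)
  assume "\<not> ?thesis"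
  hence z0: "Im (P z) > 0" by simp
  have cont: "continuous_on D P" by (rule holomorphic_on_imp_continuous_on[OF P])
  have comp: "compact {z\<in>D. c \<le> Im (P z)}" if c: "c > 0" for c
    unfolding compact_eq_bounded_closed
  proof
    obtain R where "\<And>z. z \<in> D \<Longrightarrow> R < norm z \<Longrightarrow> Im (P z) < c" using far[OF c] by blast
    thus "bounded {z\<in>D. c \<le> Im (P z)}"
      unfolding bounded_iff by (intro exI[of _ R]) force
    show "closed {z\<in>D. c \<le> Im (P z)}"
      unfolding closed_sequential_limits
    proof (intro allI impI, elim conjE)
      fix x l assume x: "\<forall>n. x n \<in> {z\<in>D. c \<le> Im (P z)}" and l: "x \<longlonglongrightarrow> l"
      have lD: "l \<in> D" using bd[of x l c] x l c by auto
      have "(\<lambda>n. P (x n)) \<longlonglongrightarrow> P l"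
        using continuous_on_tendsto_compose[OF cont l lD] x by simp
      hence "c \<le> Im (P l)"
        by (intro LIMSEQ_le_const[OF tendsto_Im]) (use x in auto)
      thus "l \<in> {z\<in>D. c \<le> Im (P z)}" using lD by simp
    qed
  qed
  have cs: "continuous_on {x\<in>D. Im (P z) \<le> Im (P x)} (\<lambda>x. Im (P x))"
    by (intro continuous_intros continuous_on_subset[OF cont]) auto
  have "{x\<in>D. Im (P z) \<le> Im (P x)} \<noteq> {}" using z by blast
  from continuous_attains_sup[OF comp[OF z0] this cs]
  obtain m where m: "m \<in> D" "Im (P z) \<le> Im (P m)" "\<And>x. x \<in> D \<Longrightarrow> Im (P z) \<le> Im (P x) \<Longrightarrow> Im (P x) \<le> Im (P m)"
    by blast
  have mx: "Im (P x) \<le> Im (P m)" if "x \<in> D" for x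
    using m(2) m(3)[OF that] by linarith
  let ?K = "{z\<in>D. Im (P m) \<le> Im (P z)}"
  have "open ?K"
    unfolding open_contains_ball
  proof
    fix a assume a: "a \<in> ?K"
    then obtain r where r: "r > 0" "ball a r \<subseteq> D" using D open_contains_ball by blast
    \<comment> \<open>The modulus of this function is \<open>exp (Im (P x))\<close>.\<close>
    have "(\<lambda>x. exp (- \<i> * P x)) constant_on (ball a r)"
    proof (rule maximum_modulus_principle)
      show "(\<lambda>x. exp (- \<i> * P x)) holomorphic_on ball a r"
        by (intro holomorphic_intros holomorphic_on_subset[OF P] r)
      show "norm (exp (- \<i> * P x)) \<le> norm (exp (- \<i> * P a))" if "x \<in> ball a r" for x
      proof -
        have "Im (P x) \<le> Im (P a)" using mx[of x] that r a by auto
        thus ?thesis by simp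
      qed
    qed (use r in auto)
    then obtain c where c: "\<And>x. x \<in> ball a r \<Longrightarrow> exp (- \<i> * P x) = c" unfolding constant_on_def by blast
    have "Im (P m) \<le> Im (P x)" if "x \<in> ball a r" for x
    proof -
      have "norm (exp (- \<i> * P x)) = norm (exp (- \<i> * P a))" using c[OF that] c[of a] r by simp
      hence "Im (P x) = Im (P a)" by simp
      thus ?thesis using a by simp
    qed
    thus "\<exists>e>0. ball a e \<subseteq> ?K" using r by (intro exI[of _ r]) auto
  qed
  moreover have "compact ?K" using comp m(2) z0 by simp
  ultimately show False using not_open_compact[of ?K] m(1) by blast
qed

lemma mapping_out_far:
  assumes m: "mapping_out A g b" and e: "e > 0"
  obtains R where "R > 0" "\<And>z. Im z > 0 \<Longrightarrow> z \<notin> A \<Longrightarrow> R < norm z \<Longrightarrow> norm (g z - z) < e"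
proof -
  obtain M R where MR: "\<And>z. z\<in>upper_hp - A \<Longrightarrow> R < norm z \<Longrightarrow>
          norm (g z - z - complex_of_real b / z) \<le> M / (norm z)^2"
    using m unfolding mapping_out_def by blast
  define R' where "R' = max 1 (max R ((\<bar>b\<bar> + \<bar>M\<bar>) / e))"
  have "norm (g z - z) < e" if z: "Im z > 0" "z \<notin> A" "R' < norm z" for z
  proof -
    have z1: "norm z > 1" "norm z > R" "norm z > (\<bar>b\<bar> + \<bar>M\<bar>) / e" using z by (auto simp: R'_def)
    have "norm (g z - z) \<le> norm (g z - z - complex_of_real b / z) + norm (complex_of_real b / z)"
      using norm_triangle_ineq[of "g z - z - complex_of_real b / z" "complex_of_real b / z"] by simp
    also have "\<dots> \<le> M / (norm z)^2 + \<bar>b\<bar> / norm z"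
      using MR[of z] z z1 by (simp add: norm_divide)
    also have "M / (norm z)^2 \<le> \<bar>M\<bar> / norm z"
    proof (rule frac_le)
      show "norm z \<le> (norm z)\<^sup>2" using z1 by (simp add: self_le_power)
    qed (use z1 in auto)
    also have "\<bar>M\<bar> / norm z + \<bar>b\<bar> / norm z = (\<bar>b\<bar> + \<bar>M\<bar>) / norm z" by (simp add: add_divide_distrib)
    also have "\<dots> < e"
    proof -
      have "\<bar>b\<bar> + \<bar>M\<bar> < e * norm z" using z1(3) e by (simp add: pos_divide_less_eq mult.commute)
      thus ?thesis using z1(1) by (subst pos_divide_less_eq) auto
    qed
    finally show ?thesis by simp
  qed
  thus ?thesis by (intro that[of R']) (auto simp: R'_def)
qed

lemma mapping_out_empty: "mapping_out {} (\<lambda>z. z) 0"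
  using open_upper_hp by (auto simp: mapping_out_def intro!: exI[of _ 0])

text \<open>Near the boundary of the smaller domain \<open>Im gB\<close> tends to 0 while
  \<open>Im gA\<close> is positive, and at infinity both maps are close to the identity.\<close>

lemma mapping_out_antimono:
  assumes mA: "mapping_out A gA bA" and mB: "mapping_out B gB bB" and sub: "A \<subseteq> B"
    and z: "Im z > 0" "z \<notin> B"
  shows "Im (gB z) \<le> Im (gA z)"
proof -
  have "Im (gB z - gA z) \<le> 0"
  proof (rule Im_maximum_principle[of "upper_hp - B" "\<lambda>z. gB z - gA z"])
    show "open (upper_hp - B)" by (rule mapping_outD(3)[OF mB])
    show "(\<lambda>z. gB z - gA z) holomorphic_on upper_hp - B"
      using sub by (intro holomorphic_intros mapping_outD(4)[OF mB] holomorphic_on_subset[OF mapping_outD(4)[OF mA]]) auto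
  next
    fix e :: real assume e: "e > 0"
    obtain R1 where R1: "\<And>z. Im z > 0 \<Longrightarrow> z \<notin> A \<Longrightarrow> R1 < norm z \<Longrightarrow> norm (gA z - z) < e / 2"
      using mapping_out_far[OF mA, of "e / 2"] e by (metis half_gt_zero)
    obtain R2 where R2: "\<And>z. Im z > 0 \<Longrightarrow> z \<notin> B \<Longrightarrow> R2 < norm z \<Longrightarrow> norm (gB z - z) < e / 2"
      using mapping_out_far[OF mB, of "e / 2"] e by (metis half_gt_zero)
    have "Im (gB z - gA z) < e" if "z \<in> upper_hp - B" "max R1 R2 < norm z" for z
    proof -
      have "norm (gA z - z) < e / 2" "norm (gB z - z) < e / 2"
        using R1[of z] R2[of z] that sub by auto
      hence "\<bar>Im (gA z - z)\<bar> < e / 2" "\<bar>Im (gB z - z)\<bar> < e / 2"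
        using abs_Im_le_cmod le_less_trans by blast+
      thus ?thesis unfolding minus_complex.simps plus_complex.simps by linarith
    qed
    thus "\<exists>R. \<forall>z\<in>upper_hp - B. R < norm z \<longrightarrow> Im (gB z - gA z) < e" by blast
  next
    fix x l e assume x: "\<And>n::nat. x n \<in> upper_hp - B" "x \<longlonglongrightarrow> l" "l \<notin> upper_hp - B"
      and e: "(e::real) > 0" "\<And>n. e \<le> Im (gB (x n) - gA (x n))"
    have "e \<le> Im (gB (x n))" for n
    proof -
      have "Im (x n) > 0" "x n \<notin> A" using x(1)[of n] sub by auto
      from mapping_out_Im_pos[OF mA this] e(2)[of n] show ?thesis by simp
    qed
    moreover have "(\<lambda>n. Im (gB (x n))) \<longlonglongrightarrow> 0"
      using x(1) by (intro mapping_out_vanish[OF mB _ x(2,3)]) auto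
    ultimately have "e \<le> 0" by (intro LIMSEQ_le_const) auto
    thus False using e by simp
  qed (use z in auto)
  thus ?thesis by simp
qed

lemma mapping_out_diff_pick:
  assumes mA: "mapping_out A gA bA" and mB: "mapping_out B gB bB" and sub: "A \<subseteq> B"
    and z: "Im z > 0" "z \<notin> B"
  shows "(norm (gA z - gB z))\<^sup>2 * Im (gB z) \<le> (bB - bA) * Im (gA z - gB z)"
    and "Im (gA z - gB z) = 0 \<Longrightarrow> bB - bA = 0"
proof -
  have h: "(\<lambda>z. gA z - gB z) holomorphic_on upper_hp - B"
    using sub by (intro holomorphic_intros mapping_outD(4)[OF mB] holomorphic_on_subset[OF mapping_outD(4)[OF mA]]) auto
  have p: "Im (gA z - gB z) \<ge> 0" if "Im z > 0" "z \<notin> B" for z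
    using mapping_out_antimono[OF mA mB sub that] by simp
  have l: "((\<lambda>y. of_real y * (gA (\<i> * of_real y) - gB (\<i> * of_real y))) \<longlongrightarrow> \<i> * of_real (bB - bA)) at_top"
    using tendsto_diff[OF mapping_out_axis(1)[OF mA] mapping_out_axis(1)[OF mB]] by (simp add: algebra_simps)
  show "(norm (gA z - gB z))\<^sup>2 * Im (gB z) \<le> (bB - bA) * Im (gA z - gB z)"
    by (rule mapping_out_pick(1)[OF mB h p l z])
  show "Im (gA z - gB z) = 0 \<Longrightarrow> bB - bA = 0"
    using mapping_out_pick(2)[OF mB h p l z] by simp
qed

text \<open>Any single point decides, here the preimage of \<open>\<i>\<close>: if
  \<open>gA - gB\<close> has positive imaginary part there, the Pick bound forces
  \<open>bB - bA\<close> to be nonnegative; if the imaginary part vanishes, the capacities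
  agree.\<close>

lemma mapping_out_mono:
  assumes mA: "mapping_out A gA bA" and mB: "mapping_out B gB bB" and sub: "A \<subseteq> B"
  shows "bA \<le> bB"
proof -
  obtain f where f: "\<And>w. Im w > 0 \<Longrightarrow> Im (f w) > 0 \<and> f w \<notin> B \<and> gB (f w) = w"
    using mapping_out_inverse[OF mB] by metis
  define z where "z = f \<i>"
  have z: "Im z > 0" "z \<notin> B" using f[of \<i>] by (auto simp: z_def)
  note d = mapping_out_diff_pick[OF mA mB sub z]
  have "0 \<le> Im (gA z - gB z)" using mapping_out_antimono[OF mA mB sub z] by simp
  moreover have "0 \<le> (norm (gA z - gB z))\<^sup>2 * Im (gB z)" using mapping_out_Im_pos[OF mB z] by simp
  ultimately have "Im (gA z - gB z) = 0 \<or> bA \<le> bB" using d(1) 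
    by (smt (verit) mult_neg_pos)
  thus ?thesis using d(2) by auto
qed

text \<open>Obtained from the Pick bound by passing to imaginary parts and cancelling one factor.
  This form survives limits of domains, and \<open>mapping_out_cap_diff_le\<close> converts it back
  into capacities.\<close>

lemma mapping_out_diff_bound:
  assumes mA: "mapping_out A gA bA" and mB: "mapping_out B gB bB" and sub: "A \<subseteq> B"
    and z: "Im z > 0" "z \<notin> B"
  shows "(Im (gA z) - Im (gB z)) * Im (gB z) \<le> bB - bA"
proof -
  define p where "p = Im (gA z) - Im (gB z)"
  have p0: "p \<ge> 0" using mapping_out_antimono[OF mA mB sub z] by (simp add: p_def)
  have "p\<^sup>2 \<le> (norm (gA z - gB z))\<^sup>2"
    using abs_Im_le_cmod[of "gA z - gB z"] p0 by (intro power_mono) (auto simp: p_def)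
  hence "p\<^sup>2 * Im (gB z) \<le> (norm (gA z - gB z))\<^sup>2 * Im (gB z)"
    using mapping_out_Im_pos[OF mB z] by (intro mult_right_mono) auto
  also have "\<dots> \<le> (bB - bA) * p"
    using mapping_out_diff_pick(1)[OF mA mB sub z] by (simp add: p_def)
  finally have "p * (p * Im (gB z)) \<le> p * (bB - bA)" by (simp only: power2_eq_square mult_ac)
  hence "p * Im (gB z) \<le> bB - bA"
    using p0 mapping_out_mono[OF mA mB sub] by (cases "p = 0") auto
  thus ?thesis by (simp add: p_def)
qed

text \<open>Equal capacities make \<open>gA\<close> and \<open>gB\<close> agree off
  \<open>B\<close>. Then \<open>gA\<close> already takes every value off \<open>B\<close>, so its
  value at a point of \<open>B - A\<close> would be taken twice.\<close>

lemma mapping_out_strict_mono: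
  assumes mA: "mapping_out A gA bA" and mB: "mapping_out B gB bB" and sub: "A \<subset> B"
  shows "bA < bB"
proof (rule ccontr)
  assume "\<not> ?thesis"
  hence eq: "bB - bA \<le> 0" by simp
  have same: "gA z = gB z" if z: "Im z > 0" "z \<notin> B" for z
  proof -
    have "(norm (gA z - gB z))\<^sup>2 * Im (gB z) \<le> (bB - bA) * Im (gA z - gB z)"
      using mapping_out_diff_pick(1)[OF mA mB _ z] sub by blast
    also have "\<dots> \<le> 0" using mapping_out_antimono[OF mA mB _ z] sub eq by (auto simp: mult_nonpos_nonneg)
    finally show ?thesis using mapping_out_Im_pos[OF mB z] by (simp add: mult_le_0_iff)
  qed
  obtain z0 where z0: "z0 \<in> B" "z0 \<notin> A" using sub by blast
  hence z0p: "z0 \<in> upper_hp - A" using mapping_outD(2)[OF mB] by auto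
  have "gA z0 \<in> upper_hp" using mapping_outD(6)[OF mA] z0p by blast
  then obtain z1 where z1: "z1 \<in> upper_hp - B" "gA z0 = gB z1"
    using mapping_outD(6)[OF mB] by (metis imageE)
  have "gA z1 = gA z0" using same[of z1] z1 by auto
  moreover have "z1 \<in> upper_hp - A" using z1 sub by blast
  ultimately have "z1 = z0" using inj_onD[OF mapping_outD(5)[OF mA]] z0p by blast
  thus False using z0 z1 by blast
qed

lemma mapping_out_nonneg: "mapping_out A g b \<Longrightarrow> 0 \<le> b"
  using mapping_out_mono[OF mapping_out_empty] by blast

lemma mapping_out_pos: "mapping_out A g b \<Longrightarrow> A \<noteq> {} \<Longrightarrow> 0 < b"
  using mapping_out_strict_mono[OF mapping_out_empty] by blast

text \<open>Uniqueness in the definite description is monotonicity for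
  \<open>A \<subseteq> A\<close>, used in both directions.\<close>

lemma hcap_eq:
  assumes m: "mapping_out A g b"
  shows "hcap A = b"
  unfolding hcap_def
proof (rule the_equality)
  show "\<exists>g. g holomorphic_on (upper_hp - A) \<and> inj_on g (upper_hp - A)
      \<and> g ` (upper_hp - A) = upper_hp
      \<and> (\<exists>M R. \<forall>z\<in>upper_hp - A. R < norm z \<longrightarrow>
             norm (g z - z - complex_of_real b / z) \<le> M / (norm z)^2)"
    using m unfolding mapping_out_def by blast
  fix b' assume "\<exists>g. g holomorphic_on (upper_hp - A) \<and> inj_on g (upper_hp - A)
      \<and> g ` (upper_hp - A) = upper_hp
      \<and> (\<exists>M R. \<forall>z\<in>upper_hp - A. R < norm z \<longrightarrow>
             norm (g z - z - complex_of_real b' / z) \<le> M / (norm z)^2)"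
  then obtain g' where "mapping_out A g' b'"
    using mapping_outD(1-3)[OF m] unfolding mapping_out_def by blast
  thus "b' = b"
    using mapping_out_mono[OF m, of A g' b'] mapping_out_mono[of A g' b' A, OF _ m] by auto
qed

text \<open>At a boundary point at least one of \<open>Im gA\<close>, \<open>Im gB\<close> tends to
  0. The other is at most \<open>Im z\<close> and \<open>Im gC\<close> is positive, so the
  combination is bounded by the vanishing term.\<close>

lemma mapping_out_subadditive:
  assumes mA: "mapping_out A gA bA" and mB: "mapping_out B gB bB" and mC: "mapping_out (A \<union> B) gC bC"
    and z: "Im z > 0" "z \<notin> A \<union> B"
  shows "Im (gA z) + Im (gB z) \<le> Im z + Im (gC z)"
proof -
  let ?P = "\<lambda>z. gA z + gB z - z - gC z"
  let ?D = "upper_hp - (A \<union> B)"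
  have "Im (?P z) \<le> 0"
  proof (rule Im_maximum_principle[of ?D ?P])
    show "open ?D" by (rule mapping_outD(3)[OF mC])
    show "?P holomorphic_on ?D"
      by (intro holomorphic_intros mapping_outD(4)[OF mC] holomorphic_on_subset[OF mapping_outD(4)[OF mA]]
         holomorphic_on_subset[OF mapping_outD(4)[OF mB]]) auto
  next
    fix e :: real assume e: "e > 0"
    hence e3: "e / 3 > 0" by simp
    obtain R1 where R1: "\<And>z. Im z > 0 \<Longrightarrow> z \<notin> A \<Longrightarrow> R1 < norm z \<Longrightarrow> norm (gA z - z) < e / 3"
      using mapping_out_far[OF mA e3] by metis
    obtain R2 where R2: "\<And>z. Im z > 0 \<Longrightarrow> z \<notin> B \<Longrightarrow> R2 < norm z \<Longrightarrow> norm (gB z - z) < e / 3"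
      using mapping_out_far[OF mB e3] by metis
    obtain R3 where R3: "\<And>z. Im z > 0 \<Longrightarrow> z \<notin> A \<union> B \<Longrightarrow> R3 < norm z \<Longrightarrow> norm (gC z - z) < e / 3"
      using mapping_out_far[OF mC e3] by metis
    have "Im (?P z) < e" if "z \<in> ?D" "max R1 (max R2 R3) < norm z" for z
    proof -
      have "norm (gA z - z) < e / 3" "norm (gB z - z) < e / 3" "norm (gC z - z) < e / 3"
        using R1[of z] R2[of z] R3[of z] that by auto
      hence "\<bar>Im (gA z - z)\<bar> < e / 3" "\<bar>Im (gB z - z)\<bar> < e / 3" "\<bar>Im (gC z - z)\<bar> < e / 3"
        using abs_Im_le_cmod le_less_trans by blast+
      thus ?thesis unfolding minus_complex.simps plus_complex.simps by linarith
    qed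
    thus "\<exists>R. \<forall>z\<in>?D. R < norm z \<longrightarrow> Im (?P z) < e" by blast
  next
    fix x l e assume x: "\<And>n::nat. x n \<in> ?D" "x \<longlonglongrightarrow> l" "l \<notin> ?D"
      and e: "(e::real) > 0" "\<And>n. e \<le> Im (?P (x n))"
    have x': "Im (x n) > 0" "x n \<notin> A" "x n \<notin> B" "x n \<notin> A \<union> B" for n using x(1)[of n] by auto
    have eA: "e \<le> Im (gA (x n))" and eB: "e \<le> Im (gB (x n))" for n
      using e(2)[of n] mapping_out_Im_pos[OF mC x'(1,4)[of n]]
        mapping_out_Im_le[OF mA x'(1,2)[of n]] mapping_out_Im_le[OF mB x'(1,3)[of n]] by auto
    consider "l \<notin> upper_hp - A" | "l \<notin> upper_hp - B" using x(3) by blast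
    then have "e \<le> 0"
    proof cases
      case 1
      have "(\<lambda>n. Im (gA (x n))) \<longlonglongrightarrow> 0"
        using x' by (intro mapping_out_vanish[OF mA _ x(2) 1]) auto
      thus ?thesis using eA by (intro LIMSEQ_le_const) auto
    next
      case 2
      have "(\<lambda>n. Im (gB (x n))) \<longlonglongrightarrow> 0"
        using x' by (intro mapping_out_vanish[OF mB _ x(2) 2]) auto
      thus ?thesis using eB by (intro LIMSEQ_le_const) auto
    qed
    thus False using e by simp
  qed (use z in auto)
  thus ?thesis by simp
qed

lemma mapping_out_defect_pick:
  assumes mA: "mapping_out A gA bA" and mB: "mapping_out B gB bB" and mC: "mapping_out (A \<union> B) gC bC"
    and z: "Im z > 0" "z \<notin> A \<union> B"
  defines "P \<equiv> \<lambda>z. z + gC z - gA z - gB z"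
  shows "(norm (P z))\<^sup>2 * Im (gC z) \<le> (bA + bB - bC) * Im (P z)"
    and "Im (P z) = 0 \<Longrightarrow> bA + bB - bC = 0"
proof -
  have h: "P holomorphic_on upper_hp - (A \<union> B)"
    unfolding P_def
    by (intro holomorphic_intros mapping_outD(4)[OF mC] holomorphic_on_subset[OF mapping_outD(4)[OF mA]]
         holomorphic_on_subset[OF mapping_outD(4)[OF mB]]) auto
  have p: "Im (P z) \<ge> 0" if "Im z > 0" "z \<notin> A \<union> B" for z
    using mapping_out_subadditive[OF mA mB mC that] by (simp add: P_def)
  have l: "((\<lambda>y. of_real y * P (\<i> * of_real y)) \<longlongrightarrow> \<i> * of_real (bA + bB - bC)) at_top"
    using tendsto_diff[OF tendsto_diff[OF mapping_out_axis(1)[OF mC] mapping_out_axis(1)[OF mA]] mapping_out_axis(1)[OF mB]]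
    by (simp add: algebra_simps P_def)
  show "(norm (P z))\<^sup>2 * Im (gC z) \<le> (bA + bB - bC) * Im (P z)"
    by (rule mapping_out_pick(1)[OF mC h p l z])
  show "Im (P z) = 0 \<Longrightarrow> bA + bB - bC = 0"
    using mapping_out_pick(2)[OF mC h p l z] by simp
qed

lemma mapping_out_cap_subadditive:
  assumes mA: "mapping_out A gA bA" and mB: "mapping_out B gB bB" and mC: "mapping_out (A \<union> B) gC bC"
  shows "bC \<le> bA + bB"
proof -
  obtain f where f: "\<And>w. Im w > 0 \<Longrightarrow> Im (f w) > 0 \<and> f w \<notin> A \<union> B \<and> gC (f w) = w"
    using mapping_out_inverse[OF mC] by metis
  define z where "z = f \<i>"
  have z: "Im z > 0" "z \<notin> A \<union> B" using f[of \<i>] by (auto simp: z_def)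
  note d = mapping_out_defect_pick[OF mA mB mC z]
  have "0 \<le> Im (z + gC z - gA z - gB z)" using mapping_out_subadditive[OF mA mB mC z] by simp
  moreover have "0 \<le> (norm (z + gC z - gA z - gB z))\<^sup>2 * Im (gC z)" using mapping_out_Im_pos[OF mC z] by simp
  ultimately have "Im (z + gC z - gA z - gB z) = 0 \<or> bC \<le> bA + bB" using d(1)
    by (smt (verit) mult_neg_pos)
  thus ?thesis using d(2) by auto
qed

text \<open>Equality would make the defect vanish identically. Along \<open>x\<close>, a path
  through the common complement to a point of \<open>A\<close> off \<open>B\<close>,
  \<open>gA\<close> and \<open>gC\<close> lose their imaginary parts while \<open>gB\<close> is
  continuous. Hence \<open>Im (gB l) = Im l\<close>, and \<open>B\<close> would have capacity
  0.\<close>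

lemma mapping_out_cap_strict_subadditive:
  assumes mA: "mapping_out A gA bA" and mB: "mapping_out B gB bB" and mC: "mapping_out (A \<union> B) gC bC"
    and x: "\<And>n::nat. Im (x n) > 0 \<and> x n \<notin> A \<union> B" "x \<longlonglongrightarrow> l" "l \<in> A" "l \<notin> B" and B: "B \<noteq> {}"
  shows "bC < bA + bB"
proof (rule ccontr)
  assume "\<not> ?thesis"
  hence le: "bA + bB - bC \<le> 0" by simp
  have l0: "Im l > 0" using x(3) mapping_outD(2)[OF mA] by auto
  have eq: "Im (x n) - Im (gB (x n)) = Im (gA (x n)) - Im (gC (x n))" for n
  proof -
    have xn: "Im (x n) > 0" "x n \<notin> A \<union> B" using x(1)[of n] by auto
    have "0 \<le> Im (x n + gC (x n) - gA (x n) - gB (x n))" using mapping_out_subadditive[OF mA mB mC xn] by simp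
    with mapping_out_defect_pick(1)[OF mA mB mC xn] le
    have "(norm (x n + gC (x n) - gA (x n) - gB (x n)))\<^sup>2 * Im (gC (x n)) \<le> 0"
      by (meson mult_nonpos_nonneg order_trans)
    hence "x n + gC (x n) - gA (x n) - gB (x n) = 0"
      using mapping_out_Im_pos[OF mC xn] by (simp add: mult_le_0_iff)
    hence "Im (x n + gC (x n) - gA (x n) - gB (x n)) = 0" by (simp only: zero_complex.simps)
    thus ?thesis by simp
  qed
  have "(\<lambda>n. Im (x n) - Im (gB (x n))) \<longlonglongrightarrow> Im l - Im (gB l)"
    by (intro tendsto_intros x(2) isCont_tendsto_compose[OF mapping_out_continuous[OF mB l0 x(4)]])
  moreover have "(\<lambda>n. Im (gA (x n)) - Im (gC (x n))) \<longlonglongrightarrow> 0 - 0"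
    using x by (intro tendsto_diff mapping_out_vanish[OF mA _ x(2)] mapping_out_vanish[OF mC _ x(2)]) auto
  ultimately have "Im (l - gB l) = 0" using eq LIMSEQ_unique by fastforce
  hence "bB - 0 = 0"
    using mapping_out_diff_pick(2)[OF mapping_out_empty mB _ l0 x(4)] by simp
  thus False using mapping_out_pos[OF mB B] by simp
qed

text \<open>No uniqueness theorem for conformal maps is needed to identify a map \<open>f\<close> onto the
  complement of \<open>A\<close>: Julia's inequality applies both to \<open>g \<circ> f\<close> and to its inverse.\<close>
lemma mapping_out_identify:
  assumes m: "mapping_out A g b" and f: "f holomorphic_on upper_hp" "inj_on f upper_hp" "f ` upper_hp = upper_hp - A"
    and lim: "((\<lambda>y. f (\<i> * of_real y) / of_real y) \<longlongrightarrow> \<i>) at_top" and w: "Im w > 0"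
  shows "Im (g (f w)) = Im w"
proof -
  define t where "t = g \<circ> f"
  have fh: "Im (f w) > 0 \<and> f w \<notin> A" if "Im w > 0" for w
  proof -
    have "f w \<in> f ` upper_hp" using that by simp
    thus ?thesis unfolding f(3) by simp
  qed
  have tp: "Im (t w) > 0" if "Im w > 0" for w
    using fh[OF that] mapping_out_Im_pos[OF m] by (simp add: t_def)
  have th: "t holomorphic_on upper_hp"
    unfolding t_def by (rule holomorphic_on_compose[OF f(1)]) (simp only: f(3) mapping_outD(4)[OF m])
  have ti: "inj_on t upper_hp"
    unfolding t_def by (rule comp_inj_on[OF f(2)]) (simp only: f(3) mapping_outD(5)[OF m])
  have "t ` upper_hp = g ` (f ` upper_hp)" by (simp add: t_def image_comp)
  hence tim: "t ` upper_hp = upper_hp" by (simp only: f(3) mapping_outD(6)[OF m])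
  have tl: "((\<lambda>y. t (\<i> * of_real y) / of_real y) \<longlongrightarrow> \<i>) at_top"
    unfolding t_def o_def by (rule mapping_out_ray(2)[OF m tendsto_ray_ident(1) lim])
  have 1: "Im w \<le> Im (t w)"
    using tp w by (intro julia_upper_hp[OF th _ tendsto_ray_ident tl]) auto
  obtain s where "s holomorphic_on (t ` upper_hp)" 
      and s2: "\<And>z. z \<in> upper_hp \<Longrightarrow> deriv t z * deriv s (t z) = 1 \<and> s (t z) = z"
    using holomorphic_has_inverse[OF th open_upper_hp ti] by metis
  hence s: "s holomorphic_on upper_hp" by (simp only: tim)
  have sp: "Im (s w) > 0" if "w \<in> upper_hp" for w
  proof -
    have "w \<in> t ` upper_hp" by (simp only: tim that)
    then obtain z where "z \<in> upper_hp" "w = t z" by (rule imageE)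
    thus ?thesis using s2[of z] by simp
  qed
  have "((\<lambda>y. s (t (\<i> * of_real y)) / of_real y) \<longlongrightarrow> \<i>) at_top"
  proof (rule Lim_transform_eventually[OF tendsto_ray_ident(2)])
    show "eventually (\<lambda>y. \<i> * of_real y / of_real y = s (t (\<i> * of_real y)) / of_real y) at_top"
      using eventually_gt_at_top[of 0] by eventually_elim (simp add: s2)
  qed
  hence "Im (t w) \<le> Im (s (t w))"
    using tp w sp by (intro julia_upper_hp[OF s _ tendsto_ray_ident(1) tl]) auto
  also have "s (t w) = w" using s2 w by simp
  finally show ?thesis using 1 by (simp add: t_def)
qed

section \<open>Existence of mapping-out functions\<close>

lemma holomorphic_factor_at_0:
  fixes F :: "complex \<Rightarrow> complex"
  assumes "F holomorphic_on S" "open S"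
  obtains G where "G holomorphic_on S" "\<And>z. F z = F 0 + z * G z" "G 0 = deriv F 0"
  using pole_lemma_open[OF assms, of 0]
  by (intro that[of "\<lambda>z. if z = 0 then deriv F 0 else (F z - F 0) / (z - 0)"]) auto

lemma Reals_limit_at_0:
  fixes F :: "complex \<Rightarrow> complex"
  assumes F: "isCont F (0::complex)" and r: "r > 0" "\<And>t. 0 < t \<Longrightarrow> t < r \<Longrightarrow> F (of_real t) \<in> \<real>"
  shows "F 0 \<in> \<real>"
proof -
  have "((\<lambda>t::real. complex_of_real t) \<longlongrightarrow> 0) (at_right 0)"
    using tendsto_of_real[OF tendsto_ident_at, of 0 "{0<..}"] by simp
  hence l: "((\<lambda>t. F (of_real t)) \<longlongrightarrow> F 0) (at_right 0)"
    by (rule isCont_tendsto_compose[OF F])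
  have e: "\<forall>\<^sub>F t in at_right (0::real). F (of_real t) \<in> \<real>"
    unfolding eventually_at_right_field using r by auto
  show ?thesis
    by (rule Lim_in_closed_set[where f = "\<lambda>t::real. F (of_real t)" and F = "at_right 0"])
       (use closed_complex_Reals e l in simp_all)
qed

text \<open>A disc automorphism is spent on \<open>\<phi> 0 = 0\<close> and a rotation on the
  positive derivative; conjugation preserves both normalizations.\<close>

lemma Riemann_map_normalized:
  assumes W: "open W" "simply_connected W" "0 \<in> W" "W \<noteq> UNIV"
  obtains \<phi> \<psi> d where "\<phi> holomorphic_on W" "\<psi> holomorphic_on ball 0 1" "\<phi> 0 = 0" "deriv \<phi> 0 = of_real d" "d > 0"
    "\<And>x. x \<in> W \<Longrightarrow> norm (\<phi> x) < 1 \<and> \<psi> (\<phi> x) = x" "\<And>w. norm w < 1 \<Longrightarrow> \<psi> w \<in> W \<and> \<phi> (\<psi> w) = w"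
proof -
  have "W = {} \<or> W = UNIV \<or> (\<exists>f g. f holomorphic_on W \<and> g holomorphic_on ball 0 1 \<and>
           (\<forall>z\<in>W. f z \<in> ball 0 1 \<and> g (f z) = z) \<and> (\<forall>z\<in>ball 0 1. g z \<in> W \<and> f (g z) = z))"
    using Riemann_mapping_theorem[of W] W(1,2) by blast
  then obtain f h where f: "f holomorphic_on W" and h: "h holomorphic_on ball 0 1"
    and fh: "\<And>z. z \<in> W \<Longrightarrow> f z \<in> ball 0 1 \<and> h (f z) = z" and hf: "\<And>z. z \<in> ball 0 1 \<Longrightarrow> h z \<in> W \<and> f (h z) = z"
    using W(3,4) by blast
  define w where "w = f 0"
  have w: "norm w < 1" using fh[OF W(3)] by (simp add: w_def)
  define M where "M = Moebius_function 0 w"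
  define M' where "M' = Moebius_function 0 (- w)"
  have M: "M holomorphic_on ball 0 1" "M' holomorphic_on ball 0 1"
    unfolding M_def M'_def using w by (intro Moebius_function_holomorphic; simp)+
  have Mb: "norm (M z) < 1" "norm (M' z) < 1" if "norm z < 1" for z
    unfolding M_def M'_def using w that by (intro Moebius_function_norm_lt_1; simp)+
  have MM: "M (M' z) = z" "M' (M z) = z" if "norm z < 1" for z
    unfolding M_def M'_def using w that by (intro Moebius_function_compose; simp)+
  define F where "F = M \<circ> f"
  define H where "H = h \<circ> M'"
  have F: "F holomorphic_on W"
    unfolding F_def using fh by (intro holomorphic_on_compose_gen[OF f M(1)]) blast
  have H: "H holomorphic_on ball 0 1"
    unfolding H_def using Mb by (intro holomorphic_on_compose_gen[OF M(2) h]) auto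
  have F0: "F 0 = 0" by (simp add: F_def M_def w_def Moebius_function_eq_zero)
  have FH: "norm (F x) < 1 \<and> H (F x) = x" if "x \<in> W" for x
    using fh[OF that] Mb MM by (simp add: F_def H_def)
  have HF: "H z \<in> W \<and> F (H z) = z" if "norm z < 1" for z
    using hf[of "M' z"] Mb(2)[OF that] MM that by (simp add: F_def H_def)
  have "inj_on F W" using FH by (metis inj_onI)
  hence d0: "deriv F 0 \<noteq> 0" using holomorphic_injective_imp_regular[OF F W(1)] W(3) by blast
  define d where "d = norm (deriv F 0)"
  define c where "c = cnj (deriv F 0) / of_real d"
  have d: "d > 0" using d0 by (simp add: d_def)
  have c: "norm c = 1" "c \<noteq> 0" using d0 by (auto simp: c_def d_def norm_divide)
  show ?thesis
  proof (rule that[of "\<lambda>z. c * F z" "\<lambda>z. H (z / c)" d])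
    show "(\<lambda>z. c * F z) holomorphic_on W" by (intro holomorphic_intros F)
    have "(\<lambda>z. z / c) ` ball 0 1 \<subseteq> ball 0 1" using c by (auto simp: norm_divide)
    thus "(\<lambda>z. H (z / c)) holomorphic_on ball 0 1"
      using c by (intro holomorphic_on_compose_gen[OF _ H, unfolded o_def] holomorphic_intros) auto
    have "F field_differentiable at 0" using F W by (metis holomorphic_on_imp_differentiable_at)
    hence "deriv (\<lambda>z. c * F z) 0 = c * deriv F 0" by (rule deriv_cmult)
    also have "\<dots> = of_real d"
      using d by (simp add: c_def d_def complex_norm_square[symmetric] power2_eq_square mult.commute field_simps)
    finally show "deriv (\<lambda>z. c * F z) 0 = of_real d" .
    show "norm (c * F x) < 1 \<and> H (c * F x / c) = x" if "x \<in> W" for x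
      using FH[OF that] c by (simp add: norm_mult)
    show "H (z / c) \<in> W \<and> c * F (H (z / c)) = z" if "norm z < 1" for z
      using HF[of "z / c"] that c by (simp add: norm_divide)
  qed (use F0 d in auto)
qed

text \<open>Conjugating a normalized Riemann map of a domain symmetric about the real axis gives
  another one, so Schwarz's lemma makes the map itself symmetric.\<close>
lemma Riemann_map_symmetric:
  assumes W: "open W" "0 \<in> W" "\<And>x. x \<in> W \<Longrightarrow> cnj x \<in> W"
    and \<phi>: "\<phi> holomorphic_on W" "\<psi> holomorphic_on ball 0 1" "\<phi> 0 = 0" "deriv \<phi> 0 = of_real d" "d > 0"
    and \<phi>\<psi>: "\<And>x. x \<in> W \<Longrightarrow> norm (\<phi> x) < 1 \<and> \<psi> (\<phi> x) = x" "\<And>w. norm w < 1 \<Longrightarrow> \<psi> w \<in> W \<and> \<phi> (\<psi> w) = w"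
    and x: "x \<in> W"
  shows "\<phi> (cnj x) = cnj (\<phi> x)"
proof -
  have cW: "cnj ` W = W" using W(3) by (metis complex_cnj_cnj image_eqI image_subsetI subset_antisym subsetI)
  have cB: "cnj ` ball 0 1 = ball 0 1"
    by (auto simp: image_iff intro!: bexI[of _ "cnj _"])
  have \<phi>': "(cnj \<circ> \<phi> \<circ> cnj) holomorphic_on W"
    using \<phi>(1) W(1) cW by (intro holomorphic_on_compose_cnj_cnj) simp_all
  have \<psi>': "(cnj \<circ> \<psi> \<circ> cnj) holomorphic_on ball 0 1"
    using \<phi>(2) cB by (intro holomorphic_on_compose_cnj_cnj) simp_all
  define k where "k = (cnj \<circ> \<phi> \<circ> cnj) \<circ> \<psi>"
  define k' where "k' = \<phi> \<circ> (cnj \<circ> \<psi> \<circ> cnj)"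
  have k: "k holomorphic_on ball 0 1"
    unfolding k_def using \<phi>\<psi>(2) by (intro holomorphic_on_compose_gen[OF \<phi>(2) \<phi>']) auto
  have k': "k' holomorphic_on ball 0 1"
    unfolding k'_def using \<phi>\<psi>(2) W(3) by (intro holomorphic_on_compose_gen[OF \<psi>' \<phi>(1)]) auto
  have \<psi>0: "\<psi> 0 = 0" using \<phi>\<psi>(1)[OF W(2)] \<phi>(3) by simp
  have k0: "k 0 = 0" "k' 0 = 0" by (simp_all add: k_def k'_def \<psi>0 \<phi>(3))
  have kb: "norm (k w) < 1" "norm (k' w) < 1" if "norm w < 1" for w
    using \<phi>\<psi>(1) \<phi>\<psi>(2) W(3) that by (auto simp: k_def k'_def)
  have k'k: "k' (k w) = w" if "norm w < 1" for w
  proof -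
    have "cnj (\<psi> w) \<in> W" using \<phi>\<psi>(2)[OF that] W(3) by blast
    thus ?thesis using \<phi>\<psi>(1)[of "cnj (\<psi> w)"] \<phi>\<psi>(2)[OF that] by (simp add: k_def k'_def)
  qed
  \<comment> \<open>An arbitrary nonzero point: Schwarz's lemma for \<open>k\<close> and its left
    inverse \<open>k'\<close> gives equality of norms there, which makes \<open>k\<close> a
    rotation.\<close>
  define w where "w = (1/2 :: complex)"
  have w: "norm w < 1" "w \<noteq> 0" by (auto simp: w_def)
  have "norm (k w) \<le> norm w" using Schwarz_Lemma(1)[OF k k0(1) kb(1) w(1)] .
  moreover have "norm (k' (k w)) \<le> norm (k w)" using Schwarz_Lemma(1)[OF k' k0(2) kb(2) kb(1)[OF w(1)]] .
  ultimately have "norm (k w) = norm w" using k'k[OF w(1)] by simp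
  then obtain a where a: "\<And>z. norm z < 1 \<Longrightarrow> k z = a * z"
    using Schwarz_Lemma(3)[OF k k0(1) kb(1) w(1)] w by blast
  have key: "cnj (\<phi> (cnj x)) = a * \<phi> x" if "x \<in> W" for x
    using a[of "\<phi> x"] \<phi>\<psi>(1)[OF that] by (simp add: k_def)
  \<comment> \<open>The rotation constant is read off from the quotient \<open>\<phi> z / z\<close>,
    which tends to the positive number \<open>d\<close> along the positive reals.\<close>
  obtain q where q: "q holomorphic_on W" "\<And>z. \<phi> z = \<phi> 0 + z * q z" "q 0 = of_real d"
    using holomorphic_factor_at_0[OF \<phi>(1) W(1)] \<phi>(4) by metis
  have qc: "isCont q 0"
    using holomorphic_on_imp_continuous_on[OF q(1)] W(1,2) by (simp add: continuous_on_eq_continuous_at)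
  obtain r where r: "r > 0" "ball 0 r \<subseteq> W" using W open_contains_ball by blast
  have tr: "((\<lambda>t::real. complex_of_real t) \<longlongrightarrow> 0) (at_right 0)"
    using tendsto_of_real[OF tendsto_ident_at, of 0 "{0<..}"] by simp
  have l1: "((\<lambda>t. cnj (q (of_real t))) \<longlongrightarrow> cnj (q 0)) (at_right 0)"
    by (intro tendsto_intros isCont_tendsto_compose[OF qc tr])
  have l2: "((\<lambda>t. a * q (of_real t)) \<longlongrightarrow> a * q 0) (at_right 0)"
    by (intro tendsto_intros isCont_tendsto_compose[OF qc tr])
  have "eventually (\<lambda>t. cnj (q (of_real t)) = a * q (of_real t)) (at_right 0)"
    unfolding eventually_at_right_field
  proof (intro exI[of _ r] conjI allI impI r)
    fix t :: real assume t: "0 < t" "t < r"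
    hence "complex_of_real t \<in> W" using r by (intro subsetD[OF r(2)]) simp
    from key[OF this] show "cnj (q (of_real t)) = a * q (of_real t)"
      using q(2)[of "of_real t"] t \<phi>(3) by simp
  qed
  from Lim_transform_eventually[OF l1 this] have "cnj (q 0) = a * q 0"
    by (rule tendsto_unique[rotated]) (use l2 in auto)
  hence "a = 1" using q(3) \<phi>(5) by simp
  thus ?thesis using key[OF x] by (metis complex_cnj_cnj mult_1)
qed

section \<open>The Joukowski map on the lower half of the unit disc\<close>

lemma joukowski_Im: "Im (w + 1 / w) = Im w * (1 - 1 / (norm w)\<^sup>2)" for w :: complex
proof (cases "w = 0")
  case False
  have "Im (1 / w) = - Im w / (norm w)\<^sup>2"
    by (simp add: Im_divide cmod_power2)
  thus ?thesis by (simp add: algebra_simps)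
qed auto

text \<open>Two different solutions of \<open>w + 1 / w = x\<close> have product 1, so they cannot
  both lie in the open unit disc.\<close>

lemma joukowski_inj:
  assumes "w + 1 / w = v + 1 / v" "norm w < 1" "norm v < 1" "w \<noteq> 0" "v \<noteq> 0"
  shows "w = (v :: complex)"
proof (rule ccontr)
  assume "w \<noteq> v"
  have "(w - v) * (1 - w * v) = w * v * ((v + 1 / v) - (w + 1 / w))"
    using assms(4,5) by (simp add: field_simps)
  hence "w * v = 1" using \<open>w \<noteq> v\<close> assms(1) by simp
  moreover have "norm w * norm v < 1 * 1"
    using assms(2-5) by (intro mult_strict_mono) auto
  ultimately show False by (metis norm_mult norm_one mult_1 less_irrefl)
qed

text \<open>The roots of \<open>w^2 - x * w + 1\<close> have product 1, so one has norm at most 1;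
  \<open>joukowski_Im\<close> then excludes norm 1 and fixes the sign of the imaginary part.\<close>

lemma joukowski_surj:
  assumes "Im x > 0"
  obtains w where "norm w < 1" "Im w < 0" "w + 1 / w = x"
proof -
  define s where "s = csqrt (x\<^sup>2 - 4)"
  define w1 where "w1 = (x + s) / 2"
  define w2 where "w2 = (x - s) / 2"
  have s: "s * s = x * x - 4" by (metis s_def power2_csqrt power2_eq_square)
  have "w1 * w2 = (x * x - s * s) / 4" by (simp add: w1_def w2_def algebra_simps)
  hence p: "w1 * w2 = 1" by (simp add: s)
  have "w1 + w2 = x" by (simp add: w1_def w2_def field_simps)
  note result = that
  have *: thesis if pw: "w * v = 1" "w + v = x" "norm w \<le> 1" for w v
  proof -
    have w0: "w \<noteq> 0" using pw by auto
    hence v: "1 / w = v" using pw(1) by (simp add: field_simps)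
    have im: "Im w * (1 - 1 / (norm w)\<^sup>2) > 0" using joukowski_Im[of w] v pw assms by simp
    hence "norm w \<noteq> 1" by auto
    hence n: "norm w < 1" using pw by simp
    hence "1 / (norm w)\<^sup>2 > 1" using w0 by (simp add: power_less_one_iff)
    hence "Im w < 0" using im by (simp add: zero_less_mult_iff)
    thus thesis using n v pw by (intro result[of w]) auto
  qed
  have "norm w1 * norm w2 = 1" using p by (metis norm_mult norm_one)
  hence "norm w1 \<le> 1 \<or> norm w2 \<le> 1"
    by (metis less_eq_real_def linorder_not_le mult_1 mult_strict_mono' norm_ge_zero order_less_irrefl zero_le_one)
  thus thesis using *[of w1 w2] *[of w2 w1] p \<open>w1 + w2 = x\<close> by (auto simp: mult.commute add.commute)
qed

text \<open>With \<open>q x = \<phi> x / x\<close> one gets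
  \<open>d / \<phi> x = 1 / x + s x\<close> for a holomorphic \<open>s\<close>, so removing the pole
  leaves a function with a Taylor expansion. Its coefficients are real because \<open>\<phi>\<close>
  is real on the real axis. The variable \<open>x\<close> stands for
  \<open>1 / (z - p)\<close>.\<close>

lemma joukowski_expansion:
  assumes W: "open W" "0 \<in> W" 
    and \<phi>: "\<phi> holomorphic_on W" "\<phi> 0 = 0" "deriv \<phi> 0 = of_real d" "d > 0"
    and nz: "\<And>x. x \<in> W \<Longrightarrow> x \<noteq> 0 \<Longrightarrow> \<phi> x \<noteq> 0"
    and real: "\<And>x. x \<in> W \<Longrightarrow> x \<in> \<real> \<Longrightarrow> \<phi> x \<in> \<real>"
  obtains c0 c1 M r where "r > 0" "\<And>x. norm x < r \<Longrightarrow> x \<noteq> 0 \<Longrightarrow>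
     norm (of_real d * (\<phi> x + 1 / \<phi> x) - 1 / x - of_real c0 - of_real c1 * x) \<le> M * (norm x)\<^sup>2"
proof -
  obtain q where q: "q holomorphic_on W" "\<And>z. \<phi> z = \<phi> 0 + z * q z" "q 0 = of_real d"
    using holomorphic_factor_at_0[OF \<phi>(1) W(1)] \<phi>(3) by metis
  have q0: "q x \<noteq> 0" if "x \<in> W" for x
    using nz[OF that] q(2)[of x] q(3) \<phi>(2,4) by (cases "x = 0") auto
  have "(\<lambda>x. of_real d / q x) holomorphic_on W" using q0 by (intro holomorphic_intros q(1)) auto
  then obtain s where s: "s holomorphic_on W" "\<And>z. of_real d / q z = of_real d / q 0 + z * s z"
    using holomorphic_factor_at_0[OF _ W(1)] by metis
  define h where "h = (\<lambda>x. of_real d * \<phi> x + s x)"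
  have h: "h holomorphic_on W" unfolding h_def by (intro holomorphic_intros s \<phi>(1))
  obtain h1 where h1: "h1 holomorphic_on W" "\<And>z. h z = h 0 + z * h1 z"
    using holomorphic_factor_at_0[OF h W(1)] by metis
  obtain h2 where h2: "h2 holomorphic_on W" "\<And>z. h1 z = h1 0 + z * h2 z"
    using holomorphic_factor_at_0[OF h1(1) W(1)] by metis
  have h_eq: "h x = of_real d * (\<phi> x + 1 / \<phi> x) - 1 / x" if "x \<in> W" "x \<noteq> 0" for x
  proof -
    have "of_real d / q x = 1 + x * s x" using s(2)[of x] q(3) \<phi>(4) by simp
    hence "s x = (of_real d / q x - 1) / x" using that by simp
    moreover have "q x = \<phi> x / x" using q(2)[of x] \<phi>(2) that by simp
    ultimately show ?thesis using that nz[OF that] by (simp add: h_def field_simps)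
  qed
  have cont: "isCont f 0" if "f holomorphic_on W" for f
    using holomorphic_on_imp_continuous_on[OF that] W(1,2) by (simp add: continuous_on_eq_continuous_at)
  obtain r where r: "r > 0" "cball 0 r \<subseteq> W" using W open_contains_cball by blast
  have hr: "h (of_real t) \<in> \<real>" if "0 < t" "t < r" for t
  proof -
    have t: "complex_of_real t \<in> W" using that r by (intro subsetD[OF r(2)]) simp
    show ?thesis using real[OF t] that by (subst h_eq[OF t]) auto
  qed
  have h0: "h 0 \<in> \<real>" by (rule Reals_limit_at_0[OF cont[OF h] r(1) hr])
  have h10: "h1 0 \<in> \<real>"
  proof (rule Reals_limit_at_0[OF cont[OF h1(1)] r(1)])
    fix t :: real assume t: "0 < t" "t < r"
    have "h1 (of_real t) = (h (of_real t) - h 0) / of_real t" using h1(2)[of "of_real t"] t by simp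
    thus "h1 (of_real t) \<in> \<real>" using hr[OF t] h0 by auto
  qed
  have "compact (h2 ` cball 0 r)"
    by (intro compact_continuous_image holomorphic_on_imp_continuous_on holomorphic_on_subset[OF h2(1) r(2)] compact_cball)
  then obtain M where M: "\<And>x. norm x \<le> r \<Longrightarrow> norm (h2 x) \<le> M"
    using compact_imp_bounded by (force simp: bounded_iff)
  obtain c0 where c0: "h 0 = of_real c0" using h0 by (auto elim: Reals_cases)
  obtain c1 where c1: "h1 0 = of_real c1" using h10 by (auto elim: Reals_cases)
  show ?thesis
  proof (rule that[OF r(1), of c0 c1 M])
    fix x :: complex assume x: "norm x < r" "x \<noteq> 0"
    have "x \<in> W" using x r by (intro subsetD[OF r(2)]) simp
    hence "of_real d * (\<phi> x + 1 / \<phi> x) - 1 / x - of_real c0 - of_real c1 * x = x * x * h2 x"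
      using h_eq[of x] x h1(2)[of x] h2(2)[of x] c0 c1 by (simp add: algebra_simps)
    also have "norm \<dots> = (norm x)\<^sup>2 * norm (h2 x)" by (simp add: norm_mult power2_eq_square)
    also have "\<dots> \<le> (norm x)\<^sup>2 * M" using M[of x] x by (intro mult_left_mono) auto
    finally show "norm (of_real d * (\<phi> x + 1 / \<phi> x) - 1 / x - of_real c0 - of_real c1 * x) \<le> M * (norm x)\<^sup>2"
      by (simp add: mult.commute)
  qed
qed

text \<open>Inversion about \<open>p\<close> sends \<open>p\<close> to infinity, and
  \<open>W\<close> is the image of the complement of \<open>K\<close> with 0 added as the image of
  infinity. Every component of \<open>- W\<close> contains the image of a connected set accumulating
  at \<open>p\<close>, so it is unbounded, and \<open>W\<close> has no holes.\<close>

lemma simply_connected_inversion: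
  fixes p :: complex
  assumes K: "compact K" "connected (- K)" "p \<in> K"
    and acc: "\<And>a. a \<in> K \<Longrightarrow> a \<noteq> p \<Longrightarrow> \<exists>C. a \<in> C \<and> connected C \<and> C \<subseteq> K - {p} \<and> p \<in> closure C"
  defines "W \<equiv> {x. x = 0 \<or> p + 1 / x \<notin> K}"
  shows "open W" "simply_connected W"
proof -
  obtain B where B: "B > 0" "\<And>z. z \<in> K \<Longrightarrow> norm (z - p) < B"
  proof -
    obtain B where "\<And>z. z \<in> K \<Longrightarrow> norm z \<le> B" using compact_imp_bounded[OF K(1)] by (auto simp: bounded_iff)
    hence "norm (z - p) < B + norm p + 1" if "z \<in> K" for z
      using norm_triangle_ineq4[of z p] that by fastforce
    moreover have "B + norm p + 1 > 0" using calculation[OF K(3)] by simp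
    ultimately show thesis using that by blast
  qed
  have sm: "x \<in> W" if "norm x < 1 / B" for x
  proof (cases "x = 0")
    case False
    hence "B < norm (1 / x)" using that B(1) by (simp add: norm_divide field_simps)
    thus ?thesis using B(2)[of "p + 1 / x"] by (auto simp: W_def)
  qed (simp add: W_def)
  have "open {x. x \<noteq> 0 \<and> p + 1 / x \<notin> K}"
  proof -
    have "open (- {0} \<inter> (\<lambda>x. p + 1 / x) -` (- K))"
      using compact_imp_closed[OF K(1)]
      by (intro continuous_open_preimage continuous_intros) auto
    moreover have "- {0} \<inter> (\<lambda>x. p + 1 / x) -` (- K) = {x. x \<noteq> 0 \<and> p + 1 / x \<notin> K}" by auto
    ultimately show ?thesis by simp
  qed
  moreover have "W = {x. x \<noteq> 0 \<and> p + 1 / x \<notin> K} \<union> ball 0 (1 / B)"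
  proof -
    have "ball 0 (1 / B) \<subseteq> W" using sm by (simp add: subset_iff)
    moreover have "0 \<in> ball (0::complex) (1 / B)" using B(1) by simp
    ultimately show ?thesis unfolding W_def by blast
  qed
  ultimately show oW: "open W" by (metis open_Un open_ball)
  define i where "i = (\<lambda>z. 1 / (z - p))"
  have "connected (i ` (- K))"
    unfolding i_def using K(3) by (intro connected_continuous_image K continuous_intros) auto
  moreover have iW: "i ` (- K) = W - {0}"
  proof (intro equalityI subsetI)
    fix x assume "x \<in> i ` (- K)" thus "x \<in> W - {0}" using K(3) by (auto simp: i_def W_def)
  next
    fix x assume "x \<in> W - {0}"
    thus "x \<in> i ` (- K)" by (intro image_eqI[of _ _ "p + 1 / x"]) (auto simp: i_def W_def)
  qed
  moreover have "W \<subseteq> closure (W - {0})"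
  proof
    fix x assume x: "x \<in> W"
    show "x \<in> closure (W - {0})"
    proof (cases "x = 0")
      case True
      have "0 \<in> closure (W - {0})"
        using open_imp_islimpt[OF oW, of 0] x True by (simp add: islimpt_in_closure)
      thus ?thesis using True by simp
    qed (use x subsetD[OF closure_subset, of x "W - {0}"] in simp)
  qed
  ultimately have cW: "connected W"
    using connected_intermediate_closure[of "W - {0}" W] by (simp only: Diff_subset)
  have "\<not> bounded C" if C: "C \<in> components (- W)" for C
  proof
    assume "bounded C"
    then obtain b where b: "\<And>x. x \<in> C \<Longrightarrow> norm x \<le> b" by (auto simp: bounded_iff)
    obtain x where x: "x \<in> C" using in_components_nonempty[OF C] by blast
    hence xW: "x \<noteq> 0" "p + 1 / x \<in> K" using in_components_subset[OF C] by (auto simp: W_def)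
    obtain C' where C': "p + 1 / x \<in> C'" "connected C'" "C' \<subseteq> K - {p}" "p \<in> closure C'"
      using acc[OF xW(2)] xW(1) by auto
    have "i ` C' \<subseteq> C"
    proof (rule components_maximal[OF C])
      show "connected (i ` C')"
        unfolding i_def using C' by (intro connected_continuous_image continuous_intros) auto
      show "i ` C' \<subseteq> - W" using C'(3) by (auto simp: i_def W_def)
      have "x \<in> i ` C'" using C'(1) by (intro image_eqI[of _ _ "p + 1 / x"]) (auto simp: i_def)
      thus "C \<inter> i ` C' \<noteq> {}" using x by blast
    qed
    hence ge: "1 \<le> b * norm (z - p)" if "z \<in> C'" for z
    proof -
      have "z \<noteq> p" using that C'(3) by auto
      have "norm (i z) \<le> b" using b \<open>i ` C' \<subseteq> C\<close> that by blast
      thus ?thesis using \<open>z \<noteq> p\<close> by (simp add: i_def norm_divide field_simps)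
    qed
    have b0: "b > 0"
      using ge[OF C'(1)] by (smt (verit) mult_nonpos_nonneg norm_ge_zero)
    obtain z where "z \<in> C'" "dist z p < 1 / b"
      using C'(4) b0 by (metis closure_approachable zero_less_divide_1_iff)
    thus False using ge[of z] b0 by (simp add: dist_norm field_simps)
  qed
  thus "simply_connected W"
    using cW oW simply_connected_eq_unbounded_complement_components by blast
qed

text \<open>The mapping-out function is built from the Riemann map of the exterior of \<open>A\<close>, its
  mirror image and \<open>p\<close> (on the sphere) by means of the Joukowski map. Since infinity is an interior
  point of this domain, the expansion at infinity is just a Taylor expansion.\<close>
lemma mapping_out_exists:
  fixes p :: real
  assumes A: "A \<subseteq> upper_hp" "A \<noteq> {}" "compact (insert (of_real p) A)"
    and con: "connected (- (insert (of_real p) A \<union> cnj ` insert (of_real p) A))"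
    and acc: "\<And>a. a \<in> A \<Longrightarrow> \<exists>C. a \<in> C \<and> connected C \<and> C \<subseteq> A \<and> of_real p \<in> closure C"
  shows "\<exists>g b. mapping_out A g b"
proof -
  define K where "K = insert (of_real p) A \<union> cnj ` insert (of_real p) A"
  have cK: "compact K"
    unfolding K_def using A(3) by (intro compact_Un compact_continuous_image continuous_intros)
  have pK: "of_real p \<in> K" by (simp add: K_def)
  have KA: "z \<in> K \<longleftrightarrow> z \<in> A" if "Im z > 0" for z
    using that A(1) by (auto simp: K_def)
  have Kc: "cnj z \<in> K \<longleftrightarrow> z \<in> K" for z
    by (auto simp: K_def image_iff) (metis complex_cnj_cnj complex_cnj_complex_of_real)+
  have accK: "\<exists>C. a \<in> C \<and> connected C \<and> C \<subseteq> K - {of_real p} \<and> of_real p \<in> closure C"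
    if a: "a \<in> K" "a \<noteq> of_real p" for a
  proof -
    have pA: "of_real p \<notin> A" "of_real p \<notin> cnj ` A" using A(1) by (auto simp: image_iff complex_eq_iff)
    have "a \<in> A \<or> cnj a \<in> A" using a by (auto simp: K_def)
    thus ?thesis
    proof
      assume "a \<in> A"
      from acc[OF this] show ?thesis using pA(1) by (force simp: K_def)
    next
      assume "cnj a \<in> A"
      from acc[OF this] obtain C where C: "cnj a \<in> C" "connected C" "C \<subseteq> A" "of_real p \<in> closure C" by blast
      show ?thesis
      proof (intro exI[of _ "cnj ` C"] conjI)
        show "a \<in> cnj ` C" using C(1) by (metis complex_cnj_cnj image_eqI)
        show "connected (cnj ` C)" by (intro connected_continuous_image C continuous_intros)
        have "cnj x \<noteq> of_real p" if "x \<in> C" for x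
          using C(3) pA(2) that by (metis image_eqI subsetD)
        thus "cnj ` C \<subseteq> K - {of_real p}" using C(3) by (auto simp: K_def)
        show "of_real p \<in> closure (cnj ` C)"
          unfolding closure_approachable
        proof (intro allI impI)
          fix e :: real assume "e > 0"
          then obtain y where "y \<in> C" "dist y (of_real p) < e" using C(4) closure_approachable by metis
          moreover have "dist (cnj y) (of_real p) = dist y (of_real p)"
            by (metis complex_cnj_complex_of_real complex_cnj_diff complex_mod_cnj dist_norm)
          ultimately show "\<exists>y\<in>cnj ` C. dist y (of_real p) < e" by (intro bexI[of _ "cnj y"]) auto
        qed
      qed
    qed
  qed
  define W where "W = {x. x = 0 \<or> of_real p + 1 / x \<notin> K}"
  have W: "open W" "simply_connected W"
    unfolding W_def
    by (rule simply_connected_inversion[OF cK con[folded K_def] pK], erule (1) accK)+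
  have W0: "0 \<in> W" by (simp add: W_def)
  have Wc: "cnj x \<in> W" if "x \<in> W" for x
    using that Kc[of "of_real p + 1 / x"] by (auto simp: W_def)
  have "W \<noteq> UNIV"
  proof -
    obtain a where a: "a \<in> A" using A(2) by blast
    hence "a \<noteq> of_real p" using A(1) by auto
    hence "1 / (a - of_real p) \<notin> W" using a by (auto simp: W_def K_def)
    thus ?thesis by blast
  qed
  with Riemann_map_normalized[OF W W0] obtain \<phi> \<psi> d where
    \<phi>: "\<phi> holomorphic_on W" "\<psi> holomorphic_on ball 0 1" "\<phi> 0 = 0" "deriv \<phi> 0 = of_real d" "d > 0" and
    \<phi>\<psi>: "\<And>x. x \<in> W \<Longrightarrow> norm (\<phi> x) < 1 \<and> \<psi> (\<phi> x) = x" and \<psi>\<phi>: "\<And>w. norm w < 1 \<Longrightarrow> \<psi> w \<in> W \<and> \<phi> (\<psi> w) = w"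
    by blast
  have sym: "\<phi> (cnj x) = cnj (\<phi> x)" if "x \<in> W" for x
    by (rule Riemann_map_symmetric[OF W(1) W0 Wc \<phi> \<phi>\<psi> \<psi>\<phi> that])
  have \<phi>nz: "\<phi> x \<noteq> 0" if "x \<in> W" "x \<noteq> 0" for x
    using \<phi>\<psi>[OF that(1)] \<phi>\<psi>[OF W0] \<phi>(3) that(2) by metis
  have real: "\<phi> x \<in> \<real> \<longleftrightarrow> x \<in> \<real>" if "x \<in> W" for x
  proof
    assume "x \<in> \<real>" thus "\<phi> x \<in> \<real>" using sym[OF that] by (simp add: Reals_cnj_iff)
  next
    assume "\<phi> x \<in> \<real>"
    hence "\<phi> (cnj x) = \<phi> x" using sym[OF that] by (simp add: Reals_cnj_iff)
    hence "cnj x = x" using \<phi>\<psi>[OF that] \<phi>\<psi>[OF Wc[OF that]] by metis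
    thus "x \<in> \<real>" by (simp add: Reals_cnj_iff)
  qed
  \<comment> \<open>The lower half-disc corresponds to the part of \<open>W\<close> below the axis:
    the inversion before \<open>\<phi>\<close> and the Joukowski map after it both reverse the sign
    of the imaginary part.\<close>
  define D where "D = {w. norm w < 1 \<and> Im w < 0}"
  have \<psi>neg: "Im (\<psi> w) < 0" if "w \<in> D" for w
  proof (rule ccontr)
    assume nn: "\<not> Im (\<psi> w) < 0"
    have "D = ball 0 1 \<inter> {w. Im w < 0}" by (auto simp: D_def)
    hence "convex D" by (simp add: convex_Int convex_halfspace_Im_lt)
    moreover have "continuous_on D \<psi>"
      by (rule continuous_on_subset[OF holomorphic_on_imp_continuous_on[OF \<phi>(2)]]) (auto simp: D_def)
    ultimately have con: "connected ((\<lambda>w. Im (\<psi> w)) ` D)"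
      by (intro connected_continuous_image continuous_intros convex_connected)
    \<comment> \<open>On the connected set \<open>D\<close> the imaginary part of
      \<open>\<psi>\<close> has no zero, so one point with negative sign decides. It is
      \<open>\<phi> (- \<i> * t)\<close> for small \<open>t\<close>, which lies in \<open>D\<close>
      because the derivative of \<open>\<phi>\<close> at 0 is positive.\<close>
    have nz: "Im (\<psi> v) \<noteq> 0" if "v \<in> D" for v
    proof
      assume "Im (\<psi> v) = 0"
      hence "\<psi> v \<in> \<real>" by (simp add: complex_is_Real_iff)
      hence "v \<in> \<real>" using real[of "\<psi> v"] \<psi>\<phi>[of v] that by (simp add: D_def)
      thus False using that by (simp add: D_def complex_is_Real_iff)
    qed
    obtain q where q: "q holomorphic_on W" "\<And>z. \<phi> z = \<phi> 0 + z * q z" "q 0 = of_real d"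
      using holomorphic_factor_at_0[OF \<phi>(1) W(1)] \<phi>(4) by metis
    have qc: "isCont q 0"
      using holomorphic_on_imp_continuous_on[OF q(1)] W(1) W0 by (simp add: continuous_on_eq_continuous_at)
    have "((\<lambda>t::real. - \<i> * complex_of_real t) \<longlongrightarrow> - \<i> * of_real 0) (at_right 0)"
      by (intro tendsto_intros)
    hence tr: "((\<lambda>t::real. - \<i> * complex_of_real t) \<longlongrightarrow> 0) (at_right 0)" by simp
    have "((\<lambda>t. Re (q (- \<i> * of_real t))) \<longlongrightarrow> Re (q 0)) (at_right 0)"
      by (intro tendsto_intros isCont_tendsto_compose[OF qc tr])
    hence "eventually (\<lambda>t. 0 < Re (q (- \<i> * of_real t))) (at_right 0)"
      by (rule order_tendstoD) (simp add: q(3) \<phi>(5))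
    moreover have "eventually (\<lambda>t. - \<i> * of_real t \<in> W) (at_right 0)"
      using topological_tendstoD[OF tr W(1) W0] .
    moreover have "eventually (\<lambda>t::real. t > 0) (at_right 0)" by (rule eventually_at_right_less)
    ultimately have "eventually (\<lambda>t. 0 < Re (q (- \<i> * of_real t)) \<and> - \<i> * of_real t \<in> W \<and> t > 0) (at_right 0)"
      by eventually_elim simp
    then obtain t :: real where t: "0 < Re (q (- \<i> * of_real t))" "- \<i> * of_real t \<in> W" "t > 0"
      using eventually_happens'[OF trivial_limit_at_right_real] by blast
    have "Im (\<phi> (- \<i> * of_real t)) < 0"
      using t q(2)[of "- \<i> * of_real t"] \<phi>(3) by simp
    hence tD: "\<phi> (- \<i> * of_real t) \<in> D" using \<phi>\<psi>[OF t(2)] by (simp add: D_def)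
    have "Im (\<psi> (\<phi> (- \<i> * of_real t))) < 0" using \<phi>\<psi>[OF t(2)] t(3) by simp
    hence "0 \<in> (\<lambda>w. Im (\<psi> w)) ` D"
      using connectedD_interval[OF con imageI[OF tD] imageI[OF \<open>w \<in> D\<close>], of 0] nn by linarith
    thus False using nz by force
  qed
  have \<phi>neg: "Im (\<phi> x) < 0" if x: "x \<in> W" "Im x < 0" for x
  proof (rule ccontr)
    assume nn: "\<not> Im (\<phi> x) < 0"
    have "\<phi> x \<notin> \<real>" using x real[OF x(1)] by (simp add: complex_is_Real_iff)
    hence "Im (\<phi> (cnj x)) < 0" using nn sym[OF x(1)] by (simp add: complex_is_Real_iff)
    hence "\<phi> (cnj x) \<in> D" using \<phi>\<psi>[OF Wc[OF x(1)]] by (simp add: D_def)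
    from \<psi>neg[OF this] \<phi>\<psi>[OF Wc[OF x(1)]] x(2) show False by simp
  qed
  have rr: "\<phi> x \<in> \<real>" if "x \<in> W" "x \<in> \<real>" for x using real that by blast
  obtain c0 c1 M r where r: "r > 0" and ex: "\<And>x. norm x < r \<Longrightarrow> x \<noteq> 0 \<Longrightarrow>
     norm (of_real d * (\<phi> x + 1 / \<phi> x) - 1 / x - of_real c0 - of_real c1 * x) \<le> M * (norm x)\<^sup>2"
    by (rule joukowski_expansion[OF W(1) W0 \<phi>(1,3,4,5)]) (erule (1) \<phi>nz, erule (1) rr, rule that)
  define \<iota> where "\<iota> = (\<lambda>z. 1 / (z - complex_of_real p))"
  \<comment> \<open>Since \<open>1 / \<iota> z = z - p\<close>, adding \<open>p - c0\<close> cancels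
    the constant term, and the coefficient \<open>c1\<close> of \<open>\<iota> z\<close> becomes the
    capacity.\<close>
  define g where "g = (\<lambda>z. of_real d * (\<phi> (\<iota> z) + 1 / \<phi> (\<iota> z)) + of_real (p - c0))"
  have \<iota>: "\<iota> z \<in> W" "Im (\<iota> z) < 0" "\<iota> z \<noteq> 0" "of_real p + 1 / \<iota> z = z" if "z \<in> upper_hp - A" for z
  proof -
    have zp: "z - of_real p \<noteq> 0" using that by (auto simp: complex_eq_iff)
    show "\<iota> z \<noteq> 0" "of_real p + 1 / \<iota> z = z" using zp by (auto simp: \<iota>_def)
    thus "\<iota> z \<in> W" using that KA by (auto simp: W_def)
    show "Im (\<iota> z) < 0" using that zp by (simp add: \<iota>_def Im_complex_div_lt_0)
  qed
  have gim: "Im (g z) > 0" if "z \<in> upper_hp - A" for z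
  proof -
    let ?w = "\<phi> (\<iota> z)"
    have w: "norm ?w < 1" "?w \<noteq> 0" "Im ?w < 0"
      using \<iota>[OF that] \<phi>\<psi> \<phi>nz \<phi>neg by blast+
    hence "1 - 1 / (norm ?w)\<^sup>2 < 0" by (simp add: power_less_one_iff)
    hence "Im (?w + 1 / ?w) > 0"
      unfolding joukowski_Im using w(3) by (simp add: mult_neg_neg)
    moreover have "Im (g z) = d * Im (?w + 1 / ?w)"
      by (simp add: g_def)
    ultimately show ?thesis using \<phi>(5) by simp
  qed
  have "mapping_out A g c1"
    unfolding mapping_out_def
  proof (intro conjI)
    show "bounded A" using compact_imp_bounded[OF A(3)] by (rule bounded_subset) auto
    show "A \<subseteq> upper_hp" by (rule A(1))
    have "upper_hp - A = upper_hp - insert (of_real p) A" by auto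
    thus "open (upper_hp - A)"
      by (simp only:) (intro open_Diff open_upper_hp compact_imp_closed[OF A(3)])
    have \<iota>h: "\<iota> holomorphic_on upper_hp - A"
      unfolding \<iota>_def by (intro holomorphic_intros) (auto simp: complex_eq_iff)
    have "(\<phi> \<circ> \<iota>) holomorphic_on upper_hp - A"
      using \<iota> by (intro holomorphic_on_compose_gen[OF \<iota>h \<phi>(1)]) blast
    thus "g holomorphic_on upper_hp - A"
      unfolding g_def o_def using \<iota> \<phi>nz by (intro holomorphic_intros) auto
    show "inj_on g (upper_hp - A)"
    proof (rule inj_onI)
      fix x y assume x: "x \<in> upper_hp - A" and y: "y \<in> upper_hp - A" and eq: "g x = g y"
      have "\<phi> (\<iota> x) + 1 / \<phi> (\<iota> x) = \<phi> (\<iota> y) + 1 / \<phi> (\<iota> y)"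
        using eq \<phi>(5) by (simp add: g_def)
      hence "\<phi> (\<iota> x) = \<phi> (\<iota> y)"
        by (rule joukowski_inj) (use \<iota>[OF x] \<iota>[OF y] \<phi>\<psi> \<phi>nz in blast)+
      hence "\<psi> (\<phi> (\<iota> x)) = \<psi> (\<phi> (\<iota> y))" by (rule arg_cong)
      hence "\<iota> x = \<iota> y" using \<phi>\<psi>[OF \<iota>(1)[OF x]] \<phi>\<psi>[OF \<iota>(1)[OF y]] by simp
      thus "x = y" using \<iota>(4)[OF x] \<iota>(4)[OF y] by metis
    qed
    show "g ` (upper_hp - A) = upper_hp"
    proof (intro equalityI subsetI)
      fix x assume "x \<in> g ` (upper_hp - A)" thus "x \<in> upper_hp" using gim by auto
    next
      fix x assume "x \<in> upper_hp"
      hence "Im ((x - of_real (p - c0)) / of_real d) > 0" using \<phi>(5) by simp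
      then obtain w where w: "norm w < 1" "Im w < 0" "w + 1 / w = (x - of_real (p - c0)) / of_real d"
        using joukowski_surj by blast
      let ?x = "\<psi> w"
      have xW: "?x \<in> W" "\<phi> ?x = w" using \<psi>\<phi>[OF w(1)] by auto
      have im: "Im ?x < 0" using \<psi>neg[of w] w by (simp add: D_def)
      hence x0: "?x \<noteq> 0" by auto
      let ?z = "of_real p + 1 / ?x"
      have "Im ?z > 0" using im x0 by (simp add: Im_complex_div_gt_0)
      moreover have "?z \<notin> K" using xW x0 by (simp add: W_def)
      ultimately have z: "?z \<in> upper_hp - A" using KA[of ?z] by auto
      have "g ?z = of_real d * (w + 1 / w) + of_real (p - c0)"
        using xW x0 by (simp add: g_def \<iota>_def)
      also have "\<dots> = x" using \<phi>(5) w(3) by simp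
      finally show "x \<in> g ` (upper_hp - A)" using z by (metis image_eqI)
    qed
    show "\<exists>M R. \<forall>z\<in>upper_hp - A. R < norm z \<longrightarrow>
          norm (g z - z - complex_of_real c1 / z) \<le> M / (norm z)^2"
    proof (intro exI ballI impI)
      \<comment> \<open>The first bound gives \<open>norm (z - p) \<ge> norm z / 2\<close>; the
        second then puts \<open>\<iota> z\<close> into the disc of radius \<open>r\<close> where the
        expansion holds.\<close>
      fix z assume z: "z \<in> upper_hp - A" and nz: "max (2 * \<bar>p\<bar>) (2 / r) < norm z"
      have z0: "z \<noteq> 0" using z by auto
      have "norm z \<le> norm (z - of_real p) + norm (complex_of_real p)" by (metis diff_add_cancel norm_triangle_ineq)
      hence zp: "norm z / 2 \<le> norm (z - of_real p)" using nz by simp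
      hence zp0: "norm (z - of_real p) > 0" using z0 by (smt (verit) half_gt_zero zero_less_norm_iff)
      have "norm (\<iota> z) < r"
      proof -
        have "1 / r < norm (z - of_real p)" using zp nz by simp
        thus ?thesis using r zp0 by (simp add: \<iota>_def norm_divide field_simps)
      qed
      note bound = ex[OF this \<iota>(3)[OF z]]
      have "1 / \<iota> z = z - of_real p" using \<iota>(4)[OF z] by (metis add_diff_cancel_left')
      hence "of_real d * (\<phi> (\<iota> z) + 1 / \<phi> (\<iota> z)) - 1 / \<iota> z - of_real c0 - of_real c1 * \<iota> z
          = g z - z - of_real c1 * \<iota> z" by (simp add: g_def)
      hence 1: "norm (g z - z - of_real c1 * \<iota> z) \<le> M * (norm (\<iota> z))\<^sup>2"
        using bound by (simp only:)
      have i2: "norm (\<iota> z) \<le> 2 / norm z"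
        using zp zp0 z0 by (simp add: \<iota>_def norm_divide field_simps)
      have "M * (norm (\<iota> z))\<^sup>2 \<le> \<bar>M\<bar> * (2 / norm z)\<^sup>2"
        using i2 by (intro mult_mono power_mono) auto
      hence 2: "norm (g z - z - of_real c1 * \<iota> z) \<le> 4 * \<bar>M\<bar> / (norm z)\<^sup>2"
        using 1 by (simp add: power_divide mult.commute)
      have "of_real c1 * \<iota> z - of_real c1 / z = of_real c1 * (\<iota> z - 1 / z)"
        by (simp add: right_diff_distrib)
      also have "\<iota> z - 1 / z = of_real p * \<iota> z / z"
        using z0 zp0 by (simp add: \<iota>_def field_simps)
      finally have "of_real c1 * \<iota> z - of_real c1 / z = of_real c1 * (of_real p * \<iota> z / z)" .
      hence "norm (of_real c1 * \<iota> z - of_real c1 / z) = \<bar>c1\<bar> * \<bar>p\<bar> / norm z * norm (\<iota> z)"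
        by (simp add: norm_mult norm_divide)
      also have "\<dots> \<le> \<bar>c1\<bar> * \<bar>p\<bar> / norm z * (2 / norm z)"
        using i2 by (intro mult_left_mono) auto
      finally have 3: "norm (of_real c1 * \<iota> z - of_real c1 / z) \<le> 2 * \<bar>c1\<bar> * \<bar>p\<bar> / (norm z)\<^sup>2"
        by (simp add: power2_eq_square mult_ac)
      have "g z - z - of_real c1 / z = (g z - z - of_real c1 * \<iota> z) + (of_real c1 * \<iota> z - of_real c1 / z)" by simp
      hence "norm (g z - z - of_real c1 / z) \<le> norm (g z - z - of_real c1 * \<iota> z) + norm (of_real c1 * \<iota> z - of_real c1 / z)"
        by (metis norm_triangle_ineq)
      also have "\<dots> \<le> (4 * \<bar>M\<bar> + 2 * \<bar>c1\<bar> * \<bar>p\<bar>) / (norm z)\<^sup>2"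
        using 2 3 by (simp add: add_divide_distrib)
      finally show "norm (g z - z - of_real c1 / z) \<le> (4 * \<bar>M\<bar> + 2 * \<bar>c1\<bar> * \<bar>p\<bar>) / (norm z)\<^sup>2" .
    qed
  qed
  thus ?thesis by blast
qed

section \<open>Slits, pairs of slits and half-discs as hulls\<close>

lemma simple_slit_mono:
  assumes "simple_slit \<gamma> T" "0 < t" "t \<le> T"
  shows "simple_slit \<gamma> t"
  using assms unfolding simple_slit_def
  by (auto intro: continuous_on_subset inj_on_subset)

lemma simple_slit_compact:
  assumes "simple_slit \<gamma> t"
  shows "compact (\<gamma> ` {0..t})" "\<gamma> ` {0..t} = insert (\<gamma> 0) (\<gamma> ` {0<..t})"
proof -
  show "compact (\<gamma> ` {0..t})"
    using assms by (intro compact_continuous_image) (auto simp: simple_slit_def)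
  have "{0..t} = insert 0 {0<..t}" using assms by (auto simp: simple_slit_def)
  thus "\<gamma> ` {0..t} = insert (\<gamma> 0) (\<gamma> ` {0<..t})" by simp
qed

text \<open>The slit and its mirror image meet only at the real base point, so together they form
  the arc \<open>\<delta>\<close>, and an arc does not separate the plane.\<close>

lemma simple_slit_double_connected:
  assumes s: "simple_slit \<gamma> t"
  shows "connected (- (\<gamma> ` {0..t} \<union> cnj ` \<gamma> ` {0..t}))"
proof -
  have t: "0 < t" and c: "continuous_on {0..t} \<gamma>" and inj: "inj_on \<gamma> {0..t}" and i0: "Im (\<gamma> 0) = 0"
    and ip: "\<And>s. 0 < s \<Longrightarrow> s \<le> t \<Longrightarrow> Im (\<gamma> s) > 0"
    using s by (auto simp: simple_slit_def image_subset_iff)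
  define \<delta> where "\<delta> = (\<lambda>s. if 0 \<le> s then \<gamma> s else cnj (\<gamma> (- s)))"
  have "continuous_on ({0..t} \<union> {-t..0}) \<delta>"
    unfolding \<delta>_def
  proof (rule continuous_on_cases)
    show "continuous_on {-t..0} (\<lambda>s. cnj (\<gamma> (- s)))"
      by (intro continuous_intros continuous_on_compose2[OF c]) auto
    show "\<forall>x. x \<in> {0..t} \<and> \<not> 0 \<le> x \<or> x \<in> {-t..0} \<and> 0 \<le> x \<longrightarrow> \<gamma> x = cnj (\<gamma> (- x))"
      using i0 by (auto simp: complex_eq_iff)
  qed (use c in auto)
  moreover have "{0..t} \<union> {-t..0} = {-t..t}" using t by auto
  ultimately have c\<delta>: "continuous_on {-t..t} \<delta>" by simp
  have im: "Im (\<delta> s) > 0 \<longleftrightarrow> s > 0" "Im (\<delta> s) < 0 \<longleftrightarrow> s < 0" if "s \<in> {-t..t}" for s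
    using ip[of s] ip[of "-s"] i0 that by (auto simp: \<delta>_def; cases "s = 0"; force)+
  have "inj_on \<delta> {-t..t}"
  proof (rule inj_onI)
    fix x y assume x: "x \<in> {-t..t}" and y: "y \<in> {-t..t}" and eq: "\<delta> x = \<delta> y"
    have "x > 0 \<longleftrightarrow> y > 0" "x < 0 \<longleftrightarrow> y < 0" using im[OF x] im[OF y] eq by auto
    then consider "x > 0" "y > 0" | "x = 0" "y = 0" | "x < 0" "y < 0" by linarith
    thus "x = y"
    proof cases
      case 1 thus ?thesis using eq x y inj_onD[OF inj, of x y] by (simp add: \<delta>_def)
    next
      case 3 thus ?thesis using eq x y inj_onD[OF inj, of "-x" "-y"] by (simp add: \<delta>_def)
    qed auto
  qed
  moreover have "\<delta> ` {-t..t} = \<gamma> ` {0..t} \<union> cnj ` \<gamma> ` {0..t}"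
  proof (intro equalityI subsetI)
    fix z assume "z \<in> \<delta> ` {-t..t}"
    then obtain s where s: "s \<in> {-t..t}" "z = \<delta> s" by blast
    show "z \<in> \<gamma> ` {0..t} \<union> cnj ` \<gamma> ` {0..t}"
      using s by (cases "0 \<le> s") (auto simp: \<delta>_def)
  next
    fix z assume "z \<in> \<gamma> ` {0..t} \<union> cnj ` \<gamma> ` {0..t}"
    then consider s where "s \<in> {0..t}" "z = \<gamma> s" | s where "s \<in> {0..t}" "z = cnj (\<gamma> s)" by blast
    thus "z \<in> \<delta> ` {-t..t}"
    proof cases
      case (1 s) thus ?thesis by (intro image_eqI[of _ _ s]) (auto simp: \<delta>_def)
    next
      case (2 s)
      show ?thesis
        using 2 i0 by (intro image_eqI[of _ _ "-s"]) (auto simp: \<delta>_def complex_eq_iff)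
    qed
  qed
  ultimately have "{-t..t} homeomorphic (\<gamma> ` {0..t} \<union> cnj ` \<gamma> ` {0..t})"
    using c\<delta> by (intro homeomorphic_compact[of _ \<delta>]) auto
  hence "(\<gamma> ` {0..t} \<union> cnj ` \<gamma> ` {0..t}) homeomorphic {-t..t}"
    by (rule homeomorphic_sym[THEN iffD1])
  thus ?thesis
    by (rule connected_complement_homeomorphic_convex_compact) auto
qed

lemma simple_slit_accessible:
  assumes s: "simple_slit \<gamma> t" and a: "a \<in> \<gamma> ` {0<..t}"
  shows "\<exists>C. a \<in> C \<and> connected C \<and> C \<subseteq> \<gamma> ` {0<..t} \<and> \<gamma> 0 \<in> closure C"
proof (intro exI conjI)
  have t: "0 < t" and c: "continuous_on {0..t} \<gamma>" using s by (auto simp: simple_slit_def)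
  show "a \<in> \<gamma> ` {0<..t}" by fact
  show "connected (\<gamma> ` {0<..t})"
    by (intro connected_continuous_image continuous_on_subset[OF c]) auto
  have "closure {0<..t} = {0..t}" using t by simp
  moreover have "\<gamma> ` closure {0<..t} \<subseteq> closure (\<gamma> ` {0<..t})"
    by (rule image_closure_subset) (simp_all add: c calculation closure_subset)
  ultimately have "\<gamma> ` {0..t} \<subseteq> closure (\<gamma> ` {0<..t})" by simp
  thus "\<gamma> 0 \<in> closure (\<gamma> ` {0<..t})" using t by auto
qed simp

lemma simple_slit_mapping_out:
  assumes s: "simple_slit \<gamma> t"
  shows "\<exists>g b. mapping_out (\<gamma> ` {0<..t}) g b"
proof (rule mapping_out_exists)
  have 0: "complex_of_real (Re (\<gamma> 0)) = \<gamma> 0" using s by (simp add: simple_slit_def complex_eq_iff)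
  show "\<gamma> ` {0<..t} \<subseteq> upper_hp" "\<gamma> ` {0<..t} \<noteq> {}" using s by (auto simp: simple_slit_def)
  show "compact (insert (complex_of_real (Re (\<gamma> 0))) (\<gamma> ` {0<..t}))"
    using simple_slit_compact[OF s] by (simp only: 0)
  show "connected (- (insert (complex_of_real (Re (\<gamma> 0))) (\<gamma> ` {0<..t}) \<union> cnj ` insert (complex_of_real (Re (\<gamma> 0))) (\<gamma> ` {0<..t})))"
    using simple_slit_double_connected[OF s] simple_slit_compact(2)[OF s] by (simp only: 0)
  show "\<exists>C. a \<in> C \<and> connected C \<and> C \<subseteq> \<gamma> ` {0<..t} \<and> complex_of_real (Re (\<gamma> 0)) \<in> closure C" if "a \<in> \<gamma> ` {0<..t}" for a
    unfolding 0 by (rule simple_slit_accessible[OF s that])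
qed

text \<open>Each doubled slit is an arc that does not separate the plane, and the two arcs meet only
  at the base point. By Janiszewski's theorem their union does not separate the plane
  either.\<close>

lemma two_slits_mapping_out:
  assumes s1: "simple_slit \<gamma>1 t1" and s2: "simple_slit \<gamma>2 t2" and eq: "\<gamma>1 0 = \<gamma>2 0"
    and dis: "\<gamma>1 ` {0<..t1} \<inter> \<gamma>2 ` {0<..t2} = {}"
  shows "\<exists>g b. mapping_out (\<gamma>1 ` {0<..t1} \<union> \<gamma>2 ` {0<..t2}) g b"
proof (rule mapping_out_exists)
  let ?A = "\<gamma>1 ` {0<..t1} \<union> \<gamma>2 ` {0<..t2}"
  let ?p = "complex_of_real (Re (\<gamma>1 0))"
  have 0: "?p = \<gamma>1 0" using s1 by (simp add: simple_slit_def complex_eq_iff)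
  have 02: "?p = \<gamma>2 0" using 0 eq by simp
  define K1 where "K1 = \<gamma>1 ` {0..t1} \<union> cnj ` \<gamma>1 ` {0..t1}"
  define K2 where "K2 = \<gamma>2 ` {0..t2} \<union> cnj ` \<gamma>2 ` {0..t2}"
  have e1: "\<gamma>1 ` {0..t1} = insert ?p (\<gamma>1 ` {0<..t1})"
    unfolding 0 by (rule simple_slit_compact(2)[OF s1])
  have e2: "\<gamma>2 ` {0..t2} = insert ?p (\<gamma>2 ` {0<..t2})"
    unfolding 02 by (rule simple_slit_compact(2)[OF s2])
  have u: "insert ?p ?A = \<gamma>1 ` {0..t1} \<union> \<gamma>2 ` {0..t2}" unfolding e1 e2 by blast
  show A: "?A \<subseteq> upper_hp" "?A \<noteq> {}" using s1 s2 by (auto simp: simple_slit_def)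
  show "compact (insert ?p ?A)"
    unfolding u by (intro compact_Un simple_slit_compact s1 s2)
  have K: "insert ?p ?A \<union> cnj ` insert ?p ?A = K1 \<union> K2"
    unfolding u K1_def K2_def by blast
  have up1: "\<And>z. z \<in> \<gamma>1 ` {0<..t1} \<Longrightarrow> Im z > 0" and up2: "\<And>z. z \<in> \<gamma>2 ` {0<..t2} \<Longrightarrow> Im z > 0"
    using A by auto
  have ci: "w \<in> cnj ` S \<longleftrightarrow> cnj w \<in> S" for w S by (metis complex_cnj_cnj image_iff)
  have "K1 \<inter> K2 = {?p}"
  proof (intro equalityI subsetI)
    fix z assume z: "z \<in> K1 \<inter> K2"
    show "z \<in> {?p}"
    proof (rule ccontr)
      assume "z \<notin> {?p}"
      hence zp: "z \<noteq> ?p" "cnj z \<noteq> ?p" by (auto simp: complex_eq_iff)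
      have "z \<in> \<gamma>1 ` {0<..t1} \<or> cnj z \<in> \<gamma>1 ` {0<..t1}" "z \<in> \<gamma>2 ` {0<..t2} \<or> cnj z \<in> \<gamma>2 ` {0<..t2}"
        using z zp unfolding K1_def K2_def e1 e2 Int_iff Un_iff ci insert_iff by blast+
      moreover have "Im z > 0 \<Longrightarrow> Im (cnj z) > 0 \<Longrightarrow> False" by simp
      ultimately show False using dis up1 up2 by blast
    qed
  next
    fix z assume "z \<in> {?p}" thus "z \<in> K1 \<inter> K2" unfolding K1_def K2_def e1 e2 by simp
  qed
  moreover have "compact K1" "compact K2"
    unfolding K1_def K2_def
    by (intro compact_Un compact_continuous_image[OF _ simple_slit_compact(1)[OF s1]] 
       compact_continuous_image[OF _ simple_slit_compact(1)[OF s2]] simple_slit_compact(1) s1 s2 continuous_intros)+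
  moreover have "connected (- K1)" "connected (- K2)"
    unfolding K1_def K2_def by (intro simple_slit_double_connected s1 s2)+
  ultimately have "connected (- (K1 \<union> K2))"
    by (intro Janiszewski_connected) (auto intro: compact_imp_closed)
  thus "connected (- (insert ?p ?A \<union> cnj ` insert ?p ?A))" unfolding K .
  fix a assume "a \<in> ?A"
  then consider "a \<in> \<gamma>1 ` {0<..t1}" | "a \<in> \<gamma>2 ` {0<..t2}" by blast
  thus "\<exists>C. a \<in> C \<and> connected C \<and> C \<subseteq> ?A \<and> ?p \<in> closure C"
  proof cases
    case 1
    from simple_slit_accessible[OF s1 this] show ?thesis unfolding 0 by blast
  next
    case 2
    from simple_slit_accessible[OF s2 this] show ?thesis unfolding 02 by blast
  qed
qed

text \<open>An explicit hull enclosing any given bounded one: it bounds capacities by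
  \<open>R^2\<close> and supplies the complementary capacity in the convergence proof. The map is
  the Joukowski map in the variable \<open>R / z\<close>, scaled by \<open>R\<close>.\<close>

lemma half_disc_mapping_out:
  assumes R: "R > 0"
  shows "mapping_out {z. Im z > 0 \<and> norm z \<le> R} (\<lambda>z. z + of_real (R\<^sup>2) / z) (R\<^sup>2)"
  unfolding mapping_out_def
proof (intro conjI)
  let ?E = "{z. Im z > 0 \<and> norm z \<le> R}" and ?g = "\<lambda>z. z + of_real (R\<^sup>2) / z"
  have D: "z \<in> upper_hp - ?E \<longleftrightarrow> Im z > 0 \<and> R < norm z" for z by auto
  have g: "?g z = of_real R * (of_real R / z + 1 / (of_real R / z))" for z :: complex
    using R by (cases "z = 0") (auto simp: field_simps power2_eq_square)
  have w: "norm (of_real R / z) < 1" "of_real R / z \<noteq> 0" "Im (of_real R / z) < 0" if "Im z > 0" "R < norm z" for z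
  proof -
    have "z \<noteq> 0" using that by auto
    thus "norm (of_real R / z) < 1" "of_real R / z \<noteq> 0" using that R by (auto simp: norm_divide)
    show "Im (of_real R / z) < 0" using that R \<open>z \<noteq> 0\<close> by (simp add: Im_complex_div_lt_0)
  qed
  show "bounded ?E" by (rule boundedI[of _ R]) simp
  show "?E \<subseteq> upper_hp" by auto
  have "upper_hp - ?E = upper_hp \<inter> - cball 0 R" by auto
  thus "open (upper_hp - ?E)" using open_upper_hp by (simp add: open_Int open_Compl)
  show "?g holomorphic_on upper_hp - ?E" by (intro holomorphic_intros) auto
  show "inj_on ?g (upper_hp - ?E)"
  proof (rule inj_onI)
    fix x y assume x: "x \<in> upper_hp - ?E" and y: "y \<in> upper_hp - ?E" and eq: "?g x = ?g y"
    note x = x[unfolded D] and y = y[unfolded D]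
    have "of_real R / x = of_real R / y"
      by (rule joukowski_inj) (use eq[unfolded g] R w x y in auto)
    moreover have "x \<noteq> 0" "y \<noteq> 0" using x y by auto
    ultimately show "x = y" using R by (simp add: field_simps)
  qed
  show "?g ` (upper_hp - ?E) = upper_hp"
  proof (intro equalityI subsetI)
    fix x assume "x \<in> ?g ` (upper_hp - ?E)"
    then obtain z where z': "z \<in> upper_hp - ?E" and zx: "x = ?g z" by blast
    note z = z'[unfolded D, THEN conjunct1] z'[unfolded D, THEN conjunct2] zx
    let ?w = "of_real R / z"
    have "1 - 1 / (norm ?w)\<^sup>2 < 0" using w[OF z(1,2)] by (simp add: power_less_one_iff)
    hence "Im (?w + 1 / ?w) > 0"
      unfolding joukowski_Im using w(3)[OF z(1,2)] by (simp add: mult_neg_neg)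
    hence "Im (of_real R * (?w + 1 / ?w)) > 0" using R by (simp del: plus_complex.simps)
    thus "x \<in> upper_hp" unfolding z(3) g by simp
  next
    fix x assume "x \<in> upper_hp"
    hence "Im (x / of_real R) > 0" using R by simp
    then obtain v where v: "norm v < 1" "Im v < 0" "v + 1 / v = x / of_real R" using joukowski_surj by blast
    have v0: "v \<noteq> 0" using v by auto
    let ?z = "of_real R / v"
    have "Im ?z > 0" using v v0 R by (simp add: Im_complex_div_gt_0 mult_pos_neg)
    moreover have "R < norm ?z" using v v0 R by (simp add: norm_divide field_simps)
    ultimately have "?z \<in> upper_hp - ?E" by (simp only: D)
    moreover have "?g ?z = x" unfolding g using v v0 R by simp
    ultimately show "x \<in> ?g ` (upper_hp - ?E)" by (metis (no_types, lifting) image_eqI)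
  qed
  show "\<exists>M R'. \<forall>z\<in>upper_hp - ?E. R' < norm z \<longrightarrow> norm (?g z - z - complex_of_real (R\<^sup>2) / z) \<le> M / (norm z)^2"
    by (intro exI[of _ 0]) auto
qed

section \<open>Continuity of the capacity\<close>

text \<open>The Pick bound against the empty hull: \<open>g\<close> moves points little wherever
  \<open>Im (g z)\<close> is not small. This makes families of inverse maps locally bounded.\<close>

lemma mapping_out_dist:
  assumes m: "mapping_out A g b" and z: "Im z > 0" "z \<notin> A"
  shows "norm (z - g z) * Im (g z) \<le> b"
proof -
  have b: "b \<ge> 0" by (rule mapping_out_nonneg[OF m])
  have "(norm (z - g z))\<^sup>2 * Im (g z) \<le> (b - 0) * Im (z - g z)"
    by (rule mapping_out_diff_pick(1)[OF mapping_out_empty m _ z]) simp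
  also have "\<dots> \<le> b * norm (z - g z)"
    using abs_Im_le_cmod[of "z - g z"] b by (simp add: mult_left_mono)
  finally have "norm (z - g z) * (norm (z - g z) * Im (g z)) \<le> norm (z - g z) * b"
    by (simp only: power2_eq_square mult_ac)
  thus ?thesis using b by (cases "z = g z") simp_all
qed

text \<open>Converse to \<open>mapping_out_diff_bound\<close>: along the path the product tends to
  \<open>b' - b\<close>, because the difference of heights is asymptotically
  \<open>(b' - b) / y\<close> and \<open>Im g'\<close> is asymptotically \<open>y\<close>.\<close>

lemma mapping_out_cap_diff_le:
  assumes m: "mapping_out A g b" and m': "mapping_out B g' b'"
    and z: "((\<lambda>y. z y / of_real y) \<longlongrightarrow> \<i>) at_top"
    and le: "eventually (\<lambda>y. (Im (g (z y)) - Im (g' (z y))) * Im (g' (z y)) \<le> c) at_top"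
  shows "b' - b \<le> c"
proof -
  note r = tendsto_ray_ident(1)
  have "((\<lambda>y. of_real y * (g (z y) - z y) - of_real y * (g' (z y) - z y)) \<longlongrightarrow> - \<i> * of_real b - (- \<i> * of_real b')) at_top"
    by (intro tendsto_diff mapping_out_ray(1)[OF m r z] mapping_out_ray(1)[OF m' r z])
  from tendsto_Im[OF this]
  have "((\<lambda>y. y * (Im (g (z y)) - Im (g' (z y)))) \<longlongrightarrow> b' - b) at_top"
    by (simp add: algebra_simps)
  moreover have "((\<lambda>y. Im (g' (z y) / of_real y)) \<longlongrightarrow> 1) at_top"
    using tendsto_Im[OF mapping_out_ray(2)[OF m' r z]] by simp
  ultimately have "((\<lambda>y. y * (Im (g (z y)) - Im (g' (z y))) * Im (g' (z y) / of_real y)) \<longlongrightarrow> (b' - b) * 1) at_top"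
    by (rule tendsto_mult)
  moreover have "eventually (\<lambda>y. y * (Im (g (z y)) - Im (g' (z y))) * Im (g' (z y) / of_real y) \<le> c) at_top"
    using le eventually_gt_at_top[of 0] by eventually_elim simp
  ultimately have "(b' - b) * 1 \<le> c"
    by (intro tendsto_upperbound[of _ _ at_top]) auto
  thus ?thesis by simp
qed

text \<open>A Harnack inequality. At half the radius Schwarz-Pick gives
  \<open>n \<le> N / 2\<close>; the triangle inequality then yields the factor 2, and
  \<open>norm_diff_cnj_sq\<close> with \<open>N \<ge> Im (F c)\<close> yields
  \<open>3 / 16\<close>.\<close>

lemma schwarz_pick_ball_half:
  assumes F: "F holomorphic_on ball c r" "\<And>z. z \<in> ball c r \<Longrightarrow> Im (F z) > 0"
    and r: "r > 0" and z: "norm (z - c) \<le> r / 2"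
  shows "norm (F z - F c) \<le> 2 * Im (F c)" "3 / 16 * Im (F c) \<le> Im (F z)"
proof -
  have zb: "z \<in> ball c r" using z r by (simp add: dist_norm norm_minus_commute)
  define N where "N = norm (F z - cnj (F c))"
  define n where "n = norm (F z - F c)"
  have p: "Im (F c) > 0" "Im (F z) > 0" using F(2) zb r by auto
  have "n \<le> norm (z - c) / r * N"
    unfolding n_def N_def by (rule schwarz_pick_ball[OF F zb])
  also have "\<dots> \<le> 1 / 2 * N"
    using z r by (intro mult_right_mono) (auto simp: field_simps N_def)
  finally have nN: "n \<le> N / 2" by simp
  have "F z - cnj (F c) = (F z - F c) + (F c - cnj (F c))" by simp
  hence "N \<le> n + norm (F c - cnj (F c))" unfolding N_def n_def by (metis norm_triangle_ineq)
  also have "norm (F c - cnj (F c)) = 2 * Im (F c)"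
    using p by (simp add: complex_diff_cnj norm_mult)
  finally show "norm (F z - F c) \<le> 2 * Im (F c)" using nN by (simp add: n_def)
  have "N\<^sup>2 = n\<^sup>2 + 4 * Im (F z) * Im (F c)"
    unfolding N_def n_def by (rule norm_diff_cnj_sq)
  moreover have "n\<^sup>2 \<le> (N / 2)\<^sup>2" using nN by (intro power_mono) (auto simp: n_def)
  hence "n\<^sup>2 \<le> N\<^sup>2 / 4" by (simp add: power_divide)
  ultimately have "3 / 4 * N\<^sup>2 \<le> 4 * Im (F z) * Im (F c)" by linarith
  moreover have "(Im (F c))\<^sup>2 \<le> N\<^sup>2"
    using abs_Im_le_cmod[of "F z - cnj (F c)"] p by (intro power_mono) (auto simp: N_def)
  ultimately have "(3 / 16 * Im (F c)) * Im (F c) \<le> Im (F z) * Im (F c)"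
    by (simp add: power2_eq_square)
  thus "3 / 16 * Im (F c) \<le> Im (F z)" using p by simp
qed

lemma half_disc_Im: "Im (z + complex_of_real (R\<^sup>2) / z) = Im z - R\<^sup>2 * Im z / (norm z)\<^sup>2"
  by (simp add: Im_divide cmod_power2)

lemma ray_of_bound:
  assumes "\<And>w. Im w > 0 \<Longrightarrow> norm (f w - w) \<le> c / Im w"
  shows "((\<lambda>y. f (\<i> * of_real y) / of_real y) \<longlongrightarrow> \<i>) at_top"
proof -
  have l: "((\<lambda>y::real. c / y) \<longlongrightarrow> 0) at_top"
    by (intro tendsto_divide_0[OF tendsto_const] filterlim_at_top_imp_at_infinity filterlim_ident)
  have "((\<lambda>y. f (\<i> * of_real y) / of_real y - \<i>) \<longlongrightarrow> 0) at_top"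
  proof (rule Lim_null_comparison[OF _ l])
    show "\<forall>\<^sub>F y in at_top. norm (f (\<i> * of_real y) / of_real y - \<i>) \<le> c / y"
      using eventually_ge_at_top[of 1]
    proof eventually_elim
      case (elim y)
      have "f (\<i> * of_real y) / of_real y - \<i> = (f (\<i> * of_real y) - \<i> * of_real y) / of_real y"
        using elim by (simp add: field_simps)
      also have "norm \<dots> \<le> norm (f (\<i> * of_real y) - \<i> * of_real y)"
        using elim by (simp add: norm_divide divide_le_eq mult_le_cancel_left1)
      also have "\<dots> \<le> c / y" using assms[of "\<i> * of_real y"] elim by simp
      finally show ?case .
    qed
  qed
  thus ?thesis by (simp add: LIM_zero_iff)
qed

text \<open>Caratheodory kernel convergence, phrased for the inverse maps: they form a normal family
  whose limits are again conformal onto the complement of the limit set. Capacity can only be lost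
  in the limit, and the same argument for the complementary capacity \<open>R\<^sup>2 - b\<close> in an enclosing
  half-disc excludes a loss.\<close>
lemma mapping_out_cap_convergent_subseq:
  fixes A :: "nat \<Rightarrow> complex set"
  assumes mA: "\<And>n. mapping_out (A n) (g n) (b n)" and m: "mapping_out A' g' b'"
    and R: "R > 0" "\<And>n z. z \<in> A n \<Longrightarrow> norm z \<le> R"
    and lim: "\<And>a. a \<in> A' \<Longrightarrow> \<exists>x. (\<forall>n. x n \<in> A n) \<and> x \<longlonglongrightarrow> a"
    and avoid: "\<And>z. Im z > 0 \<Longrightarrow> z \<notin> A' \<Longrightarrow> \<exists>r>0. eventually (\<lambda>n. ball z r \<inter> A n = {}) sequentially"
    and bl: "b \<longlonglongrightarrow> l"
  shows "l = b'"
proof -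
  define E where "E = {z. Im z > 0 \<and> norm z \<le> R}"
  define gE where "gE = (\<lambda>z. z + complex_of_real (R\<^sup>2) / z)"
  have mE: "mapping_out E gE (R\<^sup>2)" unfolding E_def gE_def by (rule half_disc_mapping_out[OF R(1)])
  have AE: "A n \<subseteq> E" for n using mapping_outD(2)[OF mA, of n] R(2)[of _ n] by (auto simp: E_def)
  have bR: "b n \<le> R\<^sup>2" for n by (rule mapping_out_mono[OF mA mE AE])
  have "\<exists>f. f holomorphic_on upper_hp \<and> (\<forall>z. Im z > 0 \<longrightarrow> z \<notin> A n \<longrightarrow> f (g n z) = z) \<and>
       (\<forall>w. Im w > 0 \<longrightarrow> Im (f w) > 0 \<and> f w \<notin> A n \<and> g n (f w) = w)" for n
    by (rule mapping_out_inverse[OF mA[of n]]) blast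
  then obtain f where fh: "\<And>n. f n holomorphic_on upper_hp"
    and fg: "\<And>n z. Im z > 0 \<Longrightarrow> z \<notin> A n \<Longrightarrow> f n (g n z) = z"
    and f: "\<And>n w. Im w > 0 \<Longrightarrow> Im (f n w) > 0 \<and> f n w \<notin> A n \<and> g n (f n w) = w"
    by metis
  have fb: "norm (f n w - w) \<le> R\<^sup>2 / Im w" if w: "Im w > 0" for n w
  proof -
    have "norm (f n w - w) * Im w \<le> b n" using mapping_out_dist[OF mA, of "f n w" n] f[OF w, of n] by simp
    hence "norm (f n w - w) * Im w \<le> R\<^sup>2" using bR[of n] by linarith
    thus ?thesis using w by (simp add: field_simps)
  qed
  have finj: "inj_on (f n) upper_hp" for n using f[of _ n] by (metis inj_onI mem_upper_hp)
  \<comment> \<open>The displacement bound is independent of \<open>n\<close> and gives the local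
    boundedness that Montel's theorem asks for.\<close>
  define \<H> where "\<H> = {h. h holomorphic_on upper_hp \<and> (\<forall>w. Im w > 0 \<longrightarrow> norm (h w - w) \<le> R\<^sup>2 / Im w)}"
  have bdd: "\<exists>B. \<forall>h\<in>\<H>. \<forall>z\<in>K. norm (h z) \<le> B" if K: "compact K" "K \<subseteq> upper_hp" for K
  proof (cases "K = {}")
    case False
    obtain m where m: "m \<in> K" "\<And>z. z \<in> K \<Longrightarrow> Im m \<le> Im z"
      using continuous_attains_inf[OF K(1) False, of Im] continuous_on_Im[OF continuous_on_id] by auto
    obtain C where C: "\<And>z. z \<in> K \<Longrightarrow> norm z \<le> C" using compact_imp_bounded[OF K(1)] by (auto simp: bounded_iff)
    have "norm (h z) \<le> C + R\<^sup>2 / Im m" if h: "h \<in> \<H>" and z: "z \<in> K" for h z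
    proof -
      have i: "Im m > 0" "Im z > 0" using m(1) z K(2) by auto
      have "norm (h z - z) \<le> R\<^sup>2 / Im z" using h i by (simp add: \<H>_def)
      also have "\<dots> \<le> R\<^sup>2 / Im m" using i m(2)[OF z] by (intro divide_left_mono) auto
      finally show ?thesis using C[OF z] norm_triangle_sub[of "h z" z] by simp
    qed
    thus ?thesis by blast
  qed auto
  have rng: "range f \<subseteq> \<H>" using fh fb by (auto simp: \<H>_def)
  obtain F r where F: "F holomorphic_on upper_hp" and r: "strict_mono r"
    and pw: "\<And>x. x \<in> upper_hp \<Longrightarrow> (\<lambda>n. f (r n) x) \<longlonglongrightarrow> F x"
    and ul: "\<And>K. compact K \<Longrightarrow> K \<subseteq> upper_hp \<Longrightarrow> uniform_limit K (f \<circ> r) F sequentially"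
    by (rule Montel[OF open_upper_hp, of \<H> f])
       (simp add: \<H>_def, erule (1) bdd, rule rng, rule that)
  have Fb: "norm (F w - w) \<le> R\<^sup>2 / Im w" if "Im w > 0" for w
    using pw[of w] fb[OF that] that
    by (intro LIMSEQ_le_const2[of "\<lambda>n. norm (f (r n) w - w)"] tendsto_intros) auto
  note Fray = ray_of_bound[OF Fb]
  \<comment> \<open>This keeps the values of \<open>F\<close> in the open half-plane and prevents
    \<open>F\<close> from being constant, as Hurwitz's theorems require.\<close>
  have FIm: "Im w \<le> Im (F w)" if "Im w > 0" for w
  proof (rule LIMSEQ_le_const[OF tendsto_Im[OF pw]])
    show "\<exists>N. \<forall>n\<ge>N. Im w \<le> Im (f (r n) w)"
      using mapping_out_Im_le[OF mA, of "f (r _) w" "r _"] f[OF that] by metis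
  qed (use that in simp)
  have nonconst: "\<not> F constant_on upper_hp"
  proof
    assume "F constant_on upper_hp"
    then obtain c where c: "\<And>w. w \<in> upper_hp \<Longrightarrow> F w = c" unfolding constant_on_def by blast
    have "Im (\<i> * of_real (\<bar>Im c\<bar> + 1)) \<le> Im c"
      using FIm[of "\<i> * of_real (\<bar>Im c\<bar> + 1)"] c[of "\<i> * of_real (\<bar>Im c\<bar> + 1)"] by simp
    thus False by simp
  qed
  have Finj: "inj_on F upper_hp"
    using ul fh finj nonconst
    by (intro Hurwitz_injective[OF open_upper_hp connected_upper_hp _ F, of "f \<circ> r"]) auto
  have Fnot: "F w \<notin> A'" if w: "Im w > 0" for w
  proof
    assume "F w \<in> A'"
    then obtain x where x: "\<And>n. x n \<in> A n" "x \<longlonglongrightarrow> F w" using lim by blast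
    have xr: "(\<lambda>n. x (r n)) \<longlonglongrightarrow> F w" using LIMSEQ_subseq_LIMSEQ[OF x(2) r] by (simp add: o_def)
    \<comment> \<open>Hurwitz with a moving target: \<open>f (r n)\<close> omits
      \<open>x (r n)\<close>, which tends to \<open>F w\<close>, so \<open>F\<close> would omit its
      own value at \<open>w\<close>.\<close>
    have "F w - F w \<noteq> 0"
    proof (rule Hurwitz_no_zeros[OF open_upper_hp connected_upper_hp, of "\<lambda>n z. f (r n) z - x (r n)" "\<lambda>z. F z - F w" w])
      show "(\<lambda>z. f (r n) z - x (r n)) holomorphic_on upper_hp" for n by (intro holomorphic_intros fh)
      show "(\<lambda>z. F z - F w) holomorphic_on upper_hp" by (intro holomorphic_intros F)
      show "uniform_limit K (\<lambda>n z. f (r n) z - x (r n)) (\<lambda>z. F z - F w) sequentially"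
        if "compact K" "K \<subseteq> upper_hp" for K
      proof -
        have "uniform_limit K (\<lambda>n z. x (r n)) (\<lambda>z. F w) sequentially"
          unfolding uniform_limit_iff using tendstoD[OF xr] by simp
        from uniform_limit_minus[OF ul[OF that] this] show ?thesis by (simp add: o_def)
      qed
      show "\<not> (\<lambda>z. F z - F w) constant_on upper_hp"
        using nonconst unfolding constant_on_def by (metis diff_add_cancel)
      show "f (r n) z - x (r n) \<noteq> 0" if "z \<in> upper_hp" for n z
        using f[of z "r n"] x(1)[of "r n"] that by auto
    qed (use w in auto)
    thus False by simp
  qed
  have A'R: "norm a \<le> R" if a: "a \<in> A'" for a
  proof -
    obtain x where x: "\<And>n. x n \<in> A n" "x \<longlonglongrightarrow> a" using lim[OF a] by blast
    show ?thesis by (rule LIMSEQ_le_const2[OF tendsto_norm[OF x(2)]]) (use R(2) x(1) in auto)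
  qed
  \<comment> \<open>\<open>good z\<close> says that the images \<open>g n z\<close> eventually stay
    in a compact part of the half-plane. It holds at \<open>z0\<close>, above the enclosing
    half-disc, and the Harnack estimate spreads it over the connected domain \<open>D\<close>;
    surjectivity of \<open>F\<close> onto \<open>D\<close> rests on it.\<close>
  define good where "good = (\<lambda>z. \<exists>B m. m > 0 \<and> eventually (\<lambda>n. z \<notin> A n \<and> norm (g n z) \<le> B \<and> m \<le> Im (g n z)) sequentially)"
  define D where "D = upper_hp - A'"
  have oD: "open D" unfolding D_def by (rule mapping_outD(3)[OF m])
  have conD: "connected D"
  proof -
    obtain f' where f': "f' holomorphic_on upper_hp" "f' ` upper_hp = D"
      using mapping_out_inverse[OF m] unfolding D_def by metis
    have "connected (f' ` upper_hp)"
      by (intro connected_continuous_image holomorphic_on_imp_continuous_on f'(1) connected_upper_hp)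
    thus ?thesis by (simp only: f'(2))
  qed
  define z0 where "z0 = \<i> * complex_of_real (R + 1)"
  have z0: "Im z0 = R + 1" "norm z0 = R + 1" using R by (auto simp: z0_def norm_mult)
  have z0D: "z0 \<in> D" using z0 A'R[of z0] R by (auto simp: D_def)
  have "good z0"
  proof -
    \<comment> \<open>The height of \<open>z0\<close> under the map of the half-disc, hence a lower
      bound for its height under every \<open>g n\<close>.\<close>
    define mm where "mm = (R + 1) - R\<^sup>2 / (R + 1)"
    have "mm * (R + 1) = (R + 1)\<^sup>2 - R\<^sup>2" using R(1) by (simp add: mm_def left_diff_distrib power2_eq_square)
    also have "\<dots> > 0" using R(1) by (simp add: power2_eq_square algebra_simps)
    finally have mm: "mm > 0" using R(1) by (simp add: zero_less_mult_iff)
    have "z0 \<notin> A n \<and> norm (g n z0) \<le> (R + 1) + R\<^sup>2 / mm \<and> mm \<le> Im (g n z0)" for n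
    proof -
      have nA: "z0 \<notin> A n" "z0 \<notin> E" using R z0 by (force simp: E_def)+
      have zp: "Im z0 > 0" using z0 R by simp
      have "Im (gE z0) = mm"
        unfolding gE_def half_disc_Im using R(1) by (simp add: z0 mm_def power2_eq_square)
      hence mi: "mm \<le> Im (g n z0)" using mapping_out_antimono[OF mA mE AE zp nA(2)] by simp
      have "norm (z0 - g n z0) * mm \<le> norm (z0 - g n z0) * Im (g n z0)" using mi by (intro mult_left_mono) auto
      also have "\<dots> \<le> R\<^sup>2" using mapping_out_dist[OF mA zp nA(1)] bR[of n] by simp
      finally have "norm (z0 - g n z0) \<le> R\<^sup>2 / mm" using mm by (simp add: field_simps)
      thus ?thesis using nA mi z0 norm_triangle_sub[of "g n z0" z0] by (simp add: norm_minus_commute)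
    qed
    thus ?thesis unfolding good_def using mm by (intro exI conjI always_eventually allI) blast+
  qed
  have good: "good z" if z: "z \<in> D" for z
  proof (rule connected_induction_simple[where P = good, OF conD z0D z \<open>good z0\<close>])
    fix a assume a: "a \<in> D"
    then obtain r1 where r1: "r1 > 0" "eventually (\<lambda>n. ball a r1 \<inter> A n = {}) sequentially"
      using avoid[of a] by (auto simp: D_def)
    obtain r2 where r2: "r2 > 0" "ball a r2 \<subseteq> D" using oD a open_contains_ball by blast
    define r where "r = min r1 r2"
    have sub: "ball a r \<subseteq> ball a r1" "ball a r \<subseteq> ball a r2" by (auto simp: r_def)
    have r: "r > 0" "ball a r \<subseteq> D" using r1(1) r2 sub(2) by (auto simp: r_def)
    have r3: "eventually (\<lambda>n. ball a r \<inter> A n = {}) sequentially"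
      by (rule eventually_mono[OF r1(2)]) (use sub(1) in blast)
    show "\<exists>T. openin (top_of_set D) T \<and> a \<in> T \<and> (\<forall>x\<in>T. \<forall>y\<in>T. good x \<longrightarrow> good y)"
    \<comment> \<open>Two points of this ball are within \<open>2 * r / 5\<close>, which is half of
      the radius \<open>4 * r / 5\<close> of a ball about \<open>x\<close> still contained in
      \<open>ball a r\<close>.\<close>
    proof (intro exI[of _ "ball a (r / 5)"] conjI ballI impI)
      show "openin (top_of_set D) (ball a (r / 5))"
        using r by (intro open_subset subset_trans[OF subset_ball r(2)]) auto
      fix x y assume x: "x \<in> ball a (r / 5)" and y: "y \<in> ball a (r / 5)" and gx: "good x"
      obtain B mm where Bm: "mm > 0" "eventually (\<lambda>n. x \<notin> A n \<and> norm (g n x) \<le> B \<and> mm \<le> Im (g n x)) sequentially"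
        using gx unfolding good_def by blast
      have sub: "ball x (4 * r / 5) \<subseteq> ball a r"
      proof
        fix u assume "u \<in> ball x (4 * r / 5)"
        thus "u \<in> ball a r" using x dist_triangle[of a u x] by simp
      qed
      have yx: "norm (y - x) \<le> (4 * r / 5) / 2"
        using x y dist_triangle[of y x a] by (simp add: dist_norm norm_minus_commute)
      from Bm(2) r3 have "eventually (\<lambda>n. y \<notin> A n \<and> norm (g n y) \<le> 3 * B \<and> 3 / 16 * mm \<le> Im (g n y)) sequentially"
      proof eventually_elim
        case (elim n)
        have sub2: "ball x (4 * r / 5) \<subseteq> upper_hp - A n"
          using sub elim(2) r(2) by (auto simp: D_def)
        have hol: "g n holomorphic_on ball x (4 * r / 5)"
          by (rule holomorphic_on_subset[OF mapping_outD(4)[OF mA] sub2])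
        have pos: "Im (g n u) > 0" if "u \<in> ball x (4 * r / 5)" for u
          using mapping_out_Im_pos[OF mA, of u n] sub2 that by auto
        have h: "norm (g n y - g n x) \<le> 2 * Im (g n x)" "3 / 16 * Im (g n x) \<le> Im (g n y)"
          using r(1) by (intro schwarz_pick_ball_half[OF hol pos _ yx]; simp)+
        have "Im (g n x) \<le> norm (g n x)" using abs_Im_le_cmod[of "g n x"] by simp
        hence "norm (g n y) \<le> 3 * B" using h(1) elim(1) norm_triangle_sub[of "g n y" "g n x"] by linarith
        moreover have "y \<in> ball a r" using y r by simp
        ultimately show ?case using h elim by auto
      qed
      thus "good y" unfolding good_def using Bm(1) by (intro exI[of _ "3 * B"] exI[of _ "3 / 16 * mm"]) simp
    qed (use r in simp)
  qed
  have Fim: "F ` upper_hp = upper_hp - A'"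
  proof (intro equalityI subsetI)
    fix x assume "x \<in> F ` upper_hp"
    then obtain w where w: "Im w > 0" "x = F w" by auto
    show "x \<in> upper_hp - A'" using Fnot[OF w(1)] FIm[OF w(1)] w by auto
  next
    fix z assume z: "z \<in> upper_hp - A'"
    hence zi: "Im z > 0" by simp
    obtain B mm where Bm: "mm > 0" "eventually (\<lambda>n. z \<notin> A n \<and> norm (g n z) \<le> B \<and> mm \<le> Im (g n z)) sequentially"
      using good[of z] z unfolding good_def D_def by blast
    define K where "K = cball 0 B \<inter> {w. mm \<le> Im w}"
    have K: "compact K" "K \<subseteq> upper_hp"
      unfolding K_def using Bm(1) by (auto intro!: compact_Int_closed closed_halfspace_Im_ge)
    have "eventually (\<lambda>n. z \<notin> A (r n) \<and> g (r n) z \<in> K) sequentially"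
      using eventually_subseq[OF r Bm(2)] by eventually_elim (auto simp: K_def)
    then obtain N where N: "\<And>n. n \<ge> N \<Longrightarrow> z \<notin> A (r n) \<and> g (r n) z \<in> K"
      by (auto simp: eventually_sequentially)
    have "\<forall>n. g (r (n + N)) z \<in> K" using N by simp
    then obtain w s where w: "w \<in> K" and s: "strict_mono s" "((\<lambda>n. g (r (n + N)) z) \<circ> s) \<longlonglongrightarrow> w"
      using K(1) unfolding compact_def by metis
    define v where "v = (\<lambda>n. g (r (s n + N)) z)"
    have vK: "v n \<in> K" for n using N by (simp add: v_def)
    have vw: "v \<longlonglongrightarrow> w" using s(2) by (simp add: v_def o_def)
    have cF: "continuous_on upper_hp F" by (rule holomorphic_on_imp_continuous_on[OF F])
    have Fv: "(\<lambda>n. F (v n)) \<longlonglongrightarrow> F w"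
      by (rule continuous_on_tendsto_compose[OF cF vw])
         (use w vK K(2) in \<open>blast intro: always_eventually\<close>)+
    \<comment> \<open>Uniform convergence on \<open>K\<close> allows \<open>F\<close> to replace
      \<open>f (r (s n + N))\<close> at the varying point \<open>v n\<close>, where the latter has
      the value \<open>z\<close>.\<close>
    have "(\<lambda>n. F (v n) - z) \<longlonglongrightarrow> 0"
    proof (rule LIMSEQ_I)
      fix e :: real assume "e > 0"
      with ul[OF K] obtain M where M: "\<And>n x. n \<ge> M \<Longrightarrow> x \<in> K \<Longrightarrow> dist ((f \<circ> r) n x) (F x) < e"
        unfolding uniform_limit_iff eventually_sequentially by blast
      have "norm (F (v n) - z - 0) < e" if "n \<ge> M" for n
      proof -
        have "s n + N \<ge> M" using seq_suble[OF s(1), of n] that by linarith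
        from M[OF this vK[of n]] have "dist (f (r (s n + N)) (v n)) (F (v n)) < e" by simp
        moreover have "f (r (s n + N)) (v n) = z"
          unfolding v_def using N[of "s n + N"] by (intro fg zi) simp
        ultimately show ?thesis by (simp add: dist_norm norm_minus_commute)
      qed
      thus "\<exists>no. \<forall>n\<ge>no. norm (F (v n) - z - 0) < e" by blast
    qed
    hence "(\<lambda>n. F (v n)) \<longlonglongrightarrow> z" by (simp add: LIM_zero_iff)
    hence "F w = z" using Fv LIMSEQ_unique by blast
    thus "z \<in> F ` upper_hp" using w K(2) by blast
  qed
  have id: "Im (g' (F w)) = Im w" if "Im w > 0" for w
    by (rule mapping_out_identify[OF m F Finj Fim Fray that])
  have br: "(\<lambda>n. b (r n)) \<longlonglongrightarrow> l" using LIMSEQ_subseq_LIMSEQ[OF bl r] by (simp add: o_def)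
  \<comment> \<open>The path \<open>F (\<i> * y)\<close> is chosen because \<open>g'\<close> sends
    it back to height \<open>y\<close>; the bounds for \<open>f (r n)\<close> at the same height
    pass to the pointwise limit.\<close>
  have "b' - 0 \<le> l"
  proof (rule mapping_out_cap_diff_le[OF mapping_out_empty m Fray])
    show "\<forall>\<^sub>F y in at_top. (Im (F (\<i> * of_real y)) - Im (g' (F (\<i> * of_real y)))) * Im (g' (F (\<i> * of_real y))) \<le> l"
      using eventually_gt_at_top[of 0]
    proof eventually_elim
      case (elim y)
      let ?w = "\<i> * complex_of_real y"
      have w: "Im ?w > 0" using elim by simp
      have "(\<lambda>n. (Im (f (r n) ?w) - Im ?w) * Im ?w) \<longlonglongrightarrow> (Im (F ?w) - Im ?w) * Im ?w"
        using w by (intro tendsto_intros pw) simp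
      hence "(Im (F ?w) - Im ?w) * Im ?w \<le> l"
      proof (rule LIMSEQ_le[OF _ br])
        have "(Im (f (r n) ?w) - Im ?w) * Im ?w \<le> b (r n)" for n
          using mapping_out_diff_bound[OF mapping_out_empty mA, of "r n" "f (r n) ?w"] f[OF w, of "r n"] by simp
        thus "\<exists>N. \<forall>n\<ge>N. (Im (f (r n) ?w) - Im ?w) * Im ?w \<le> b (r n)" by blast
      qed
      thus ?case using id[OF w] by (simp only:)
    qed
  qed
  \<comment> \<open>The upper bound for \<open>l\<close>: the same passage to the limit for the
    pairs \<open>A n \<subseteq> E\<close>, whose capacities differ by
    \<open>R^2 - b n\<close>.\<close>
  moreover have "R\<^sup>2 - b' \<le> R\<^sup>2 - l"
  proof (rule mapping_out_cap_diff_le[OF m mE Fray])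
    show "\<forall>\<^sub>F y in at_top. (Im (g' (F (\<i> * of_real y))) - Im (gE (F (\<i> * of_real y)))) * Im (gE (F (\<i> * of_real y))) \<le> R\<^sup>2 - l"
      using eventually_gt_at_top[of "R + 1 + R\<^sup>2"]
    proof eventually_elim
      case (elim y)
      let ?w = "\<i> * complex_of_real y"
      have y1: "y > 1" "y > R + R\<^sup>2" using elim R(1) by (auto intro: le_less_trans[OF _ elim])
      hence w: "Im ?w > 0" by simp
      \<comment> \<open>For \<open>y > 1\<close> the displacement is at most \<open>R^2\<close>, so
        above height \<open>R + R^2\<close> all values lie outside the half-disc.\<close>
      have big: "norm (h - ?w) \<le> R\<^sup>2 / Im ?w \<Longrightarrow> h \<notin> E \<and> h \<noteq> 0" for h
      proof -
        assume h: "norm (h - ?w) \<le> R\<^sup>2 / Im ?w"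
        have "R\<^sup>2 / y \<le> R\<^sup>2" using y1 by (simp add: divide_le_eq mult_le_cancel_left1)
        hence "norm h \<ge> y - R\<^sup>2"
          using h norm_triangle_sub[of ?w h] y1 by (simp add: norm_mult norm_minus_commute)
        hence "norm h > R" using y1 by simp
        thus ?thesis using R(1) by (auto simp: E_def)
      qed
      have Fn: "F ?w \<notin> E" "F ?w \<noteq> 0" using big[OF Fb[OF w]] by auto
      have gc: "isCont gE (F ?w)" unfolding gE_def using Fn by (intro continuous_intros) auto
      have "(\<lambda>n. (Im ?w - Im (gE (f (r n) ?w))) * Im (gE (f (r n) ?w)))
          \<longlonglongrightarrow> (Im ?w - Im (gE (F ?w))) * Im (gE (F ?w))"
        using w by (intro tendsto_intros isCont_tendsto_compose[OF gc] pw) simp_all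
      hence "(Im ?w - Im (gE (F ?w))) * Im (gE (F ?w)) \<le> R\<^sup>2 - l"
      proof (rule LIMSEQ_le[OF _ tendsto_diff[OF tendsto_const br]])
        have "(Im ?w - Im (gE (f (r n) ?w))) * Im (gE (f (r n) ?w)) \<le> R\<^sup>2 - b (r n)" for n
          using mapping_out_diff_bound[OF mA mE AE, of "f (r n) ?w" "r n"] f[OF w, of "r n"] big[OF fb[OF w]] by simp
        thus "\<exists>N. \<forall>n\<ge>N. (Im ?w - Im (gE (f (r n) ?w))) * Im (gE (f (r n) ?w)) \<le> R\<^sup>2 - b (r n)" by blast
      qed
      thus ?case using id[OF w] by (simp only:)
    qed
  qed
  ultimately show ?thesis by simp
qed

text \<open>Capacities stay in the compact interval from 0 to \<open>R^2\<close>, so a sequence not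
  tending to \<open>b'\<close> would have a subsequence with a different limit.\<close>

lemma mapping_out_cap_convergent:
  fixes A :: "nat \<Rightarrow> complex set"
  assumes mA: "\<And>n. mapping_out (A n) (g n) (b n)" and m: "mapping_out A' g' b'"
    and R: "R > 0" "\<And>n z. z \<in> A n \<Longrightarrow> norm z \<le> R"
    and lim: "\<And>a. a \<in> A' \<Longrightarrow> \<exists>x. (\<forall>n. x n \<in> A n) \<and> x \<longlonglongrightarrow> a"
    and avoid: "\<And>z. Im z > 0 \<Longrightarrow> z \<notin> A' \<Longrightarrow> \<exists>r>0. eventually (\<lambda>n. ball z r \<inter> A n = {}) sequentially"
  shows "b \<longlonglongrightarrow> b'"
proof (rule ccontr)
  assume "\<not> ?thesis"
  then obtain e where e: "e > 0" "\<not> (\<forall>\<^sub>F n in sequentially. \<bar>b n - b'\<bar> < e)"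
    by (auto simp: tendsto_iff dist_real_def)
  hence "infinite {n. e \<le> \<bar>b n - b'\<bar>}"
    by (simp add: frequently_cofinite[symmetric] cofinite_eq_sequentially frequently_def not_le)
  then obtain r :: "nat \<Rightarrow> nat" where r: "strict_mono r" "\<And>n. e \<le> \<bar>b (r n) - b'\<bar>"
    using infinite_enumerate by blast
  have AE: "A n \<subseteq> {z. Im z > 0 \<and> norm z \<le> R}" for n using mapping_outD(2)[OF mA, of n] R(2)[of _ n] by auto
  have "b n \<le> R\<^sup>2" for n by (rule mapping_out_mono[OF mA half_disc_mapping_out[OF R(1)] AE])
  moreover have "0 \<le> b n" for n by (rule mapping_out_nonneg[OF mA])
  ultimately have "\<forall>n. b (r n) \<in> {0..R\<^sup>2}" by simp
  then obtain l s where s: "strict_mono s" "((\<lambda>n. b (r n)) \<circ> s) \<longlonglongrightarrow> l"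
    using compact_Icc[of 0 "R\<^sup>2"] unfolding compact_def by metis
  have rs: "strict_mono (\<lambda>n. r (s n))" using strict_mono_o[OF r(1) s(1)] by (simp add: o_def)
  have "l = b'"
  proof (rule mapping_out_cap_convergent_subseq[where A = "\<lambda>n. A (r (s n))" and g = "\<lambda>n. g (r (s n))"
        and b = "\<lambda>n. b (r (s n))" and g' = g', OF mA m R(1)])
    show "\<exists>x. (\<forall>n. x n \<in> A (r (s n))) \<and> x \<longlonglongrightarrow> a" if a: "a \<in> A'" for a
    proof -
      obtain x where x: "\<forall>n. x n \<in> A n" "x \<longlonglongrightarrow> a" using lim[OF a] by blast
      show ?thesis
        using x(1) LIMSEQ_subseq_LIMSEQ[OF x(2) rs] by (intro exI[of _ "\<lambda>n. x (r (s n))"]) (simp add: o_def)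
    qed
    show "\<exists>d>0. eventually (\<lambda>n. ball z d \<inter> A (r (s n)) = {}) sequentially" if "Im z > 0" "z \<notin> A'" for z
      using avoid[OF that] eventually_subseq[OF rs] by blast
    show "(\<lambda>n. b (r (s n))) \<longlonglongrightarrow> l" using s(2) by (simp add: o_def)
  qed (use R(2) in auto)
  moreover have "e \<le> \<bar>l - b'\<bar>"
    by (rule LIMSEQ_le_const[OF tendsto_rabs[OF tendsto_diff[OF s(2) tendsto_const]]]) (use r(2) in auto)
  ultimately show False using e(1) by simp
qed

section \<open>Blow-up of slits\<close>

text \<open>Conjugation by \<open>h w = r * w + p\<close>. At \<open>z = h w\<close> the term
  \<open>b / z\<close> equals \<open>b / (r * w)\<close> up to second order, and the outer division
  contributes the second factor \<open>r\<close>.\<close>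

lemma mapping_out_affine:
  fixes r p :: real
  assumes m: "mapping_out A g b" and r: "r > 0"
  shows "mapping_out ((\<lambda>z. (z - of_real p) / of_real r) ` A)
           (\<lambda>z. (g (of_real r * z + of_real p) - of_real p) / of_real r) (b / r\<^sup>2)"
proof -
  define h where "h = (\<lambda>w. complex_of_real r * w + of_real p)"
  define A' where "A' = (\<lambda>z. (z - of_real p) / of_real r) ` A"
  define G where "G = (\<lambda>w. (g (h w) - of_real p) / of_real r)"
  have hA: "h w \<in> A \<longleftrightarrow> w \<in> A'" for w
  proof
    assume "h w \<in> A"
    thus "w \<in> A'" unfolding A'_def by (rule rev_image_eqI) (use r in \<open>simp add: h_def\<close>)
  next
    assume "w \<in> A'" thus "h w \<in> A" using r by (auto simp: A'_def h_def)
  qed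
  have hH: "h w \<in> upper_hp \<longleftrightarrow> w \<in> upper_hp" for w using r by (simp add: h_def zero_less_mult_iff)
  have hD: "h w \<in> upper_hp - A \<longleftrightarrow> w \<in> upper_hp - A'" for w using hA hH by blast
  have hs: "\<exists>w. z = h w" for z
    by (rule exI[of _ "(z - of_real p) / of_real r"]) (use r in \<open>simp add: h_def\<close>)
  have himg: "h ` (upper_hp - A') = upper_hp - A"
  proof (intro equalityI subsetI)
    fix z assume z: "z \<in> upper_hp - A"
    obtain w where "z = h w" using hs by blast
    thus "z \<in> h ` (upper_hp - A')" using z hD by blast
  qed (use hD in blast)
  have hinj: "h x = h y \<Longrightarrow> x = y" for x y using r by (simp add: h_def)
  have "mapping_out A' G (b / r\<^sup>2)"
    unfolding mapping_out_def
  proof (intro conjI)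
    obtain B where B: "\<And>z. z \<in> A \<Longrightarrow> norm z \<le> B" using mapping_outD(1)[OF m] by (auto simp: bounded_iff)
    have "norm w \<le> (B + \<bar>p\<bar>) / r" if "w \<in> A'" for w
    proof -
      have "norm (h w) \<le> B" using that hA B by blast
      moreover have "norm (of_real r * w) \<le> norm (h w) + norm (complex_of_real p)"
        unfolding h_def by (metis add_diff_cancel_right' norm_triangle_ineq4)
      ultimately have "r * norm w \<le> B + \<bar>p\<bar>" using r by (simp add: norm_mult)
      thus ?thesis using r by (simp add: pos_le_divide_eq mult.commute)
    qed
    thus "bounded A'" by (auto simp: bounded_iff)
    show "A' \<subseteq> upper_hp" using hA hH mapping_outD(2)[OF m] by blast
    have "h -` (upper_hp - A) = upper_hp - A'" using hD by blast
    moreover have "open (h -` (upper_hp - A))"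
      unfolding h_def by (intro open_vimage mapping_outD(3)[OF m] continuous_intros)
    ultimately show "open (upper_hp - A')" by simp
    have "(g \<circ> h) holomorphic_on upper_hp - A'"
    proof (rule holomorphic_on_compose)
      show "h holomorphic_on upper_hp - A'" unfolding h_def by (intro holomorphic_intros)
      show "g holomorphic_on h ` (upper_hp - A')" unfolding himg by (rule mapping_outD(4)[OF m])
    qed
    thus "G holomorphic_on upper_hp - A'"
      unfolding G_def o_def using r by (intro holomorphic_intros) auto
    show "inj_on G (upper_hp - A')"
    proof (rule inj_onI)
      fix x y assume x: "x \<in> upper_hp - A'" and y: "y \<in> upper_hp - A'" and "G x = G y"
      hence "g (h x) = g (h y)" using r by (simp add: G_def)
      hence "h x = h y" using inj_onD[OF mapping_outD(5)[OF m]] hD x y by blast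
      thus "x = y" by (rule hinj)
    qed
    show "G ` (upper_hp - A') = upper_hp"
    proof -
      have "G ` (upper_hp - A') = (\<lambda>z. (z - of_real p) / of_real r) ` g ` h ` (upper_hp - A')"
        by (simp add: G_def image_image)
      also have "\<dots> = (\<lambda>z. (z - of_real p) / of_real r) ` upper_hp"
        by (simp only: himg mapping_outD(6)[OF m])
      also have "\<dots> = upper_hp"
      proof (intro equalityI subsetI)
        fix z assume "z \<in> upper_hp"
        hence "h z \<in> upper_hp" using hH by blast
        thus "z \<in> (\<lambda>z. (z - of_real p) / of_real r) ` upper_hp"
          by (rule rev_image_eqI) (use r in \<open>simp add: h_def\<close>)
      qed (use r in auto)
      finally show ?thesis .
    qed
    obtain M R where MR: "\<And>z. z\<in>upper_hp - A \<Longrightarrow> R < norm z \<Longrightarrow>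
            norm (g z - z - complex_of_real b / z) \<le> M / (norm z)^2"
      using m unfolding mapping_out_def by blast
    show "\<exists>M R. \<forall>z\<in>upper_hp - A'. R < norm z \<longrightarrow>
            norm (G z - z - complex_of_real (b / r\<^sup>2) / z) \<le> M / (norm z)^2"
    proof (intro exI ballI impI)
      \<comment> \<open>The two bounds make \<open>norm z\<close> at least
        \<open>r * norm w / 2\<close> and larger than \<open>R\<close>.\<close>
      fix w assume w: "w \<in> upper_hp - A'" and nw: "max (2 * \<bar>p\<bar> / r) (2 * \<bar>R\<bar> / r) < norm w"
      define z where "z = h w"
      have z: "z \<in> upper_hp - A" using w hD by (simp add: z_def)
      have w0: "w \<noteq> 0" "z \<noteq> 0" using w z by auto
      have nwp: "norm w > 0" using w0 by simp
      have nw': "2 * \<bar>p\<bar> < r * norm w" "2 * \<bar>R\<bar> < r * norm w"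
        using nw r by (simp_all add: pos_divide_less_eq mult.commute)
      have "norm (of_real r * w) \<le> norm z + norm (complex_of_real p)"
        unfolding z_def h_def by (metis add_diff_cancel_right' norm_triangle_ineq4)
      hence zw: "r * norm w / 2 \<le> norm z" using r nw' by (simp add: norm_mult)
      have zR: "R < norm z" using zw nw' by linarith
      have rw: "0 < r * norm w / 2" using r nwp by simp
      have "norm (g z - z - of_real b / z) \<le> M / (norm z)\<^sup>2" by (rule MR[OF z zR])
      also have "\<dots> \<le> \<bar>M\<bar> / (r * norm w / 2)\<^sup>2"
        using zw rw by (intro frac_le power_mono) auto
      also have "\<dots> = 4 * \<bar>M\<bar> / r\<^sup>2 / (norm w)\<^sup>2" by (simp add: power_mult_distrib power_divide)
      finally have 1: "norm (g z - z - of_real b / z) \<le> 4 * \<bar>M\<bar> / r\<^sup>2 / (norm w)\<^sup>2" .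
      have "of_real b / z - of_real b / (of_real r * w) = - of_real b * of_real p / (z * (of_real r * w))"
        using w0 r by (simp add: z_def h_def field_simps)
      hence "norm (of_real b / z - of_real b / (of_real r * w)) = \<bar>b\<bar> * \<bar>p\<bar> / (norm z * (r * norm w))"
        using r by (simp add: norm_divide norm_mult)
      also have "\<dots> \<le> \<bar>b\<bar> * \<bar>p\<bar> / ((r * norm w / 2) * (r * norm w))"
        using zw rw r by (intro divide_left_mono mult_right_mono mult_pos_pos) auto
      also have "\<dots> = 2 * (\<bar>b\<bar> * \<bar>p\<bar>) / r\<^sup>2 / (norm w)\<^sup>2" by (simp add: power2_eq_square mult_ac)
      finally have 2: "norm (of_real b / z - of_real b / (of_real r * w)) \<le> 2 * (\<bar>b\<bar> * \<bar>p\<bar>) / r\<^sup>2 / (norm w)\<^sup>2" .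
      have "G w - w - complex_of_real (b / r\<^sup>2) / w = ((g z - z - of_real b / z) + (of_real b / z - of_real b / (of_real r * w))) / of_real r"
        using r w0 by (simp add: G_def z_def[symmetric] diff_divide_distrib add_divide_distrib power2_eq_square)
           (simp add: z_def h_def add_divide_distrib)
      also have "norm \<dots> \<le> (norm (g z - z - of_real b / z) + norm (of_real b / z - of_real b / (of_real r * w))) / r"
      proof -
        have "norm ((u + v) / complex_of_real r) \<le> (norm u + norm v) / r" for u v
          using r by (simp add: norm_divide divide_right_mono norm_triangle_ineq)
        thus ?thesis .
      qed
      also have "\<dots> \<le> (4 * \<bar>M\<bar> / r\<^sup>2 / (norm w)\<^sup>2 + 2 * (\<bar>b\<bar> * \<bar>p\<bar>) / r\<^sup>2 / (norm w)\<^sup>2) / r"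
        using 1 2 r by (intro divide_right_mono) auto
      also have "\<dots> = ((4 * \<bar>M\<bar> / r\<^sup>2 + 2 * (\<bar>b\<bar> * \<bar>p\<bar>) / r\<^sup>2) / r) / (norm w)\<^sup>2"
        by (simp add: add_divide_distrib mult_ac)
      finally show "norm (G w - w - complex_of_real (b / r\<^sup>2) / w) \<le> ((4 * \<bar>M\<bar> / r\<^sup>2 + 2 * (\<bar>b\<bar> * \<bar>p\<bar>) / r\<^sup>2) / r) / (norm w)\<^sup>2" .
    qed
  qed
  thus ?thesis by (simp add: A'_def G_def h_def)
qed

section \<open>Straight segments and convergence of rescaled slits\<close>

definition seg :: "real \<Rightarrow> real \<Rightarrow> complex set" where
  "seg \<alpha> l = (\<lambda>s. of_real s * cis \<alpha>) ` {0<..l}"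

lemma cis_upper: "0 < \<alpha> \<Longrightarrow> \<alpha> < pi \<Longrightarrow> Im (cis \<alpha>) > 0"
  by (simp add: sin_gt_zero)

lemma simple_slit_seg:
  assumes "0 < \<alpha>" "\<alpha> < pi" "0 < l"
  shows "simple_slit (\<lambda>s. of_real s * cis \<alpha>) l"
  using assms cis_upper[of \<alpha>]
  by (auto simp: simple_slit_def inj_on_def intro!: continuous_intros)

lemma seg_mapping_out:
  assumes "0 < \<alpha>" "\<alpha> < pi" "0 < l"
  shows "\<exists>g b. mapping_out (seg \<alpha> l) g b"
  unfolding seg_def by (rule simple_slit_mapping_out[OF simple_slit_seg[OF assms]])

lemma Arg_of_real_mult_cis:
  assumes "0 < s" "0 < \<alpha>" "\<alpha> < pi"
  shows "Arg (of_real s * cis \<alpha>) = \<alpha>"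
  using assms by (simp add: Arg_times_of_real Arg_cis)

lemma mem_seg:
  assumes "0 < \<alpha>" "\<alpha> < pi"
  shows "z \<in> seg \<alpha> l \<longleftrightarrow> z \<noteq> 0 \<and> Arg z = \<alpha> \<and> norm z \<le> l"
proof
  assume "z \<in> seg \<alpha> l"
  then obtain s where s: "0 < s" "s \<le> l" "z = of_real s * cis \<alpha>" by (auto simp: seg_def)
  thus "z \<noteq> 0 \<and> Arg z = \<alpha> \<and> norm z \<le> l"
    using assms by (simp add: Arg_times_of_real Arg_cis norm_mult)
next
  assume z: "z \<noteq> 0 \<and> Arg z = \<alpha> \<and> norm z \<le> l"
  hence "z = of_real (norm z) * cis \<alpha>" using Arg_eq[of z] by (simp add: cis_conv_exp)
  thus "z \<in> seg \<alpha> l" unfolding seg_def using z by (intro image_eqI[of _ _ "norm z"]) auto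
qed

text \<open>Equal directions need their own case: the segments are then nested and form a single
  slit, while the two-slit construction asks for disjoint slits.\<close>

lemma two_seg_mapping_out:
  assumes a: "0 < \<alpha>" "\<alpha> < pi" "0 < \<beta>" "\<beta> < pi" and l: "0 < l" "0 < k"
  shows "\<exists>g b. mapping_out (seg \<alpha> l \<union> seg \<beta> k) g b"
proof (cases "\<alpha> = \<beta>")
  case True
  have "{0<..l} \<union> {0<..k} = {0<..max l k}" by auto
  hence "seg \<alpha> l \<union> seg \<beta> k = seg \<alpha> (max l k)"
    using True unfolding seg_def by (metis image_Un)
  thus ?thesis using seg_mapping_out[OF a(1,2), of "max l k"] l by simp
next
  case False
  have "seg \<alpha> l \<inter> seg \<beta> k = {}" using False by (auto simp: mem_seg a)
  thus ?thesis unfolding seg_def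
    by (intro two_slits_mapping_out simple_slit_seg a l) auto
qed

lemma hcap_affine:
  fixes r p :: real
  assumes m: "mapping_out A g b" and r: "r > 0"
  shows "hcap ((\<lambda>z. (z - of_real p) / of_real r) ` A) = hcap A / r\<^sup>2"
  using hcap_eq[OF mapping_out_affine[OF m r]] hcap_eq[OF m] by simp

lemma hcap_seg:
  assumes a: "0 < \<alpha>" "\<alpha> < pi" and l: "0 < l"
  shows "hcap (seg \<alpha> l) = l\<^sup>2 * hcap (seg \<alpha> 1)"
proof -
  obtain g b where m: "mapping_out (seg \<alpha> l) g b" using seg_mapping_out[OF a l] by blast
  have "(\<lambda>z. (z - of_real 0) / of_real l) ` seg \<alpha> l = seg \<alpha> 1"
  proof (intro equalityI subsetI)
    fix z assume "z \<in> (\<lambda>z. (z - of_real 0) / of_real l) ` seg \<alpha> l"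
    then obtain s where "0 < s" "s \<le> l" "z = of_real s * cis \<alpha> / of_real l" by (auto simp: seg_def)
    thus "z \<in> seg \<alpha> 1" using l unfolding seg_def by (intro image_eqI[of _ _ "s / l"]) auto
  next
    fix z assume "z \<in> seg \<alpha> 1"
    then obtain s where s: "0 < s" "s \<le> 1" "z = of_real s * cis \<alpha>" by (auto simp: seg_def)
    hence "of_real (l * s) * cis \<alpha> \<in> seg \<alpha> l"
      using l unfolding seg_def by (intro image_eqI[of _ _ "l * s"]) (auto simp: mult_le_cancel_left1)
    thus "z \<in> (\<lambda>z. (z - of_real 0) / of_real l) ` seg \<alpha> l"
      by (rule rev_image_eqI) (use l s in simp)
  qed
  with hcap_affine[OF m l, of 0] have "hcap (seg \<alpha> 1) = hcap (seg \<alpha> l) / l\<^sup>2" by simp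
  thus ?thesis using l by simp
qed

lemma hcap_pos:
  assumes "mapping_out A g b" "A \<noteq> {}"
  shows "hcap A > 0"
  using mapping_out_pos[OF assms] hcap_eq[OF assms(1)] by simp

lemma hcap_seg_pos:
  assumes a: "0 < \<alpha>" "\<alpha> < pi" and l: "0 < l"
  shows "hcap (seg \<alpha> l) > 0"
proof -
  have "of_real l * cis \<alpha> \<in> seg \<alpha> l" using l by (auto simp: seg_def)
  thus ?thesis using seg_mapping_out[OF a l] hcap_pos by blast
qed

text \<open>A slit with asymptotic direction \<open>\<alpha>\<close>, rescaled so that its radius tends to \<open>l\<close>, converges
  to the segment: it lies in thinner and thinner sectors, and meets every smaller circle.\<close>
lemma slit_blowup:
  assumes s: "simple_slit \<gamma> T" "\<gamma> 0 = of_real p" and dir: "approaches_in_dir \<gamma> T p \<alpha>" and a: "0 < \<alpha>" "\<alpha> < pi"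
    and t: "\<And>n::nat. 0 < t n \<and> t n \<le> T" "t \<longlonglongrightarrow> 0"
    and \<sigma>: "\<And>n. 0 < \<sigma> n" and \<rho>: "\<And>n. \<forall>x\<in>{0..t n}. norm (\<gamma> x - of_real p) \<le> \<rho> n"
      "\<And>n. \<exists>x\<in>{0..t n}. norm (\<gamma> x - of_real p) = \<rho> n" and l: "l > 0" "(\<lambda>n. \<rho> n / \<sigma> n) \<longlonglongrightarrow> l"
  defines "A \<equiv> \<lambda>n. (\<lambda>z. (z - of_real p) / of_real (\<sigma> n)) ` \<gamma> ` {0<..t n}"
  shows "a \<in> seg \<alpha> l \<Longrightarrow> \<exists>x. (\<forall>n. x n \<in> A n) \<and> x \<longlonglongrightarrow> a"
    and "Im z > 0 \<Longrightarrow> z \<notin> seg \<alpha> l \<Longrightarrow> \<exists>r>0. eventually (\<lambda>n. ball z r \<inter> A n = {}) sequentially"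
    and "w \<in> A n \<Longrightarrow> norm w \<le> \<rho> n / \<sigma> n"
proof -
  have cont: "continuous_on {0..T} \<gamma>" and inj: "inj_on \<gamma> {0..T}" using s by (auto simp: simple_slit_def)
  have nz: "\<gamma> x \<noteq> of_real p" if "0 < x" "x \<le> T" for x
    using inj_onD[OF inj, of x 0] that s(2) by force
  have arg: "eventually (\<lambda>n. \<forall>x. 0 < x \<longrightarrow> x \<le> t n \<longrightarrow> \<bar>Arg (\<gamma> x - of_real p) - \<alpha>\<bar> < e) sequentially" if e: "e > 0" for e
  proof -
    obtain t0 where t0: "t0 > 0" "\<And>x. x \<in> {0<..min t0 T} \<Longrightarrow> \<alpha> - e < Arg (\<gamma> x - of_real p) \<and> Arg (\<gamma> x - of_real p) < \<alpha> + e"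
      using dir e unfolding approaches_in_dir_def by blast
    have "eventually (\<lambda>n. t n < t0) sequentially" using order_tendstoD(2)[OF t(2) t0(1)] .
    thus ?thesis
    proof eventually_elim
      case (elim n)
      show ?case
      proof (intro allI impI)
        fix x assume "0 < x" "x \<le> t n"
        thus "\<bar>Arg (\<gamma> x - of_real p) - \<alpha>\<bar> < e" using t0(2)[of x] elim t(1)[of n] by auto
      qed
    qed
  qed
  have args: "Arg ((u - of_real p) / of_real (\<sigma> n)) = Arg (u - of_real p)" for u n
    using Arg_divide_of_real[OF \<sigma>] .
  show "w \<in> A n \<Longrightarrow> norm w \<le> \<rho> n / \<sigma> n" for w n
    using \<rho>(1) \<sigma>[of n] by (auto simp: A_def norm_divide divide_right_mono)
  have \<rho>0: "\<rho> n > 0" for n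
  proof -
    have "0 < norm (\<gamma> (t n) - of_real p)" using nz[of "t n"] t(1)[of n] by simp
    also have "\<dots> \<le> \<rho> n" using \<rho>(1)[of n] t(1)[of n] by simp
    finally show ?thesis .
  qed
  show "\<exists>x. (\<forall>n. x n \<in> A n) \<and> x \<longlonglongrightarrow> a" if a': "a \<in> seg \<alpha> l" for a
  proof -
    obtain u where u: "0 < u" "u \<le> l" "a = of_real u * cis \<alpha>" using a' by (auto simp: seg_def)
    \<comment> \<open>The slit crosses the circle of radius \<open>u * \<sigma> n\<close> unless it
      is too short for this \<open>n\<close>. The minimum with \<open>\<rho> n\<close> covers that
      case, and after rescaling it tends to \<open>u\<close> because
      \<open>u \<le> l\<close>.\<close>
    have "\<exists>x. 0 < x \<and> x \<le> t n \<and> norm (\<gamma> x - of_real p) = min (u * \<sigma> n) (\<rho> n)" for n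
    proof -
      obtain y where y: "0 \<le> y" "y \<le> t n" "norm (\<gamma> y - of_real p) = \<rho> n" using \<rho>(2)[of n] by auto
      have "\<exists>x\<ge>0. x \<le> y \<and> norm (\<gamma> x - of_real p) = min (u * \<sigma> n) (\<rho> n)"
      proof (rule IVT')
        have "continuous_on {0..y} \<gamma>" by (rule continuous_on_subset[OF cont]) (use y t(1)[of n] in auto)
        thus "continuous_on {0..y} (\<lambda>x. norm (\<gamma> x - of_real p))" by (intro continuous_intros)
      qed (use y u \<sigma>[of n] \<rho>0[of n] s(2) in \<open>auto intro: less_imp_le\<close>)
      then obtain x where x: "x \<ge> 0" "x \<le> y" "norm (\<gamma> x - of_real p) = min (u * \<sigma> n) (\<rho> n)" by blast
      have "min (u * \<sigma> n) (\<rho> n) > 0" using u \<sigma>[of n] \<rho>0[of n] by simp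
      hence "x \<noteq> 0" using x(3) s(2) by auto
      thus ?thesis using x y by (intro exI[of _ x]) auto
    qed
    then obtain \<tau> where \<tau>: "\<And>n. 0 < \<tau> n \<and> \<tau> n \<le> t n \<and> norm (\<gamma> (\<tau> n) - of_real p) = min (u * \<sigma> n) (\<rho> n)"
      by metis
    define x where "x = (\<lambda>n. (\<gamma> (\<tau> n) - of_real p) / of_real (\<sigma> n))"
    have xA: "\<forall>n. x n \<in> A n" using \<tau> by (auto simp: A_def x_def)
    have nx: "norm (x n) = min u (\<rho> n / \<sigma> n)" for n
      using \<tau>[of n] \<sigma>[of n] by (simp add: x_def norm_divide min_def divide_simps)
    have "(\<lambda>n. min u (\<rho> n / \<sigma> n)) \<longlonglongrightarrow> min u l" by (intro tendsto_intros l)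
    hence 1: "(\<lambda>n. norm (x n)) \<longlonglongrightarrow> u" using u by (simp add: nx)
    have 2: "(\<lambda>n. Arg (x n)) \<longlonglongrightarrow> \<alpha>"
    proof (rule tendstoI)
      fix e :: real assume "e > 0"
      from arg[OF this] show "\<forall>\<^sub>F n in sequentially. dist (Arg (x n)) \<alpha> < e"
        by eventually_elim (use \<tau> in \<open>simp add: x_def args dist_real_def\<close>)
    qed
    have "(\<lambda>n. of_real (norm (x n)) * cis (Arg (x n))) \<longlonglongrightarrow> of_real u * cis \<alpha>"
      by (intro tendsto_intros 1 2)
    moreover have "of_real (norm (x n)) * cis (Arg (x n)) = x n" for n
    proof -
      have "x n \<noteq> 0" using nz[of "\<tau> n"] \<tau>[of n] t(1)[of n] \<sigma>[of n] by (auto simp: x_def)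
      thus ?thesis using Arg_eq[of "x n"] by (simp add: cis_conv_exp)
    qed
    ultimately have "x \<longlonglongrightarrow> a" by (simp add: u(3))
    thus ?thesis using xA by blast
  qed
  show "\<exists>r>0. eventually (\<lambda>n. ball z r \<inter> A n = {}) sequentially" if z: "Im z > 0" "z \<notin> seg \<alpha> l" for z
  \<comment> \<open>A point off the segment either lies beyond the tip or has another argument; the
    half gaps \<open>r\<close> and \<open>e\<close> leave room for the approximation.\<close>
  proof (cases "Arg z = \<alpha>")
    case True
    have "z \<noteq> 0" using z(1) by auto
    hence zl: "norm z > l" using z(2) True mem_seg[OF a] by auto
    define r where "r = (norm z - l) / 2"
    have r: "r > 0" using zl by (simp add: r_def)
    have "eventually (\<lambda>n. \<rho> n / \<sigma> n < l + r) sequentially"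
      using order_tendstoD(2)[OF l(2), of "l + r"] r by simp
    hence "eventually (\<lambda>n. ball z r \<inter> A n = {}) sequentially"
    proof eventually_elim
      case (elim n)
      have "w \<notin> A n" if "w \<in> ball z r" for w
      proof
        assume "w \<in> A n"
        hence "norm w \<le> \<rho> n / \<sigma> n" using \<rho>(1) \<sigma>[of n] by (auto simp: A_def norm_divide divide_right_mono)
        hence "norm w < l + r" using elim by simp
        moreover have "norm z \<le> norm w + norm (z - w)" by (metis norm_triangle_sub)
        ultimately show False using that by (simp add: dist_norm r_def field_simps)
      qed
      thus ?case by blast
    qed
    thus ?thesis using r by blast
  next
    case False
    define e where "e = \<bar>Arg z - \<alpha>\<bar> / 2"
    have e: "e > 0" using False by (simp add: e_def)
    have "isCont Arg z" using z(1) by (intro continuous_at_Arg) (auto simp: complex_nonpos_Reals_iff)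
    then obtain r where r: "r > 0" "\<And>w. dist w z < r \<Longrightarrow> dist (Arg w) (Arg z) < e"
      using e unfolding continuous_at_eps_delta by blast
    have "eventually (\<lambda>n. ball z r \<inter> A n = {}) sequentially"
      using arg[OF e]
    proof eventually_elim
      case (elim n)
      have "w \<notin> A n" if "w \<in> ball z r" for w
      proof
        assume "w \<in> A n"
        hence "\<bar>Arg w - \<alpha>\<bar> < e" using elim args by (auto simp: A_def)
        moreover have "\<bar>Arg w - Arg z\<bar> < e" using r(2)[of w] that by (simp add: dist_commute dist_real_def)
        moreover have "\<bar>Arg z - \<alpha>\<bar> \<le> \<bar>Arg w - \<alpha>\<bar> + \<bar>Arg w - Arg z\<bar>" by (simp add: abs_if)
        moreover have "\<bar>Arg z - \<alpha>\<bar> = 2 * e" by (simp add: e_def)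
        ultimately show False by linarith
      qed
      thus ?case by blast
    qed
    thus ?thesis using r(1) by blast
  qed
qed

lemma slit_radius:
  assumes s: "simple_slit \<gamma> T" "\<gamma> 0 = of_real p" and t: "0 < t" "t \<le> T"
  obtains \<rho> where "\<rho> > 0" "\<forall>x\<in>{0..t}. norm (\<gamma> x - of_real p) \<le> \<rho>" "\<exists>x\<in>{0..t}. norm (\<gamma> x - of_real p) = \<rho>"
proof -
  have "continuous_on {0..t} \<gamma>" using s(1) t by (auto simp: simple_slit_def intro: continuous_on_subset)
  hence "continuous_on {0..t} (\<lambda>x. norm (\<gamma> x - of_real p))" by (intro continuous_intros)
  then obtain y where y: "y \<in> {0..t}" "\<And>x. x \<in> {0..t} \<Longrightarrow> norm (\<gamma> x - of_real p) \<le> norm (\<gamma> y - of_real p)"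
    using continuous_attains_sup[OF compact_Icc, of 0 t] t by (metis atLeastAtMost_iff empty_iff less_imp_le order_refl)
  have "Im (\<gamma> t) > 0" using s(1) t by (auto simp: simple_slit_def image_subset_iff)
  hence "0 < norm (\<gamma> t - of_real p)" by (auto simp: complex_eq_iff)
  also have "\<dots> \<le> norm (\<gamma> y - of_real p)" using y(2)[of t] t by simp
  finally show ?thesis using y by (intro that[of "norm (\<gamma> y - of_real p)"]) auto
qed

text \<open>Scaled by its own radius, the slit converges to the unit segment. Capacity is thus
  asymptotic to the squared radius times a constant of the direction, which converts a capacity rate
  into a radius.\<close>

lemma slit_cap_ratio:
  assumes s: "simple_slit \<gamma> T" "\<gamma> 0 = of_real p" and dir: "approaches_in_dir \<gamma> T p \<alpha>" and a: "0 < \<alpha>" "\<alpha> < pi"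
    and t: "\<And>n::nat. 0 < t n \<and> t n \<le> T" "t \<longlonglongrightarrow> 0"
    and \<rho>0: "\<And>n. \<rho> n > 0" and \<rho>: "\<And>n. \<forall>x\<in>{0..t n}. norm (\<gamma> x - of_real p) \<le> \<rho> n"
      "\<And>n. \<exists>x\<in>{0..t n}. norm (\<gamma> x - of_real p) = \<rho> n"
  shows "(\<lambda>n. hcap (\<gamma> ` {0<..t n}) / (\<rho> n)\<^sup>2) \<longlonglongrightarrow> hcap (seg \<alpha> 1)"
proof -
  define A where "A = (\<lambda>n. (\<lambda>z. (z - of_real p) / of_real (\<rho> n)) ` \<gamma> ` {0<..t n})"
  have l: "(\<lambda>n. \<rho> n / \<rho> n) \<longlonglongrightarrow> 1"
    using \<rho>0 by (simp add: less_imp_neq[OF \<rho>0, symmetric])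
  have "\<exists>g b. mapping_out (\<gamma> ` {0<..t n}) g b" for n
    using simple_slit_mapping_out[OF simple_slit_mono[OF s(1)]] t(1) by blast
  then obtain g b where m: "\<And>n. mapping_out (\<gamma> ` {0<..t n}) (g n) (b n)" by metis
  have mA: "\<exists>G. mapping_out (A n) G (b n / (\<rho> n)\<^sup>2)" for n
    unfolding A_def using mapping_out_affine[OF m \<rho>0] by blast
  then obtain G where mA: "\<And>n. mapping_out (A n) (G n) (b n / (\<rho> n)\<^sup>2)" by metis
  obtain g' b' where m': "mapping_out (seg \<alpha> 1) g' b'" using seg_mapping_out[OF a] by (metis zero_less_one)
  have A_eq: "A n = (\<lambda>z. (z - of_real p) / of_real (\<rho> n)) ` \<gamma> ` {0<..t n}" for n by (simp only: A_def)
  note bl = slit_blowup[OF s dir a t \<rho>0 \<rho> zero_less_one l, folded A_eq]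
  have "(\<lambda>n. b n / (\<rho> n)\<^sup>2) \<longlonglongrightarrow> b'"
  proof (rule mapping_out_cap_convergent[OF mA m' zero_less_one])
    show "norm z \<le> 1" if "z \<in> A n" for n z using bl(3)[OF that] \<rho>0[of n] by simp
  qed (use bl(1,2) in blast)+
  thus ?thesis using hcap_eq[OF m] hcap_eq[OF m'] by simp
qed

text \<open>The configuration fixes \<open>p\<close> only through the closures of the slits. Being
  real, \<open>p\<close> lies on neither slit, so it must be the endpoint added by the
  closure.\<close>

lemma two_slit_config_start:
  assumes cfg: "two_slit_config \<gamma>1 \<gamma>2 T p \<alpha>1 \<alpha>2 b1 b2"
  shows "\<gamma>1 0 = of_real p" "\<gamma>2 0 = of_real p" "\<gamma>1 ` {0<..T} \<inter> \<gamma>2 ` {0<..T} = {}"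
proof -
  have s: "simple_slit \<gamma>1 T" "simple_slit \<gamma>2 T"
    and int: "closure (\<gamma>1 ` {0<..T}) \<inter> closure (\<gamma>2 ` {0<..T}) = {of_real p}"
    using cfg by (auto simp: two_slit_config_def)
  have notp: "of_real p \<notin> \<gamma> ` {0<..T}" if "simple_slit \<gamma> T" for \<gamma>
  proof
    assume "of_real p \<in> \<gamma> ` {0<..T}"
    hence "complex_of_real p \<in> upper_hp" using that unfolding simple_slit_def by blast
    thus False by simp
  qed
  have start: "\<gamma> 0 = of_real p" if "simple_slit \<gamma> T" "of_real p \<in> closure (\<gamma> ` {0<..T})" for \<gamma>
  proof -
    have "closed (\<gamma> ` {0..T})" using simple_slit_compact(1)[OF that(1)] by (rule compact_imp_closed)
    hence "closure (\<gamma> ` {0<..T}) \<subseteq> \<gamma> ` {0..T}" by (intro closure_minimal image_mono) auto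
    hence "of_real p \<in> insert (\<gamma> 0) (\<gamma> ` {0<..T})"
      using that(2) simple_slit_compact(2)[OF that(1)] by auto
    thus ?thesis using notp[OF that(1)] by simp
  qed
  have pc: "complex_of_real p \<in> closure (\<gamma>1 ` {0<..T}) \<inter> closure (\<gamma>2 ` {0<..T})" by (simp add: int)
  show "\<gamma>1 0 = of_real p" by (rule start[OF s(1) IntD1[OF pc]])
  show "\<gamma>2 0 = of_real p" by (rule start[OF s(2) IntD2[OF pc]])
  show "\<gamma>1 ` {0<..T} \<inter> \<gamma>2 ` {0<..T} = {}"
  proof (rule equals0I)
    fix x assume x: "x \<in> \<gamma>1 ` {0<..T} \<inter> \<gamma>2 ` {0<..T}"
    have "x \<in> closure (\<gamma>1 ` {0<..T}) \<inter> closure (\<gamma>2 ` {0<..T})"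
      by (intro IntI closure_subset[THEN subsetD] IntD1[OF x] IntD2[OF x])
    hence "x = of_real p" by (simp add: int)
    thus False using IntD1[OF x] notp[OF s(1)] by simp
  qed
qed

text \<open>At time 0 the slit images are empty, so this is the value of every capacity function at
  the point of differentiation.\<close>

lemma hcap_zero: "hcap {} = 0"
  by (rule hcap_eq[OF mapping_out_empty])

lemma tendsto_ratio_from_derivative:
  assumes d: "(f has_real_derivative c) (at 0 within {0..T})" and f0: "f 0 = 0"
    and t: "\<And>n::nat. 0 < t n \<and> t n \<le> T" "t \<longlonglongrightarrow> 0"
  shows "(\<lambda>n. f (t n) / t n) \<longlonglongrightarrow> c"
proof -
  have "((\<lambda>y. f y / y) \<longlongrightarrow> c) (at 0 within {0..T})"
    using d f0 by (simp add: has_field_derivative_iff)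
  hence "((\<lambda>y. f y / y) \<circ> t) \<longlonglongrightarrow> c"
    unfolding tendsto_at_iff_sequentially
  proof (elim allE impE)
    show "\<forall>i. t i \<in> {0..T} - {0}"
    proof
      fix i show "t i \<in> {0..T} - {0}" using t(1)[of i] by auto
    qed
  qed (use t(2) in auto)
  thus ?thesis by (simp add: o_def)
qed

lemma derivative_from_ratio:
  assumes f0: "f 0 = 0"
    and lim: "\<And>t. (\<And>n::nat. 0 < t n \<and> t n \<le> T) \<Longrightarrow> t \<longlonglongrightarrow> 0 \<Longrightarrow> (\<lambda>n. f (t n) / t n) \<longlonglongrightarrow> c"
  shows "(f has_real_derivative c) (at 0 within {0..T})"
proof -
  have "((\<lambda>y. f y / y) \<longlongrightarrow> c) (at 0 within {0..T})"
    unfolding tendsto_at_iff_sequentially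
  proof (intro allI impI)
    fix X :: "nat \<Rightarrow> real" assume X: "\<forall>i. X i \<in> {0..T} - {0}" "X \<longlonglongrightarrow> 0"
    have "0 < X n \<and> X n \<le> T" for n using X(1)[rule_format, of n] by auto
    from lim[OF this X(2)] show "((\<lambda>y. f y / y) \<circ> X) \<longlonglongrightarrow> c" by (simp add: o_def)
  qed
  thus ?thesis using f0 by (simp add: has_field_derivative_iff)
qed

text \<open>Dividing \<open>hcap / t \<rightarrow> b\<close> by
  \<open>hcap / \<rho>^2 \<rightarrow> C\<close> gives
  \<open>\<rho> / sqrt t \<rightarrow> sqrt (b / C)\<close>. Under the common scaling by
  \<open>1 / sqrt t\<close> both slits therefore converge, and the capacity of the rescaled union is
  \<open>joint_hcap / t\<close>.\<close>

lemma joint_hcap_blowup: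
  assumes cfg: "two_slit_config \<gamma>1 \<gamma>2 T p \<alpha>1 \<alpha>2 b1 b2" and b: "0 < b1" "0 < b2"
  obtains l1 l2 where "l1 > 0" "l2 > 0" "hcap (seg \<alpha>1 l1) = b1" "hcap (seg \<alpha>2 l2) = b2"
    "(joint_hcap \<gamma>1 \<gamma>2 has_real_derivative hcap (seg \<alpha>1 l1 \<union> seg \<alpha>2 l2)) (at 0 within {0..T})"
proof -
  note cfg' = cfg[unfolded two_slit_config_def]
  have s: "simple_slit \<gamma>1 T" "simple_slit \<gamma>2 T" and T: "T > 0" using cfg' by (auto simp: simple_slit_def)
  have dir: "approaches_in_dir \<gamma>1 T p \<alpha>1" "approaches_in_dir \<gamma>2 T p \<alpha>2"
    and a1: "0 < \<alpha>1" "\<alpha>1 < pi" and a2: "0 < \<alpha>2" "\<alpha>2 < pi" using cfg' by auto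
  have start: "\<gamma>1 0 = of_real p" "\<gamma>2 0 = of_real p" and dis: "\<gamma>1 ` {0<..T} \<inter> \<gamma>2 ` {0<..T} = {}"
    using two_slit_config_start[OF cfg] by auto
  define C1 where "C1 = hcap (seg \<alpha>1 1)"
  define C2 where "C2 = hcap (seg \<alpha>2 1)"
  have C: "C1 > 0" "C2 > 0" unfolding C1_def C2_def by (intro hcap_seg_pos a1 a2 zero_less_one)+
  \<comment> \<open>The length at which quadratic scaling gives
    \<open>l1^2 * C1 = b1\<close>.\<close>
  define l1 where "l1 = sqrt (b1 / C1)"
  define l2 where "l2 = sqrt (b2 / C2)"
  have l: "l1 > 0" "l2 > 0" using b C by (simp_all add: l1_def l2_def)
  have hl: "hcap (seg \<alpha>1 l1) = b1" "hcap (seg \<alpha>2 l2) = b2"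
    using hcap_seg[OF a1 l(1)] hcap_seg[OF a2 l(2)] b C
    by (simp_all add: l1_def l2_def C1_def[symmetric] C2_def[symmetric])
  have radius: "(\<lambda>n. \<rho> n / sqrt (t n)) \<longlonglongrightarrow> sqrt (b0 / C0)"
    if sl: "simple_slit \<gamma> T" "\<gamma> 0 = of_real p" and d: "approaches_in_dir \<gamma> T p \<alpha>" and a: "0 < \<alpha>" "\<alpha> < pi"
      and t: "\<And>n::nat. 0 < t n \<and> t n \<le> T" "t \<longlonglongrightarrow> 0"
      and \<rho>0: "\<And>n. \<rho> n > 0" and \<rho>: "\<And>n. \<forall>x\<in>{0..t n}. norm (\<gamma> x - of_real p) \<le> \<rho> n"
        "\<And>n. \<exists>x\<in>{0..t n}. norm (\<gamma> x - of_real p) = \<rho> n"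
      and der: "((\<lambda>t. hcap (\<gamma> ` {0<..t})) has_real_derivative b0) (at 0 within {0..T})"
      and C0: "C0 = hcap (seg \<alpha> 1)" "C0 > 0" and b0: "b0 > 0"
    for \<gamma> \<alpha> b0 C0 and t \<rho> :: "nat \<Rightarrow> real"
  proof -
    have r1: "(\<lambda>n. hcap (\<gamma> ` {0<..t n}) / (\<rho> n)\<^sup>2) \<longlonglongrightarrow> C0"
      unfolding C0(1) by (rule slit_cap_ratio[OF sl d a t \<rho>0 \<rho>])
    have r2: "(\<lambda>n. hcap (\<gamma> ` {0<..t n}) / t n) \<longlonglongrightarrow> b0"
      by (rule tendsto_ratio_from_derivative[OF der _ t]) (simp add: hcap_zero)
    have pos: "hcap (\<gamma> ` {0<..t n}) > 0" for n
    proof -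
      have "\<exists>g b. mapping_out (\<gamma> ` {0<..t n}) g b"
        using simple_slit_mapping_out[OF simple_slit_mono[OF sl(1)]] t(1) by blast
      moreover have "\<gamma> ` {0<..t n} \<noteq> {}" using t(1)[of n] by auto
      ultimately show ?thesis using hcap_pos by blast
    qed
    have "(\<lambda>n. sqrt ((hcap (\<gamma> ` {0<..t n}) / t n) / (hcap (\<gamma> ` {0<..t n}) / (\<rho> n)\<^sup>2))) \<longlonglongrightarrow> sqrt (b0 / C0)"
      using C0 by (intro tendsto_intros r1 r2) auto
    moreover have "sqrt ((hcap (\<gamma> ` {0<..t n}) / t n) / (hcap (\<gamma> ` {0<..t n}) / (\<rho> n)\<^sup>2)) = \<rho> n / sqrt (t n)" for n
    proof -
      have "(hcap (\<gamma> ` {0<..t n}) / t n) / (hcap (\<gamma> ` {0<..t n}) / (\<rho> n)\<^sup>2) = (\<rho> n)\<^sup>2 / t n"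
        using pos[of n] \<rho>0[of n] by simp
      thus ?thesis using \<rho>0[of n] by (simp add: real_sqrt_divide)
    qed
    ultimately show ?thesis by simp
  qed
  have "(joint_hcap \<gamma>1 \<gamma>2 has_real_derivative hcap (seg \<alpha>1 l1 \<union> seg \<alpha>2 l2)) (at 0 within {0..T})"
  proof (rule derivative_from_ratio)
    show "joint_hcap \<gamma>1 \<gamma>2 0 = 0" by (simp add: joint_hcap_def hcap_zero)
    fix t :: "nat \<Rightarrow> real" assume t: "\<And>n. 0 < t n \<and> t n \<le> T" "t \<longlonglongrightarrow> 0"
    have "\<exists>\<rho>>0. (\<forall>x\<in>{0..t n}. norm (\<gamma>1 x - of_real p) \<le> \<rho>) \<and> (\<exists>x\<in>{0..t n}. norm (\<gamma>1 x - of_real p) = \<rho>)" for n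
      using slit_radius[OF s(1) start(1), of "t n"] t(1)[of n] by metis
    then obtain \<rho>1 where \<rho>1: "\<And>n. \<rho>1 n > 0" "\<And>n. \<forall>x\<in>{0..t n}. norm (\<gamma>1 x - of_real p) \<le> \<rho>1 n"
      "\<And>n. \<exists>x\<in>{0..t n}. norm (\<gamma>1 x - of_real p) = \<rho>1 n" by metis
    have "\<exists>\<rho>>0. (\<forall>x\<in>{0..t n}. norm (\<gamma>2 x - of_real p) \<le> \<rho>) \<and> (\<exists>x\<in>{0..t n}. norm (\<gamma>2 x - of_real p) = \<rho>)" for n
      using slit_radius[OF s(2) start(2), of "t n"] t(1)[of n] by metis
    then obtain \<rho>2 where \<rho>2: "\<And>n. \<rho>2 n > 0" "\<And>n. \<forall>x\<in>{0..t n}. norm (\<gamma>2 x - of_real p) \<le> \<rho>2 n"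
      "\<And>n. \<exists>x\<in>{0..t n}. norm (\<gamma>2 x - of_real p) = \<rho>2 n" by metis
    have st: "0 < sqrt (t n)" for n using t(1)[of n] by simp
    have r1: "(\<lambda>n. \<rho>1 n / sqrt (t n)) \<longlonglongrightarrow> l1"
      unfolding l1_def
      by (rule radius[OF s(1) start(1) dir(1) a1 t \<rho>1 _ C1_def C(1) b(1)]) (use cfg' in simp)
    have r2: "(\<lambda>n. \<rho>2 n / sqrt (t n)) \<longlonglongrightarrow> l2"
      unfolding l2_def
      by (rule radius[OF s(2) start(2) dir(2) a2 t \<rho>2 _ C2_def C(2) b(2)]) (use cfg' in simp)
    define A1 where "A1 = (\<lambda>n. (\<lambda>z. (z - of_real p) / of_real (sqrt (t n))) ` \<gamma>1 ` {0<..t n})"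
    define A2 where "A2 = (\<lambda>n. (\<lambda>z. (z - of_real p) / of_real (sqrt (t n))) ` \<gamma>2 ` {0<..t n})"
    have A1_eq: "A1 n = (\<lambda>z. (z - of_real p) / of_real (sqrt (t n))) ` \<gamma>1 ` {0<..t n}" for n by (simp only: A1_def)
    have A2_eq: "A2 n = (\<lambda>z. (z - of_real p) / of_real (sqrt (t n))) ` \<gamma>2 ` {0<..t n}" for n by (simp only: A2_def)
    note B1 = slit_blowup[OF s(1) start(1) dir(1) a1 t st \<rho>1(2,3) l(1) r1, folded A1_eq]
    note B2 = slit_blowup[OF s(2) start(2) dir(2) a2 t st \<rho>2(2,3) l(2) r2, folded A2_eq]
    have "\<exists>g b. mapping_out (\<gamma>1 ` {0<..t n} \<union> \<gamma>2 ` {0<..t n}) g b" for n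
    proof (rule two_slits_mapping_out)
      show "simple_slit \<gamma>1 (t n)" "simple_slit \<gamma>2 (t n)" using s t(1)[of n] by (auto intro: simple_slit_mono)
      show "\<gamma>1 0 = \<gamma>2 0" using start by simp
      have "{0<..t n} \<subseteq> {0<..T}" using t(1)[of n] by auto
      thus "\<gamma>1 ` {0<..t n} \<inter> \<gamma>2 ` {0<..t n} = {}" using dis by blast
    qed
    then obtain g c where m: "\<And>n. mapping_out (\<gamma>1 ` {0<..t n} \<union> \<gamma>2 ` {0<..t n}) (g n) (c n)" by metis
    have U: "(\<lambda>z. (z - of_real p) / of_real (sqrt (t n))) ` (\<gamma>1 ` {0<..t n} \<union> \<gamma>2 ` {0<..t n}) = A1 n \<union> A2 n" for n
      by (simp only: A1_eq A2_eq image_Un)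
    have "\<exists>G. mapping_out (A1 n \<union> A2 n) G (c n / (sqrt (t n))\<^sup>2)" for n
      using mapping_out_affine[OF m[of n] st[of n], of p] unfolding U by blast
    then obtain G where mA: "\<And>n. mapping_out (A1 n \<union> A2 n) (G n) (c n / (sqrt (t n))\<^sup>2)" by metis
    obtain g' c' where m': "mapping_out (seg \<alpha>1 l1 \<union> seg \<alpha>2 l2) g' c'"
      using two_seg_mapping_out[OF a1 a2 l] by blast
    obtain R1 where R1: "\<And>n. norm (\<rho>1 n / sqrt (t n)) \<le> R1"
      using convergent_imp_Bseq[OF convergentI[OF r1]] by (auto simp: Bseq_def)
    obtain R2 where R2: "\<And>n. norm (\<rho>2 n / sqrt (t n)) \<le> R2"
      using convergent_imp_Bseq[OF convergentI[OF r2]] by (auto simp: Bseq_def)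
    define R where "R = max 1 (max R1 R2)"
    have "(\<lambda>n. c n / (sqrt (t n))\<^sup>2) \<longlonglongrightarrow> c'"
    proof (rule mapping_out_cap_convergent[OF mA m'])
      show "R > 0" by (simp add: R_def)
      show "norm z \<le> R" if z: "z \<in> A1 n \<union> A2 n" for n z
      proof -
        have "norm z \<le> \<rho>1 n / sqrt (t n) \<or> norm z \<le> \<rho>2 n / sqrt (t n)" using z B1(3) B2(3) by blast
        moreover have "\<rho>1 n / sqrt (t n) \<le> R1" "\<rho>2 n / sqrt (t n) \<le> R2"
          using R1[of n] R2[of n] unfolding real_norm_def by (blast dest: abs_le_D1)+
        ultimately show ?thesis unfolding R_def by linarith
      qed
      show "\<exists>x. (\<forall>n. x n \<in> A1 n \<union> A2 n) \<and> x \<longlonglongrightarrow> a" if "a \<in> seg \<alpha>1 l1 \<union> seg \<alpha>2 l2" for a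
        using that B1(1)[of a] B2(1)[of a] by blast
      show "\<exists>r>0. eventually (\<lambda>n. ball z r \<inter> (A1 n \<union> A2 n) = {}) sequentially"
        if z: "Im z > 0" "z \<notin> seg \<alpha>1 l1 \<union> seg \<alpha>2 l2" for z
      proof -
        obtain d1 where d1: "d1 > 0" "eventually (\<lambda>n. ball z d1 \<inter> A1 n = {}) sequentially" using B1(2)[of z] z by blast
        obtain d2 where d2: "d2 > 0" "eventually (\<lambda>n. ball z d2 \<inter> A2 n = {}) sequentially" using B2(2)[of z] z by blast
        have sub: "ball z (min d1 d2) \<subseteq> ball z d1" "ball z (min d1 d2) \<subseteq> ball z d2" by auto
        have "eventually (\<lambda>n. ball z (min d1 d2) \<inter> (A1 n \<union> A2 n) = {}) sequentially"
          using d1(2) d2(2) by eventually_elim (use sub in blast)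
        thus ?thesis using d1(1) d2(1) by (intro exI[of _ "min d1 d2"]) auto
      qed
    qed
    moreover have "c n / (sqrt (t n))\<^sup>2 = joint_hcap \<gamma>1 \<gamma>2 (t n) / t n" for n
      using hcap_eq[OF m, of n] t(1)[of n] by (simp add: joint_hcap_def)
    ultimately show "(\<lambda>n. joint_hcap \<gamma>1 \<gamma>2 (t n) / t n) \<longlonglongrightarrow> hcap (seg \<alpha>1 l1 \<union> seg \<alpha>2 l2)"
      using hcap_eq[OF m'] by simp
  qed
  thus thesis using l hl that by blast
qed

section \<open>The capacity of a segment\<close>

text \<open>The branch of the logarithm that is continuous on the closed upper half-plane without 0.\<close>
definition lg :: "complex \<Rightarrow> complex" where
  "lg w = Ln (- \<i> * w) + \<i> * of_real (pi / 2)"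

lemma lg_nonpos:
  assumes "Im w \<ge> 0" "w \<noteq> 0"
  shows "- \<i> * w \<notin> \<real>\<^sub>\<le>\<^sub>0"
  using assms by (auto simp: complex_nonpos_Reals_iff complex_eq_iff)

lemma lg_Re: "w \<noteq> 0 \<Longrightarrow> Re (lg w) = ln (norm w)"
  by (simp add: lg_def norm_mult)

lemma lg_Im:
  assumes "Im w > 0"
  shows "0 < Im (lg w)" "Im (lg w) < pi"
proof -
  have "w \<noteq> 0" using assms by auto
  hence "\<bar>Im (Ln (- \<i> * w))\<bar> < pi / 2" using Re_Ln_pos_lt[of "- \<i> * w"] assms by simp
  hence "- (pi / 2) < Im (Ln (- \<i> * w))" "Im (Ln (- \<i> * w)) < pi / 2" by (simp_all only: abs_less_iff) auto
  thus "0 < Im (lg w)" "Im (lg w) < pi" by (simp_all add: lg_def)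
qed

lemma lg_pos: "x > 0 \<Longrightarrow> lg (of_real x) = of_real (ln x)"
  using Ln_times_of_real[of x "- \<i>"] by (simp add: lg_def mult.commute Ln_of_real)

lemma lg_neg: "x > 0 \<Longrightarrow> lg (- of_real x) = of_real (ln x) + \<i> * of_real pi"
  using Ln_times_of_real[of x "\<i>"] by (simp add: lg_def mult.commute field_simps Ln_of_real)

lemma lg_isCont:
  assumes "Im w \<ge> 0" "w \<noteq> 0"
  shows "isCont lg w"
  unfolding lg_def using lg_nonpos[OF assms] by (intro continuous_intros isCont_Ln') auto

lemma lg_deriv:
  assumes "Im w > 0"
  shows "(lg has_field_derivative 1 / w) (at w)"
proof -
  have "w \<noteq> 0" using assms by auto
  moreover have "- \<i> * w \<notin> \<real>\<^sub>\<le>\<^sub>0" using lg_nonpos[of w] assms \<open>w \<noteq> 0\<close> by simp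
  ultimately show ?thesis unfolding lg_def[abs_def]
    by (auto intro!: derivative_eq_intros simp: divide_simps)
qed

section \<open>The conformal map onto the complement of a segment of direction
  \<open>pi * s\<close>\<close>

locale slit_map =
  fixes s :: real
  assumes s: "0 < s" "s < 1"
begin

text \<open>\<open>f\<close> is the product \<open>(w + s)^(1 - s) * (w - (1 - s))^s\<close>. On the
  real line its argument is \<open>pi\<close> left of \<open>- s\<close>, \<open>pi * s\<close>
  between the branch points and 0 to their right. The branch points are placed so that their sum
  with weights \<open>1 - s\<close> and \<open>s\<close> vanishes, which removes the constant term
  at infinity.\<close>

definition L where "L w = of_real (1 - s) * lg (w + of_real s) + of_real s * lg (w - of_real (1 - s))"
definition f where "f w = exp (L w)"
text \<open>The modulus of \<open>f\<close> at its critical point \<open>1 - 2 * s\<close>, where it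
  is maximal between the branch points.\<close>

definition tip where "tip = exp ((1 - s) * ln (1 - s) + s * ln s)"

lemma L_Im:
  assumes "Im w > 0"
  shows "0 < Im (L w)" "Im (L w) < pi"
proof -
  have i: "Im (w + of_real s) > 0" "Im (w - of_real (1 - s)) > 0" using assms by auto
  have e: "Im (L w) = (1 - s) * Im (lg (w + of_real s)) + s * Im (lg (w - of_real (1 - s)))"
    by (simp add: L_def)
  show "0 < Im (L w)" unfolding e using s lg_Im(1)[OF i(1)] lg_Im(1)[OF i(2)] by (intro add_pos_pos mult_pos_pos) auto
  have "(1 - s) * Im (lg (w + of_real s)) < (1 - s) * pi" "s * Im (lg (w - of_real (1 - s))) < s * pi"
    using s lg_Im(2)[OF i(1)] lg_Im(2)[OF i(2)] by simp_all
  thus "Im (L w) < pi" unfolding e by (simp add: algebra_simps)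
qed

lemma f_Im: "Im w > 0 \<Longrightarrow> Im (f w) > 0"
  using L_Im[of w] sin_gt_zero[of "Im (L w)"] by (simp add: f_def Im_exp)

lemma L_deriv:
  assumes "Im w > 0"
  shows "(L has_field_derivative of_real (1 - s) / (w + of_real s) + of_real s / (w - of_real (1 - s))) (at w)"
proof -
  have i: "Im (w + of_real s) > 0" "Im (w - of_real (1 - s)) > 0" using assms by auto
  have "((\<lambda>w. lg (w + of_real s)) has_field_derivative 1 / (w + of_real s) * 1) (at w)"
    by (rule DERIV_chain2[where f = lg and g = "\<lambda>w. w + of_real s", OF lg_deriv[OF i(1)]]) (auto intro!: derivative_eq_intros)
  moreover have "((\<lambda>w. lg (w - of_real (1 - s))) has_field_derivative 1 / (w - of_real (1 - s)) * 1) (at w)"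
    by (rule DERIV_chain2[where f = lg and g = "\<lambda>w. w - of_real (1 - s)", OF lg_deriv[OF i(2)]]) (auto intro!: derivative_eq_intros)
  ultimately have "((\<lambda>w. of_real (1 - s) * lg (w + of_real s) + of_real s * lg (w - of_real (1 - s))) has_field_derivative
     of_real (1 - s) * (1 / (w + of_real s) * 1) + of_real s * (1 / (w - of_real (1 - s)) * 1)) (at w)"
    by (intro DERIV_add DERIV_cmult)
  thus ?thesis by (simp add: L_def[abs_def])
qed

lemma L_deriv_Im:
  assumes "Im w > 0"
  shows "Im (of_real (1 - s) / (w + of_real s) + of_real s / (w - of_real (1 - s))) < 0"
proof -
  have "Im (of_real c / z) < 0" if "c > 0" "Im z > 0" for c z
  proof -
    have "z \<noteq> 0" using that by auto
    thus ?thesis using that by (simp add: Im_complex_div_lt_0)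
  qed
  from this[of "1 - s" "w + of_real s"] this[of s "w - of_real (1 - s)"] s assms show ?thesis
    unfolding plus_complex.simps by (intro add_neg_neg) auto
qed

text \<open>The Noshiro-Warschawski argument: on a convex domain the derivative of \<open>L\<close>
  has negative imaginary part, so \<open>Im (L / d)\<close> decreases strictly along the segment
  from \<open>w1\<close> to \<open>w2\<close>.\<close>

lemma L_inj: "inj_on L upper_hp"
proof (rule inj_onI, rule ccontr)
  fix w1 w2 assume w: "w1 \<in> upper_hp" "w2 \<in> upper_hp" and eq: "L w1 = L w2" and ne: "w1 \<noteq> w2"
  define d where "d = w2 - w1"
  have d: "d \<noteq> 0" using ne by (simp add: d_def)
  define p where "p = (\<lambda>t::real. w1 + of_real t * d)"
  define q where "q = (\<lambda>t. of_real (1 - s) / (p t + of_real s) + of_real s / (p t - of_real (1 - s)))"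
  have pp: "Im (p t) > 0" if "0 \<le> t" "t \<le> 1" for t
  proof -
    have "p t = (1 - t) *\<^sub>R w1 + t *\<^sub>R w2" by (simp add: p_def d_def scaleR_conv_of_real algebra_simps)
    moreover have "(1 - t) *\<^sub>R w1 + t *\<^sub>R w2 \<in> upper_hp"
      using that w by (intro convexD[OF convex_upper_hp]) auto
    ultimately show ?thesis by simp
  qed
  have "Im (L (p 1) / d) < Im (L (p 0) / d)"
  proof (rule DERIV_neg_imp_decreasing[where f = "\<lambda>t. Im (L (p t) / d)" and a = 0 and b = 1])
    fix t :: real assume t: "0 \<le> t" "t \<le> 1"
    have "(p has_vector_derivative d) (at t)"
      unfolding p_def by (auto intro!: derivative_eq_intros simp: has_vector_derivative_def scaleR_conv_of_real mult.commute)
    from field_vector_diff_chain_at[OF this L_deriv[OF pp[OF t]]]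
    have "((L \<circ> p) has_vector_derivative d * q t) (at t)" by (simp add: q_def)
    hence "((\<lambda>t. L (p t) / d) has_vector_derivative d * q t / d) (at t)"
      using has_vector_derivative_divide[of "L \<circ> p" "d * q t" "at t" d] by (simp add: o_def)
    hence "((\<lambda>t. L (p t) / d) has_vector_derivative q t) (at t)" using d by simp
    hence "((\<lambda>t. Im (L (p t) / d)) has_real_derivative Im (q t)) (at t)"
      by (auto simp: has_vector_derivative_complex_iff has_real_derivative_iff_has_vector_derivative)
    thus "\<exists>y. ((\<lambda>t. Im (L (p t) / d)) has_real_derivative y) (at t) \<and> y < 0"
      using L_deriv_Im[OF pp[OF t]] unfolding q_def by blast
  qed simp
  thus False using eq by (simp add: p_def d_def)
qed

lemma L_holomorphic: "L holomorphic_on upper_hp"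
  unfolding holomorphic_on_open[OF open_upper_hp] using L_deriv mem_upper_hp by blast

lemma f_holomorphic: "f holomorphic_on upper_hp"
  unfolding f_def[abs_def] by (intro holomorphic_intros L_holomorphic)

text \<open>\<open>L\<close> takes its values in the strip \<open>0 < Im < pi\<close>, on which
  \<open>exp\<close> is injective.\<close>

lemma f_inj: "inj_on f upper_hp"
proof (rule inj_onI)
  fix x y assume x: "x \<in> upper_hp" and y: "y \<in> upper_hp" and eq: "f x = f y"
  have "\<bar>Im (L x) - Im (L y)\<bar> < 2 * pi" using L_Im[of x] L_Im[of y] x y by simp
  hence "L x = L y" using eq unfolding f_def by (rule exp_complex_eqI)
  thus "x = y" using inj_onD[OF L_inj] x y by blast
qed

lemma f_norm:
  assumes "w \<noteq> - of_real s" "w \<noteq> of_real (1 - s)"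
  shows "norm (f w) = norm (w + of_real s) powr (1 - s) * norm (w - of_real (1 - s)) powr s"
proof -
  have "w + of_real s \<noteq> 0" "w - of_real (1 - s) \<noteq> 0"
    using assms by (auto simp: eq_neg_iff_add_eq_0)
  hence "Re (L w) = (1 - s) * ln (norm (w + of_real s)) + s * ln (norm (w - of_real (1 - s)))"
    by (simp add: L_def lg_Re del: of_real_diff)
  thus ?thesis using \<open>w + of_real s \<noteq> 0\<close> \<open>w - of_real (1 - s) \<noteq> 0\<close>
    unfolding f_def norm_exp_eq_Re by (simp add: powr_def exp_add del: of_real_diff)
qed

lemma f_isCont:
  assumes "Im w \<ge> 0" "w \<noteq> - of_real s" "w \<noteq> of_real (1 - s)"
  shows "isCont f w"
proof -
  have n: "w + of_real s \<noteq> 0" "w - of_real (1 - s) \<noteq> 0"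
    using assms by (auto simp: eq_neg_iff_add_eq_0)
  have "isCont (\<lambda>w. lg (w + of_real s)) w"
    using assms n by (intro isCont_o2[OF _ lg_isCont] continuous_intros) auto
  moreover have "isCont (\<lambda>w. lg (w - of_real (1 - s))) w"
    using assms n by (intro isCont_o2[OF _ lg_isCont] continuous_intros) auto
  ultimately show ?thesis unfolding f_def[abs_def] L_def[abs_def] by (intro continuous_intros)
qed

lemma f_right: "x > 1 - s \<Longrightarrow> f (of_real x) \<in> \<real>"
proof -
  assume "x > 1 - s"
  hence "lg (of_real x + of_real s) = of_real (ln (x + s))" "lg (of_real x - of_real (1 - s)) = of_real (ln (x - (1 - s)))"
    using lg_pos[of "x + s"] lg_pos[of "x - (1 - s)"] s by simp_all
  hence "L (of_real x) = of_real ((1 - s) * ln (x + s) + s * ln (x - (1 - s)))" by (simp only: L_def) simp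
  thus ?thesis unfolding f_def by (metis Reals_of_real exp_of_real)
qed

lemma f_left: "x < - s \<Longrightarrow> f (of_real x) \<in> \<real>"
proof -
  assume x: "x < - s"
  hence "lg (of_real x + of_real s) = of_real (ln (- x - s)) + \<i> * of_real pi"
     "lg (of_real x - of_real (1 - s)) = of_real (ln (1 - s - x)) + \<i> * of_real pi"
    using lg_neg[of "- x - s"] lg_neg[of "1 - s - x"] s by (simp_all add: algebra_simps)
  hence "L (of_real x) = of_real ((1 - s) * ln (- x - s) + s * ln (1 - s - x)) + \<i> * of_real pi"
    by (simp only: L_def) (simp add: algebra_simps)
  hence "f (of_real x) = of_real (exp ((1 - s) * ln (- x - s) + s * ln (1 - s - x))) * (- 1)"
    unfolding f_def by (simp only: exp_add exp_of_real) (simp add: exp_pi_i')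
  thus ?thesis by simp
qed

lemma f_middle:
  assumes "- s < x" "x < 1 - s"
  shows "f (of_real x) = of_real (exp ((1 - s) * ln (x + s) + s * ln (1 - s - x))) * cis (pi * s)"
proof -
  have "lg (of_real x + of_real s) = of_real (ln (x + s))"
     "lg (of_real x - of_real (1 - s)) = of_real (ln (1 - s - x)) + \<i> * of_real pi"
    using lg_pos[of "x + s"] lg_neg[of "1 - s - x"] assms by simp_all
  hence "L (of_real x) = of_real ((1 - s) * ln (x + s) + s * ln (1 - s - x)) + \<i> * of_real (pi * s)"
    by (simp only: L_def) (simp add: algebra_simps)
  thus ?thesis unfolding f_def by (simp only: exp_add exp_of_real cis_conv_exp)
qed

lemma ln_tangent: "u > 0 \<Longrightarrow> c > 0 \<Longrightarrow> c * ln u \<le> c * ln c + (u - c)" for u c :: real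
proof -
  assume a: "u > 0" "c > 0"
  have "ln (u / c) \<le> u / c - 1" using a by (intro ln_le_minus_one) simp
  hence "c * ln (u / c) \<le> c * (u / c - 1)" using a by (intro mult_left_mono) auto
  thus ?thesis using a by (simp add: ln_div algebra_simps)
qed

text \<open>Concavity of the logarithm, used through \<open>ln_tangent\<close> at
  \<open>1 - s\<close> and \<open>s\<close>, bounds the exponent by its value at
  \<open>1 - 2 * s\<close>; the two linear corrections cancel.\<close>

lemma f_middle_seg:
  assumes "- s < x" "x < 1 - s"
  shows "f (of_real x) \<in> seg (pi * s) tip"
proof -
  have "(1 - s) * ln (x + s) + s * ln (1 - s - x) \<le> (1 - s) * ln (1 - s) + s * ln s"
    using ln_tangent[of "x + s" "1 - s"] ln_tangent[of "1 - s - x" s] assms s by simp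
  thus ?thesis unfolding f_middle[OF assms] seg_def tip_def by (intro imageI) simp
qed

lemma seg_boundary_value:
  assumes a: "a \<in> seg (pi * s) tip"
  obtains x where "- s < x" "x < 1 - s" "f (of_real x) = a"
proof -
  obtain r where r: "0 < r" "r \<le> tip" "a = of_real r * cis (pi * s)" using a by (auto simp: seg_def)
  \<comment> \<open>\<open>powr\<close> replaces \<open>exp\<close> and \<open>ln\<close> because
    \<open>0 powr (1 - s) = 0\<close> is the correct endpoint value at \<open>- s\<close>, whereas
    the default \<open>ln 0 = 0\<close> would not give it.\<close>
  define h where "h = (\<lambda>x. (x + s) powr (1 - s) * (1 - s - x) powr s)"
  have hm: "h x = exp ((1 - s) * ln (x + s) + s * ln (1 - s - x))" if "- s < x" "x < 1 - s" for x
    using that by (simp add: h_def powr_def exp_add)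
  have "\<exists>x\<ge>- s. x \<le> 1 - 2 * s \<and> h x = r"
  proof (rule IVT')
    show "h (- s) \<le> r" using r by (simp add: h_def)
    show "r \<le> h (1 - 2 * s)" using r s by (subst hm) (auto simp: tip_def)
    show "- s \<le> 1 - 2 * s" using s by simp
    show "continuous_on {- s..1 - 2 * s} h"
      unfolding h_def using s by (intro continuous_intros continuous_on_powr') auto
  qed
  then obtain x where x: "- s \<le> x" "x \<le> 1 - 2 * s" "h x = r" by blast
  have "x \<noteq> - s" using x(3) r(1) by (auto simp: h_def)
  hence x': "- s < x" "x < 1 - s" using x s by auto
  show thesis using that[OF x'] f_middle[OF x'] hm[OF x'] x(3) r(3) by simp
qed

text \<open>The modulus of \<open>f\<close> is a weighted geometric mean of two distances, each at
  least \<open>norm w - 1\<close>. This keeps preimages of bounded sequences bounded.\<close>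

lemma norm_large: "norm w \<ge> 1 \<Longrightarrow> norm w - 1 \<le> norm (f w)"
proof (cases "w = - of_real s \<or> w = of_real (1 - s)")
  case True
  hence "norm w < 1" using s by (auto simp del: of_real_diff)
  thus "norm w \<ge> 1 \<Longrightarrow> norm w - 1 \<le> norm (f w)" by simp
next
  case False
  assume w: "norm w \<ge> 1"
  have "norm w - 1 \<le> norm w - s" "norm w - 1 \<le> norm w - (1 - s)" using s by auto
  moreover have "norm w - s \<le> norm (w + of_real s)" using norm_diff_ineq[of w "of_real s"] s by simp
  moreover have "norm w - (1 - s) \<le> norm (w - of_real (1 - s))"
    using norm_triangle_ineq2[of w "of_real (1 - s)"] s by (simp del: of_real_diff)
  ultimately have b: "norm w - 1 \<le> norm (w + of_real s)" "norm w - 1 \<le> norm (w - of_real (1 - s))" by linarith+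
  have "norm w - 1 = (norm w - 1) powr (1 - s) * (norm w - 1) powr s"
    using w by (simp flip: powr_add)
  also have "\<dots> \<le> norm (w + of_real s) powr (1 - s) * norm (w - of_real (1 - s)) powr s"
    using b w s by (intro mult_mono powr_mono2) auto
  also have "\<dots> = norm (f w)" using f_norm[of w] False by simp
  finally show ?thesis .
qed

text \<open>At the branch points \<open>lg\<close> is of no use, but the modulus of \<open>f\<close>
  tends to 0; at all other real points \<open>f\<close> is continuous up to the boundary.\<close>

lemma f_boundary:
  assumes w: "\<And>n::nat. Im (w n) > 0" "w \<longlonglongrightarrow> l" "Im l = 0" and y: "(\<lambda>n. f (w n)) \<longlonglongrightarrow> y"
  shows "y \<in> \<real> \<union> seg (pi * s) tip"
proof -
  have l: "l = of_real (Re l)" using w(3) by (simp add: complex_eq_iff)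
  show ?thesis
  proof (cases "l = - of_real s \<or> l = of_real (1 - s)")
    case True
    have "(\<lambda>n. norm (w n + of_real s) powr (1 - s) * norm (w n - of_real (1 - s)) powr s) \<longlonglongrightarrow>
        norm (l + of_real s) powr (1 - s) * norm (l - of_real (1 - s)) powr s"
      using s by (intro tendsto_intros w tendsto_powr') auto
    moreover have "norm (w n + of_real s) powr (1 - s) * norm (w n - of_real (1 - s)) powr s = norm (f (w n))" for n
      using w(1)[of n] by (subst f_norm) auto
    moreover have "norm (l + of_real s) powr (1 - s) * norm (l - of_real (1 - s)) powr s = 0"
      using True by auto
    ultimately have "(\<lambda>n. norm (f (w n))) \<longlonglongrightarrow> 0" by (simp only:)
    hence "y = 0" using y tendsto_norm_zero_iff LIMSEQ_unique by metis
    thus ?thesis by simp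
  next
    case False
    have "(\<lambda>n. f (w n)) \<longlonglongrightarrow> f l"
      using False w(3) by (intro isCont_tendsto_compose[OF f_isCont w(2)]) auto
    hence yl: "y = f (of_real (Re l))" using y LIMSEQ_unique l by metis
    have "Re l \<noteq> - s" "Re l \<noteq> 1 - s" using False l by (metis of_real_minus, metis)
    then consider "Re l < - s" | "- s < Re l" "Re l < 1 - s" | "Re l > 1 - s" by linarith
    thus ?thesis unfolding yl using f_left f_right f_middle_seg by cases auto
  qed
qed

text \<open>The image is open, misses the segment and is relatively closed in its complement. That
  complement is connected because the inverse of an abstract mapping-out function parametrizes it,
  so the image is everything.\<close>

lemma f_image: "f ` upper_hp = upper_hp - seg (pi * s) tip"
proof -
  let ?S = "seg (pi * s) tip"
  have \<alpha>: "0 < pi * s" "pi * s < pi" using s by auto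
  obtain g b where m: "mapping_out ?S g b"
    using seg_mapping_out[OF \<alpha>, of tip] by (auto simp: tip_def)
  obtain f' where f': "f' holomorphic_on upper_hp" "f' ` upper_hp = upper_hp - ?S"
    using mapping_out_inverse[OF m] by metis
  have "connected (f' ` upper_hp)"
    by (intro connected_continuous_image holomorphic_on_imp_continuous_on f'(1) connected_upper_hp)
  hence con: "connected (upper_hp - ?S)" by (simp only: f'(2))
  have op: "open (f ` upper_hp)"
    by (rule open_mapping_thm3[OF f_holomorphic open_upper_hp f_inj])
  \<comment> \<open>A point of the segment is the boundary value at some real \<open>x\<close>. If
    it were also \<open>f w\<close>, continuity of the inverse along points tending to
    \<open>x\<close> would give \<open>w = x\<close>.\<close>
  have notS: "f w \<notin> ?S" if w: "Im w > 0" for w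
  proof
    assume "f w \<in> ?S"
    then obtain x where x: "- s < x" "x < 1 - s" "f (of_real x) = f w" by (rule seg_boundary_value)
    obtain h where "h holomorphic_on (f ` upper_hp)"
      and h: "\<And>z. z \<in> upper_hp \<Longrightarrow> deriv f z * deriv h (f z) = 1 \<and> h (f z) = z"
      using holomorphic_has_inverse[OF f_holomorphic open_upper_hp f_inj] by metis
    hence "continuous_on (f ` upper_hp) h" by (intro holomorphic_on_imp_continuous_on)
    moreover have "f w \<in> f ` upper_hp" using w by simp
    ultimately have hc: "isCont h (f w)" using continuous_on_eq_continuous_at[OF op] by blast
    define v where "v = (\<lambda>n. of_real x + \<i> * of_real (inverse (real (Suc n))))"
    have "v \<longlonglongrightarrow> of_real x + \<i> * of_real 0"
      unfolding v_def by (intro tendsto_intros LIMSEQ_inverse_real_of_nat)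
    hence v: "v \<longlonglongrightarrow> of_real x" by simp
    have "isCont f (of_real x)"
      using x by (intro f_isCont) (auto simp: complex_eq_iff)
    hence "(\<lambda>n. f (v n)) \<longlonglongrightarrow> f w" using isCont_tendsto_compose[OF _ v] x(3) by metis
    hence "(\<lambda>n. h (f (v n))) \<longlonglongrightarrow> h (f w)" by (rule isCont_tendsto_compose[OF hc])
    moreover have "h (f (v n)) = v n" for n using h[of "v n"] by (simp add: v_def)
    ultimately have "w = of_real x" using h[of w] w v LIMSEQ_unique by fastforce
    thus False using w by simp
  qed
  have sub: "f ` upper_hp \<subseteq> upper_hp - ?S" using f_Im notS by auto
  have cl: "closedin (top_of_set (upper_hp - ?S)) (f ` upper_hp)"
  proof -
    have "l \<in> f ` upper_hp" if l: "l \<in> upper_hp - ?S" "l \<in> closure (f ` upper_hp)" for l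
    proof -
      obtain y where yl: "(\<forall>n. y n \<in> f ` upper_hp) \<and> y \<longlonglongrightarrow> l \<and> l \<in> upper_hp - ?S"
        using l by (auto simp: closure_sequential)
      hence "\<forall>n. \<exists>w. Im w > 0 \<and> y n = f w" by force
      then obtain w where w: "\<And>n. Im (w n) > 0" "\<And>n. y n = f (w n)" by metis
      have yl': "y \<longlonglongrightarrow> l" using yl by blast
      obtain B where B: "\<And>n. norm (y n) \<le> B" using convergent_imp_bounded[OF yl'] by (auto simp: bounded_iff)
      have "norm (w n) \<le> \<bar>B\<bar> + 1" for n
      proof (cases "norm (w n) \<ge> 1")
        case True
        hence "norm (w n) - 1 \<le> norm (y n)" using norm_large[of "w n"] w(2)[of n] by simp
        thus ?thesis using B[of n] by simp
      qed simp
      hence "bounded (range w)" by (auto simp: bounded_iff)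
      then obtain w0 r where r: "strict_mono r" "(w \<circ> r) \<longlonglongrightarrow> w0"
        using bounded_imp_convergent_subsequence by blast
      have fr: "(\<lambda>n. f ((w \<circ> r) n)) \<longlonglongrightarrow> l" using LIMSEQ_subseq_LIMSEQ[OF yl' r(1)] w(2) by (simp add: o_def)
      have "Im w0 \<ge> 0" by (rule LIMSEQ_le_const[OF tendsto_Im[OF r(2)]]) (use w(1) in \<open>auto intro: less_imp_le\<close>)
      moreover have "Im w0 \<noteq> 0"
      proof
        assume "Im w0 = 0"
        from f_boundary[OF _ r(2) this fr] w(1) have "l \<in> \<real> \<union> ?S" by simp
        thus False using yl by (auto simp: complex_is_Real_iff)
      qed
      ultimately have w0: "Im w0 > 0" by simp
      have "w0 \<noteq> - of_real s" "w0 \<noteq> of_real (1 - s)" using w0 by auto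
      hence "(\<lambda>n. f ((w \<circ> r) n)) \<longlonglongrightarrow> f w0" using w0 by (intro isCont_tendsto_compose[OF f_isCont r(2)]) auto
      hence "l = f w0" using fr LIMSEQ_unique by blast
      thus ?thesis using w0 by simp
    qed
    hence "f ` upper_hp = (upper_hp - ?S) \<inter> closure (f ` upper_hp)"
      using sub closure_subset[of "f ` upper_hp"] by blast
    thus ?thesis unfolding closedin_closed using closed_closure by blast
  qed
  have "openin (top_of_set (upper_hp - ?S)) (f ` upper_hp)" using op sub by (rule open_subset[rotated])
  with cl con have "f ` upper_hp = {} \<or> f ` upper_hp = upper_hp - ?S"
    unfolding connected_clopen by blast
  moreover have "f \<i> \<in> f ` upper_hp" by simp
  ultimately show ?thesis by blast
qed

text \<open>In the variable \<open>x = 1 / w\<close> one has \<open>f w = w * E x\<close> with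
  \<open>E\<close> holomorphic at 0. Since \<open>E\<close> has derivative \<open>x * N x\<close>,
  its linear term vanishes and its quadratic coefficient is
  \<open>N 0 / 2 = - (a * c) / 2\<close>.\<close>

lemma f_asymp: "((\<lambda>y. of_real y * (f (\<i> * of_real y) - \<i> * of_real y)) \<longlongrightarrow> \<i> * of_real (s * (1 - s) / 2)) at_top"
proof -
  define a where "a = complex_of_real s"
  define c where "c = complex_of_real (1 - s)"
  have ac: "a + c = 1" by (simp add: a_def c_def)
  define E where "E = (\<lambda>x. exp (c * Ln (1 + a * x) + a * Ln (1 - c * x)))"
  define N where "N = (\<lambda>x. E x * (- (a * c)) / ((1 + a * x) * (1 - c * x)))"
  have re: "Re (1 + a * x) > 0" "Re (1 - c * x) > 0" if x: "x \<in> ball 0 1" for x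
  proof -
    have "\<bar>Re (a * x)\<bar> \<le> norm (a * x)" "\<bar>Re (c * x)\<bar> \<le> norm (c * x)" by (rule abs_Re_le_cmod)+
    moreover have "norm (a * x) = s * norm x" "norm (c * x) = (1 - s) * norm x"
      using s by (simp_all add: a_def c_def norm_mult del: of_real_diff)
    moreover have "s * norm x < 1 * 1" "(1 - s) * norm x < 1 * 1"
      using s x by (intro mult_strict_mono; simp)+
    ultimately show "Re (1 + a * x) > 0" "Re (1 - c * x) > 0" by simp_all
  qed
  have nz: "1 + a * x \<noteq> 0" "1 - c * x \<noteq> 0" if "x \<in> ball 0 1" for x
    using re[OF that] by (metis zero_complex.simps(1) less_irrefl)+
  have np: "1 + a * x \<notin> \<real>\<^sub>\<le>\<^sub>0" "1 - c * x \<notin> \<real>\<^sub>\<le>\<^sub>0" if "x \<in> ball 0 1" for x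
    using re[OF that] by (simp_all add: complex_nonpos_Reals_iff)
  have dE: "(E has_field_derivative x * N x) (at x)" if x: "x \<in> ball 0 1" for x
  proof -
    have "(E has_field_derivative E x * (c * (a / (1 + a * x)) + a * (- c / (1 - c * x)))) (at x)"
      unfolding E_def using np[OF x] nz[OF x] by (auto intro!: derivative_eq_intros simp: divide_simps)
    moreover have "c * (a / (1 + a * x)) + a * (- c / (1 - c * x)) = x * (- (a * c) * (a + c)) / ((1 + a * x) * (1 - c * x))"
      using nz[OF x] by (simp add: divide_simps) (simp add: algebra_simps)
    ultimately show ?thesis by (simp add: N_def ac mult_ac)
  qed
  have holE: "E holomorphic_on ball 0 1"
    unfolding holomorphic_on_open[OF open_ball] using dE by blast
  have z0: "(0::complex) \<in> ball 0 1" by simp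
  have E0: "E 0 = 1" by (simp add: E_def)
  have dE0: "deriv E 0 = 0" using DERIV_imp_deriv[OF dE[OF z0]] by simp
  obtain G1 where G1: "G1 holomorphic_on ball 0 1" "\<And>z. E z = E 0 + z * G1 z" "G1 0 = deriv E 0"
    using holomorphic_factor_at_0[OF holE open_ball] by metis
  obtain G2 where G2: "G2 holomorphic_on ball 0 1" "\<And>z. G1 z = G1 0 + z * G2 z"
    using holomorphic_factor_at_0[OF G1(1) open_ball] by metis
  have E_eq: "E z = 1 + z * z * G2 z" for z
    using G1(2)[of z] G2(2)[of z] G1(3) dE0 E0 by simp
  have cont: "isCont h 0" if "h holomorphic_on ball 0 1" for h :: "complex \<Rightarrow> complex"
    using holomorphic_on_imp_continuous_on[OF that] continuous_on_eq_continuous_at[OF open_ball] z0 by blast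
  have G2c: "isCont G2 0" by (rule cont[OF G2(1)])
  have Nh: "N holomorphic_on ball 0 1"
    unfolding N_def using nz by (intro holomorphic_intros holE) auto
  have eq: "N z = 2 * G2 z + z * deriv G2 z" if z: "z \<in> ball 0 1" "z \<noteq> 0" for z
  proof -
    have "(G2 has_field_derivative deriv G2 z) (at z)"
      by (rule holomorphic_derivI[OF G2(1) open_ball z(1)])
    hence "((\<lambda>z. 1 + z * z * G2 z) has_field_derivative z * (2 * G2 z + z * deriv G2 z)) (at z)"
      by (auto intro!: derivative_eq_intros simp: algebra_simps)
    moreover have "E = (\<lambda>z. 1 + z * z * G2 z)" using E_eq by blast
    ultimately have "z * N z = z * (2 * G2 z + z * deriv G2 z)" using DERIV_unique[OF dE[OF z(1)]] by simp
    thus ?thesis using z(2) by simp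
  qed
  have l1: "((\<lambda>z. 2 * G2 z + z * deriv G2 z) \<longlongrightarrow> 2 * G2 0 + 0 * deriv G2 0) (at 0)"
    using cont[OF G2(1)] cont[OF holomorphic_deriv[OF G2(1) open_ball]]
    by (intro tendsto_intros) (auto simp: isCont_def)
  have l2: "(N \<longlongrightarrow> N 0) (at 0)" using cont[OF Nh] by (simp add: isCont_def)
  have ev: "eventually (\<lambda>z. 2 * G2 z + z * deriv G2 z = N z) (at 0)"
    unfolding eventually_at by (intro exI[of _ 1]) (auto simp: eq)
  have "N 0 = 2 * G2 0"
    using tendsto_unique[OF at_neq_bot l2 Lim_transform_eventually[OF l1 ev]] by simp
  hence G20: "G2 0 = - (a * c) / 2" by (simp add: N_def E0)
  have "((\<lambda>y::real. - \<i> / of_real y) \<longlongrightarrow> 0) at_top"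
    by (rule tendsto_const_over_at_top[OF filterlim_ident])
  hence lim: "((\<lambda>y::real. - \<i> * G2 (- \<i> / of_real y)) \<longlongrightarrow> - \<i> * G2 0) at_top"
    by (intro tendsto_intros isCont_tendsto_compose[OF G2c])
  have val: "- \<i> * G2 0 = \<i> * of_real (s * (1 - s) / 2)" by (simp add: G20 a_def c_def)
  have "eventually (\<lambda>y. - \<i> * G2 (- \<i> / of_real y) = of_real y * (f (\<i> * of_real y) - \<i> * of_real y)) at_top"
    using eventually_gt_at_top[of 0]
  proof eventually_elim
    case (elim y)
    \<comment> \<open>This is \<open>1 / w\<close> at \<open>w = \<i> * y\<close>.\<close>
    define e where "e = - \<i> / complex_of_real y"
    have lgy: "lg (\<i> * of_real y + k) = of_real (ln y) + Ln (1 + k * e) + \<i> * of_real (pi / 2)" if "1 + k * e \<noteq> 0" for k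
    proof -
      have "- \<i> * (\<i> * of_real y + k) = of_real y * (1 + k * e)"
        using elim by (simp add: e_def field_simps)
      thus ?thesis using Ln_times_of_real[OF elim that] Ln_of_real[OF elim] by (simp add: lg_def)
    qed
    have n1: "1 + a * e \<noteq> 0" "1 + - c * e \<noteq> 0"
      using elim s by (auto simp: e_def a_def c_def complex_eq_iff)
    have "L (\<i> * of_real y) = c * lg (\<i> * of_real y + a) + a * lg (\<i> * of_real y + - c)"
      by (simp only: L_def a_def c_def diff_conv_add_uminus)
    also have "\<dots> = (a + c) * (of_real (ln y) + \<i> * of_real (pi / 2)) + (c * Ln (1 + a * e) + a * Ln (1 - c * e))"
      unfolding lgy[OF n1(1)] lgy[OF n1(2)] by (simp add: algebra_simps)
    finally have "L (\<i> * of_real y) = of_real (ln y) + \<i> * of_real (pi / 2) + (c * Ln (1 + a * e) + a * Ln (1 - c * e))"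
      by (simp add: ac)
    moreover have "exp (\<i> * of_real (pi / 2)) = \<i>" by (metis cis_conv_exp cis_pi_half)
    ultimately have "f (\<i> * of_real y) = of_real y * \<i> * E e"
      using elim by (simp only: f_def E_def exp_add exp_of_real) simp
    also have "E e = 1 - G2 e / of_real (y * y)" using elim by (simp add: E_eq e_def)
    finally have F: "f (\<i> * of_real y) = of_real y * \<i> * (1 - G2 e / of_real (y * y))" .
    have "of_real y * (f (\<i> * of_real y) - \<i> * of_real y) = - \<i> * G2 e"
      unfolding F using elim by (simp add: field_simps)
    thus ?case by (simp only: e_def)
  qed
  from Lim_transform_eventually[OF lim[unfolded val] this] show ?thesis .
qed

text \<open>By \<open>mapping_out_identify\<close>, \<open>g\<close> sends
  \<open>f (\<i> * y)\<close> to height \<open>y\<close>, so its coefficient is that of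
  \<open>f\<close> with the sign reversed.\<close>

lemma hcap_tip: "hcap (seg (pi * s) tip) = s * (1 - s) / 2"
proof -
  have \<alpha>: "0 < pi * s" "pi * s < pi" using s by auto
  obtain g b where m: "mapping_out (seg (pi * s) tip) g b"
    using seg_mapping_out[OF \<alpha>, of tip] by (auto simp: tip_def)
  have "((\<lambda>y. of_real y * (f (\<i> * of_real y) - \<i> * of_real y) * (1 / of_real y) * (1 / of_real y) + (\<i> * of_real y) / of_real y)
      \<longlongrightarrow> (\<i> * of_real (s * (1 - s) / 2)) * 0 * 0 + \<i>) at_top"
    by (intro tendsto_intros f_asymp tendsto_ray_ident tendsto_const_over_at_top)
  hence "((\<lambda>y. of_real y * (f (\<i> * of_real y) - \<i> * of_real y) * (1 / of_real y) * (1 / of_real y) + (\<i> * of_real y) / of_real y) \<longlongrightarrow> \<i>) at_top"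
    by simp
  moreover have "eventually (\<lambda>y. of_real y * (f (\<i> * of_real y) - \<i> * of_real y) * (1 / of_real y) * (1 / of_real y) + (\<i> * of_real y) / of_real y
      = f (\<i> * of_real y) / of_real y) at_top"
    using eventually_gt_at_top[of 0] by eventually_elim (simp add: field_simps)
  ultimately have ray: "((\<lambda>y. f (\<i> * of_real y) / of_real y) \<longlongrightarrow> \<i>) at_top"
    by (rule Lim_transform_eventually)
  have id: "Im (g (f w)) = Im w" if "Im w > 0" for w
    by (rule mapping_out_identify[OF m f_holomorphic f_inj f_image ray that])
  have l1: "((\<lambda>y. Im (of_real y * (g (f (\<i> * of_real y)) - f (\<i> * of_real y)))) \<longlongrightarrow> Im (- \<i> * of_real b)) at_top"
    by (intro tendsto_Im mapping_out_ray(1)[OF m tendsto_ray_ident(1) ray])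
  have l2: "((\<lambda>y. - Im (of_real y * (f (\<i> * of_real y) - \<i> * of_real y))) \<longlongrightarrow> - Im (\<i> * of_real (s * (1 - s) / 2))) at_top"
    by (intro tendsto_intros f_asymp)
  have ev: "eventually (\<lambda>y. - Im (of_real y * (f (\<i> * of_real y) - \<i> * of_real y))
     = Im (of_real y * (g (f (\<i> * of_real y)) - f (\<i> * of_real y)))) at_top"
    using eventually_gt_at_top[of 0]
  proof eventually_elim
    case (elim y)
    thus ?case using id[of "\<i> * of_real y"] by (simp add: algebra_simps)
  qed
  have "Im (- \<i> * of_real b) = - Im (\<i> * of_real (s * (1 - s) / 2))"
    by (rule tendsto_unique[OF trivial_limit_at_top_linorder l1 Lim_transform_eventually[OF l2 ev]])
  thus ?thesis using hcap_eq[OF m] by simp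
qed

text \<open>The lower bound uses \<open>ln x \<ge> 1 - 1 / x\<close> in both terms; the resulting
  bounds \<open>s - 1\<close> and \<open>- s\<close> add up to -1.\<close>

lemma tip_bounds: "exp (- 1) \<le> tip" "tip \<le> 1"
proof -
  have "s * ln s \<ge> s * (1 - 1 / s)" 
    using s ln_le_minus_one[of "1 / s"] by (intro mult_left_mono) (auto simp: ln_div)
  moreover have "(1 - s) * ln (1 - s) \<ge> (1 - s) * (1 - 1 / (1 - s))"
    using s ln_le_minus_one[of "1 / (1 - s)"] by (intro mult_left_mono) (auto simp: ln_div)
  ultimately show "exp (- 1) \<le> tip" using s by (simp add: tip_def right_diff_distrib)
  have "s * ln s \<le> 0" "(1 - s) * ln (1 - s) \<le> 0" using s by (auto simp: mult_le_0_iff)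
  thus "tip \<le> 1" by (simp add: tip_def)
qed

end

text \<open>Rescaling from length \<open>tip\<close> to length 1 costs a factor
  \<open>tip^2\<close>, and \<open>tip\<close> lies between \<open>1 / 3\<close> and 1; hence the
  9.\<close>

lemma hcap_seg_bounds:
  assumes s: "0 < s" "s < 1"
  shows "s * (1 - s) / 2 \<le> hcap (seg (pi * s) 1)" "hcap (seg (pi * s) 1) \<le> 9 * (s * (1 - s) / 2)"
proof -
  interpret slit_map s using s by unfold_locales
  have \<alpha>: "0 < pi * s" "pi * s < pi" using s by auto
  have t: "tip > 0" by (simp add: tip_def)
  have eq: "s * (1 - s) / 2 = tip\<^sup>2 * hcap (seg (pi * s) 1)"
    using hcap_seg[OF \<alpha> t] hcap_tip by simp
  have p: "hcap (seg (pi * s) 1) > 0" by (rule hcap_seg_pos[OF \<alpha>]) simp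
  have "tip\<^sup>2 \<le> 1" using tip_bounds t by (simp add: power_le_one)
  thus "s * (1 - s) / 2 \<le> hcap (seg (pi * s) 1)" unfolding eq using p by (simp add: mult_left_le_one_le)
  have "1 / 3 \<le> exp (- 1 :: real)" using exp_le by (simp add: exp_minus field_simps)
  hence "1 / 3 \<le> tip" using tip_bounds(1) by simp
  hence "(1 / 3)\<^sup>2 \<le> tip\<^sup>2" by (intro power_mono) auto
  hence "1 / 9 * hcap (seg (pi * s) 1) \<le> tip\<^sup>2 * hcap (seg (pi * s) 1)"
    using p by (intro mult_right_mono) (auto simp: power2_eq_square)
  thus "hcap (seg (pi * s) 1) \<le> 9 * (s * (1 - s) / 2)" unfolding eq by simp
qed

section \<open>Two segments in nearly opposite directions\<close>

text \<open>As \<open>Im (g z)\<close> is positive, \<open>Im z - Im (g z)\<close> is asymptotically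
  at most the height of the boundary point approached; at infinity it tends to 0.\<close>

lemma mapping_out_height:
  assumes m: "mapping_out A g b" and h: "\<And>a. a \<in> A \<Longrightarrow> Im a \<le> h" "0 \<le> h"
    and z: "Im z > 0" "z \<notin> A"
  shows "Im z - Im (g z) \<le> h"
proof -
  let ?P = "\<lambda>z. z - g z - \<i> * of_real h"
  have "Im (?P z) \<le> 0"
  proof (rule Im_maximum_principle[of "upper_hp - A" ?P])
    show "open (upper_hp - A)" by (rule mapping_outD(3)[OF m])
    show "?P holomorphic_on upper_hp - A" by (intro holomorphic_intros mapping_outD(4)[OF m])
  next
    fix e :: real assume e: "e > 0"
    obtain R where R: "\<And>z. Im z > 0 \<Longrightarrow> z \<notin> A \<Longrightarrow> R < norm z \<Longrightarrow> norm (g z - z) < e"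
      using mapping_out_far[OF m e] by metis
    have "Im (?P z) < e" if "z \<in> upper_hp - A" "R < norm z" for z
    proof -
      have "norm (g z - z) < e" using R[of z] that by auto
      hence "\<bar>Im (g z - z)\<bar> < e" using abs_Im_le_cmod le_less_trans by blast
      thus ?thesis using h(2) by simp
    qed
    thus "\<exists>R. \<forall>z\<in>upper_hp - A. R < norm z \<longrightarrow> Im (?P z) < e" by blast
  next
    fix x l e assume x: "\<And>n::nat. x n \<in> upper_hp - A" "x \<longlonglongrightarrow> l" "l \<notin> upper_hp - A"
      and e: "(e::real) > 0" "\<And>n. e \<le> Im (?P (x n))"
    have "e \<le> Im (x n) - h" for n
      using e(2)[of n] mapping_out_Im_pos[OF m, of "x n"] x(1)[of n] by simp
    moreover have "(\<lambda>n. Im (x n) - h) \<longlonglongrightarrow> Im l - h" by (intro tendsto_intros x(2))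
    ultimately have "e \<le> Im l - h" by (intro LIMSEQ_le_const) auto
    moreover have "Im l \<le> h"
    proof (cases "l \<in> A")
      case True thus ?thesis by (rule h(1))
    next
      case False thus ?thesis using x(3) h(2) by simp
    qed
    ultimately show False using e(1) by simp
  qed (use z in auto)
  thus ?thesis by simp
qed

text \<open>The barrier \<open>Re q\<^sup>2 + 2 Im q\<close> is nonnegative on the diameter of the unit half-disc, at
  least 1 on the half-circle, and of the order of \<open>Im q\<close> on the vertical axis.\<close>
lemma mapping_out_local_bound:
  assumes m: "mapping_out A g b" and h: "\<And>z. Im z > 0 \<Longrightarrow> z \<notin> A \<Longrightarrow> Im z - Im (g z) \<le> h" "0 \<le> h"
    and dis: "ball (of_real (Re z)) \<rho> \<inter> A = {}" and z: "0 < Im z" "Im z < \<rho>"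
  shows "Im z - Im (g z) \<le> h * (2 * Im z / \<rho>)"
proof -
  define x0 where "x0 = complex_of_real (Re z)"
  define q where "q = (\<lambda>w. (w - x0) / of_real \<rho>)"
  have \<rho>: "\<rho> > 0" using z by simp
  define W where "W = (\<lambda>w. Re (q w * q w) + 2 * Im (q w))"
  let ?D = "upper_hp \<inter> ball x0 \<rho>"
  \<comment> \<open>The subtracted term has imaginary part \<open>h * W w\<close>, so the barrier is
    the imaginary part of a holomorphic function.\<close>
  let ?P = "\<lambda>w. w - g w - of_real h * (\<i> * (q w * q w) + 2 * q w)"
  have Pim: "Im (?P w) = Im w - Im (g w) - h * W w" for w
    by (simp add: W_def)
  have DA: "Im w > 0 \<and> w \<notin> A" if "w \<in> ?D" for w using that dis by (auto simp: x0_def)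
  have zD: "z \<in> ?D"
  proof -
    have "x0 - z = - \<i> * of_real (Im z)" by (simp add: x0_def complex_eq_iff)
    hence "norm (x0 - z) = Im z" using z by (simp add: norm_mult)
    thus ?thesis using z by (simp add: dist_norm)
  qed
  have "Im (?P z) \<le> 0"
  proof (rule Im_maximum_principle[of ?D ?P])
    show "open ?D" by (intro open_Int open_upper_hp open_ball)
    show "?P holomorphic_on ?D"
      unfolding q_def using \<rho> DA
      by (intro holomorphic_intros holomorphic_on_subset[OF mapping_outD(4)[OF m]]) auto
  next
    fix e :: real assume e: "e > 0"
    have "\<not> norm x0 + \<rho> < norm w" if "w \<in> ?D" for w
      using that norm_triangle_sub[of w x0] by (simp add: dist_norm norm_minus_commute)
    thus "\<exists>R. \<forall>w\<in>?D. R < norm w \<longrightarrow> Im (?P w) < e" by blast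
  next
    fix x l e assume x: "\<And>n::nat. x n \<in> ?D" "x \<longlonglongrightarrow> l" "l \<notin> ?D"
      and e: "(e::real) > 0" "\<And>n. e \<le> Im (?P (x n))"
    have Wl: "(\<lambda>n. W (x n)) \<longlonglongrightarrow> W l"
      unfolding W_def q_def using \<rho> by (intro tendsto_intros x(2)) auto
    have xp: "Im (x n) > 0" "x n \<notin> A" for n using DA[OF x(1)] by auto
    have l0: "Im l \<ge> 0" by (rule LIMSEQ_le_const[OF tendsto_Im[OF x(2)]]) (use xp in \<open>auto intro: less_imp_le\<close>)
    define c where "c = Re (q l)"
    define d where "d = Im (q l)"
    have Wcd: "W l = c\<^sup>2 - d\<^sup>2 + 2 * d" by (simp add: W_def c_def d_def power2_eq_square)
    have d0: "d = Im l / \<rho>" by (simp add: d_def q_def x0_def)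
    show False
    \<comment> \<open>On the diameter \<open>Im (x n)\<close> tends to 0 against a nonnegative
      barrier; on the arc the global bound \<open>h\<close> meets a barrier of at least 1.\<close>
    proof (cases "Im l = 0")
      case True
      have "e \<le> Im (x n) - h * W (x n)" for n
        using e(2)[of n] mapping_out_Im_pos[OF m xp(1,2)[of n]] unfolding Pim by simp
      moreover have "(\<lambda>n. Im (x n) - h * W (x n)) \<longlonglongrightarrow> Im l - h * W l" by (intro tendsto_intros x(2) Wl)
      ultimately have "e \<le> Im l - h * W l" by (intro LIMSEQ_le_const) auto
      moreover have "0 \<le> W l" using True by (simp add: Wcd d0)
      hence "0 \<le> h * W l" using h(2) by (intro mult_nonneg_nonneg)
      ultimately show False using e(1) True by linarith
    next
      case False
      have "e \<le> h - h * W (x n)" for n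
        using e(2)[of n] h(1)[OF xp(1,2)[of n]] unfolding Pim by simp
      moreover have "(\<lambda>n. h - h * W (x n)) \<longlonglongrightarrow> h - h * W l" by (intro tendsto_intros Wl)
      ultimately have "e \<le> h - h * W l" by (intro LIMSEQ_le_const) auto
      moreover have "1 \<le> W l"
      proof -
        have "l \<notin> ball x0 \<rho>" using x(3) False l0 by simp
        hence "\<rho> \<le> norm (l - x0)" by (simp add: dist_norm norm_minus_commute)
        moreover have "norm (l - x0) \<le> \<rho>"
          by (rule LIMSEQ_le_const2[OF tendsto_norm[OF tendsto_diff[OF x(2) tendsto_const]]])
             (use x(1) in \<open>auto simp: dist_norm norm_minus_commute intro: less_imp_le\<close>)
        ultimately have "norm (q l) = 1" using \<rho> by (simp add: q_def norm_divide)
        hence cd: "c\<^sup>2 + d\<^sup>2 = 1" using cmod_power2[of "q l"] by (simp add: c_def d_def)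
        have "d \<ge> 0" using d0 l0 \<rho> by simp
        moreover have "d \<le> 1"
        proof (rule power2_le_imp_le)
          have "0 \<le> c\<^sup>2" by simp
          thus "d\<^sup>2 \<le> 1\<^sup>2" using cd by (simp only: one_power2)
        qed simp
        ultimately have "d * d \<le> d * 1" by (intro mult_left_mono)
        moreover have "c\<^sup>2 = 1 - d\<^sup>2" using cd by simp
        ultimately show ?thesis unfolding Wcd by (simp add: power2_eq_square)
      qed
      ultimately show False using e(1) h(2) mult_left_mono[of 1 "W l" h] by simp
    qed
  qed (rule zD)
  moreover have "W z \<le> 2 * Im z / \<rho>"
  proof -
    have "q z = \<i> * of_real (Im z / \<rho>)" by (simp add: q_def x0_def complex_eq_iff)
    thus ?thesis unfolding W_def by simp
  qed
  ultimately show ?thesis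
    unfolding Pim using mult_left_mono[of "W z" "2 * Im z / \<rho>" h] h(2) by simp
qed

text \<open>The defect \<open>u\<^sub>A + u\<^sub>B - u\<^sub>C\<close>, where \<open>u = Im (z - g(z))\<close>, has the boundary values \<open>u\<^sub>B\<close> on \<open>A\<close>
  and \<open>u\<^sub>A\<close> on \<open>B\<close>. They are small compared to \<open>Im z\<close> away from \<open>A1\<close> and \<open>B1\<close>, and the latter have
  small capacity.\<close>
lemma mapping_out_defect_bound:
  assumes mA: "mapping_out A gA bA" and mB: "mapping_out B gB bB" and mC: "mapping_out (A \<union> B) gC bC"
    and mA1: "mapping_out A1 gA1 bA1" and mB1: "mapping_out B1 gB1 bB1" and sub: "A1 \<subseteq> A" "B1 \<subseteq> B"
    and \<eta>: "0 \<le> \<eta>"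
    and A: "\<And>l. l \<in> A \<Longrightarrow> l \<notin> A1 \<Longrightarrow> l \<notin> B \<and> Im l - Im (gB l) \<le> \<eta> * Im l"
    and B: "\<And>l. l \<in> B \<Longrightarrow> l \<notin> B1 \<Longrightarrow> l \<notin> A \<and> Im l - Im (gA l) \<le> \<eta> * Im l"
  shows "bA + bB - bC \<le> \<eta> * (bA + bB) + bA1 + bB1"
proof -
  let ?D = "upper_hp - (A \<union> B)"
  \<comment> \<open>The defect minus the majorant \<open>\<eta> * (u_A + u_B) + u_A1 + u_B1\<close>,
    whose coefficient at infinity is the claimed right-hand side.\<close>
  define P where "P = (\<lambda>z. (z + gC z - gA z - gB z) - of_real \<eta> * (z - gA z) - of_real \<eta> * (z - gB z) - (z - gA1 z) - (z - gB1 z))"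
  have Pim: "Im (P z) = (Im z + Im (gC z) - Im (gA z) - Im (gB z)) - \<eta> * (Im z - Im (gA z)) - \<eta> * (Im z - Im (gB z))
      - (Im z - Im (gA1 z)) - (Im z - Im (gB1 z))" for z by (simp add: P_def)
  have D: "Im z > 0" "z \<notin> A" "z \<notin> B" "z \<notin> A \<union> B" "z \<notin> A1" "z \<notin> B1" if "z \<in> ?D" for z
    using that sub by auto
  have u: "0 \<le> Im z - Im (gA z)" "0 \<le> Im z - Im (gB z)" "0 \<le> Im z - Im (gC z)" "0 \<le> Im z - Im (gA1 z)" "0 \<le> Im z - Im (gB1 z)"
    "0 < Im (gA z)" "0 < Im (gB z)" "0 \<le> \<eta> * (Im z - Im (gA z))" "0 \<le> \<eta> * (Im z - Im (gB z))"
    if z: "z \<in> ?D" for z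
    using D[OF z] mapping_out_Im_le[OF mA] mapping_out_Im_le[OF mB] mapping_out_Im_le[OF mC] mapping_out_Im_le[OF mA1]
      mapping_out_Im_le[OF mB1] mapping_out_Im_pos[OF mA] mapping_out_Im_pos[OF mB] \<eta>
    by simp_all
  have le: "Im (P z) \<le> 0" if z: "z \<in> ?D" for z
  proof (rule Im_maximum_principle[of ?D P])
    show "open ?D" by (rule mapping_outD(3)[OF mC])
    show "P holomorphic_on ?D"
      unfolding P_def using sub
      by (intro holomorphic_intros mapping_outD(4)[OF mC] holomorphic_on_subset[OF mapping_outD(4)[OF mA]]
         holomorphic_on_subset[OF mapping_outD(4)[OF mB]] holomorphic_on_subset[OF mapping_outD(4)[OF mA1]]
         holomorphic_on_subset[OF mapping_outD(4)[OF mB1]]) auto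
  next
    fix e :: real assume e: "e > 0"
    hence e2: "e / 2 > 0" by simp
    obtain R1 where R1: "\<And>z. Im z > 0 \<Longrightarrow> z \<notin> A \<Longrightarrow> R1 < norm z \<Longrightarrow> norm (gA z - z) < e / 2"
      using mapping_out_far[OF mA e2] by metis
    obtain R2 where R2: "\<And>z. Im z > 0 \<Longrightarrow> z \<notin> B \<Longrightarrow> R2 < norm z \<Longrightarrow> norm (gB z - z) < e / 2"
      using mapping_out_far[OF mB e2] by metis
    have "Im (P z) < e" if z: "z \<in> ?D" "max R1 R2 < norm z" for z
    proof -
      have "norm (gA z - z) < e / 2" "norm (gB z - z) < e / 2"
        using D[OF z(1)] z(2) R1[of z] R2[of z] by auto
      hence "\<bar>Im (gA z - z)\<bar> < e / 2" "\<bar>Im (gB z - z)\<bar> < e / 2"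
        using abs_Im_le_cmod le_less_trans by blast+
      hence "Im z - Im (gA z) < e / 2" "Im z - Im (gB z) < e / 2"
        unfolding minus_complex.simps by linarith+
      thus ?thesis using u[OF z(1)] unfolding Pim by linarith
    qed
    thus "\<exists>R. \<forall>z\<in>?D. R < norm z \<longrightarrow> Im (P z) < e" by blast
  next
    fix x l e assume x: "\<And>n::nat. x n \<in> ?D" "x \<longlonglongrightarrow> l" "l \<notin> ?D"
      and e: "(e::real) > 0" "\<And>n. e \<le> Im (P (x n))"
    have finish: False if "\<And>n. Im (P (x n)) \<le> y n" "y \<longlonglongrightarrow> y0" "y0 \<le> 0" for y y0
    proof -
      have "e \<le> y n" for n using e(2)[of n] that(1)[of n] by simp
      hence "e \<le> y0" by (intro LIMSEQ_le_const[OF that(2)]) auto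
      thus False using that(3) e(1) by simp
    qed
    have vC: "(\<lambda>n. Im (gC (x n))) \<longlonglongrightarrow> 0"
      using D[OF x(1)] x(3) by (intro mapping_out_vanish[OF mC _ x(2)]) auto
    show False
    proof (cases "Im l > 0")
      case False
      show False
      proof (rule finish)
        \<comment> \<open>At real boundary points it suffices that \<open>u_A\<close> and
          \<open>u_B\<close> are at most \<open>Im z\<close>.\<close>
        show "Im (P (x n)) \<le> 2 * Im (x n)" for n using u[OF x(1)[of n]] unfolding Pim by linarith
        show "(\<lambda>n. 2 * Im (x n)) \<longlonglongrightarrow> 2 * Im l" by (intro tendsto_intros x(2))
      qed (use False in simp)
    next
      case l0: True
      have AB: "l \<in> A \<or> l \<in> B" using x(3) l0 by simp
      have small: False if m1: "mapping_out S g' b'" "S = A1 \<and> g' = gA1 \<or> S = B1 \<and> g' = gB1" "l \<in> S" for S g' b'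
      proof (rule finish)
        \<comment> \<open>The defect is at most \<open>Im z + Im (gC z)\<close>, and the subtracted
          \<open>u\<close> of the exceptional part is \<open>Im z\<close> up to a vanishing
          term.\<close>
        show "Im (P (x n)) \<le> Im (gC (x n)) + Im (g' (x n))" for n using u[OF x(1)[of n]] m1(2) unfolding Pim by auto
        have "(\<lambda>n. Im (g' (x n))) \<longlonglongrightarrow> 0"
          using D[OF x(1)] m1(2,3) by (intro mapping_out_vanish[OF m1(1) _ x(2)]) auto
        from tendsto_add[OF vC this] show "(\<lambda>n. Im (gC (x n)) + Im (g' (x n))) \<longlonglongrightarrow> 0" by simp
      qed simp
      show False
      proof (cases "l \<in> A1 \<or> l \<in> B1")
        case True
        thus False using small[OF mA1] small[OF mB1] by blast
      next
        case ns: False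
        show False
        proof (cases "l \<in> A")
          case True
          hence lB: "l \<notin> B" "Im l - Im (gB l) \<le> \<eta> * Im l" using A[OF True] ns by auto
          have vA: "(\<lambda>n. Im (gA (x n))) \<longlonglongrightarrow> 0"
            using D[OF x(1)] True by (intro mapping_out_vanish[OF mA _ x(2)]) auto
          show False
          proof (rule finish)
            \<comment> \<open>Here \<open>u_A\<close> tends to \<open>Im l\<close>, so
              \<open>\<eta> * u_A\<close> absorbs the limit \<open>u_B\<close> of the
              defect.\<close>
            show "Im (P (x n)) \<le> Im (x n) + Im (gC (x n)) - Im (gB (x n)) - \<eta> * (Im (x n) - Im (gA (x n)))" for n
              using u[OF x(1)[of n]] unfolding Pim by linarith
            show "(\<lambda>n. Im (x n) + Im (gC (x n)) - Im (gB (x n)) - \<eta> * (Im (x n) - Im (gA (x n))))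
               \<longlonglongrightarrow> Im l + 0 - Im (gB l) - \<eta> * (Im l - 0)"
              by (intro tendsto_intros x(2) vC vA isCont_tendsto_compose[OF mapping_out_continuous[OF mB l0 lB(1)]])
          qed (use lB in simp)
        next
          case False
          hence lBB: "l \<in> B" using AB by simp
          hence lA: "l \<notin> A" "Im l - Im (gA l) \<le> \<eta> * Im l" using B[OF lBB] ns by auto
          have vB: "(\<lambda>n. Im (gB (x n))) \<longlonglongrightarrow> 0"
            using D[OF x(1)] lBB by (intro mapping_out_vanish[OF mB _ x(2)]) auto
          show False
          proof (rule finish)
            show "Im (P (x n)) \<le> Im (x n) + Im (gC (x n)) - Im (gA (x n)) - \<eta> * (Im (x n) - Im (gB (x n)))" for n
              using u[OF x(1)[of n]] unfolding Pim by linarith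
            show "(\<lambda>n. Im (x n) + Im (gC (x n)) - Im (gA (x n)) - \<eta> * (Im (x n) - Im (gB (x n))))
               \<longlonglongrightarrow> Im l + 0 - Im (gA l) - \<eta> * (Im l - 0)"
              by (intro tendsto_intros x(2) vC vB isCont_tendsto_compose[OF mapping_out_continuous[OF mA l0 lA(1)]])
          qed (use lA in simp)
        qed
      qed
    qed
  qed (rule z)
  have ax: "((\<lambda>y. Im (of_real y * (g (\<i> * of_real y) - \<i> * of_real y))) \<longlongrightarrow> - b) at_top" if "mapping_out S g b" for S g b
    using tendsto_Im[OF mapping_out_axis(1)[OF that]] by simp
  have "((\<lambda>y. Im (of_real y * (gC (\<i> * of_real y) - \<i> * of_real y))
      - (1 - \<eta>) * Im (of_real y * (gA (\<i> * of_real y) - \<i> * of_real y))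
      - (1 - \<eta>) * Im (of_real y * (gB (\<i> * of_real y) - \<i> * of_real y))
      + Im (of_real y * (gA1 (\<i> * of_real y) - \<i> * of_real y))
      + Im (of_real y * (gB1 (\<i> * of_real y) - \<i> * of_real y)))
     \<longlongrightarrow> - bC - (1 - \<eta>) * (- bA) - (1 - \<eta>) * (- bB) + (- bA1) + (- bB1)) at_top"
    by (intro tendsto_intros ax[OF mA] ax[OF mB] ax[OF mC] ax[OF mA1] ax[OF mB1])
  moreover have "eventually (\<lambda>y. Im (of_real y * (gC (\<i> * of_real y) - \<i> * of_real y))
      - (1 - \<eta>) * Im (of_real y * (gA (\<i> * of_real y) - \<i> * of_real y))
      - (1 - \<eta>) * Im (of_real y * (gB (\<i> * of_real y) - \<i> * of_real y))
      + Im (of_real y * (gA1 (\<i> * of_real y) - \<i> * of_real y))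
      + Im (of_real y * (gB1 (\<i> * of_real y) - \<i> * of_real y)) \<le> 0) at_top"
    using bounded_eventually_notin[OF mapping_outD(1)[OF mC] filterlim_at_infinity_ray(1)[OF tendsto_ray_ident]]
      eventually_gt_at_top[of 0]
  proof eventually_elim
    case (elim y)
    hence "\<i> * of_real y \<in> ?D" by simp
    from le[OF this] have "y * Im (P (\<i> * of_real y)) \<le> 0" using elim by (simp add: mult_le_0_iff)
    moreover have "y * Im (P (\<i> * of_real y)) = Im (of_real y * (gC (\<i> * of_real y) - \<i> * of_real y))
      - (1 - \<eta>) * Im (of_real y * (gA (\<i> * of_real y) - \<i> * of_real y))
      - (1 - \<eta>) * Im (of_real y * (gB (\<i> * of_real y) - \<i> * of_real y))
      + Im (of_real y * (gA1 (\<i> * of_real y) - \<i> * of_real y))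
      + Im (of_real y * (gB1 (\<i> * of_real y) - \<i> * of_real y))"
      unfolding Pim by (simp add: algebra_simps)
    ultimately show ?case by (simp only:)
  qed
  ultimately have "- bC - (1 - \<eta>) * (- bA) - (1 - \<eta>) * (- bB) + (- bA1) + (- bB1) \<le> 0"
    by (intro tendsto_upperbound[of _ _ at_top]) auto
  thus ?thesis by (simp add: algebra_simps)
qed

lemma seg_bounds:
  assumes "0 < \<alpha>" "\<alpha> < pi" "z \<in> seg \<alpha> l"
  shows "Im z \<le> l * sin \<alpha>" "z = of_real (norm z) * cis \<alpha>" "0 < norm z"
proof -
  obtain r where r: "0 < r" "r \<le> l" "z = of_real r * cis \<alpha>" using assms(3) by (auto simp: seg_def)
  thus "Im z \<le> l * sin \<alpha>" using sin_gt_zero[OF assms(1,2)] by (simp add: mult_right_mono)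
  show "z = of_real (norm z) * cis \<alpha>" "0 < norm z" using r by (simp_all add: norm_mult)
qed

lemma small_angle:
  fixes \<alpha> :: real
  assumes "0 < \<alpha>" "\<alpha> < pi / 4"
  shows "1 / 2 < cos \<alpha>" "sin \<alpha> < cos \<alpha>"
proof -
  have "cos (pi / 3) < cos \<alpha>" using assms by (intro cos_monotone_0_pi) auto
  thus "1 / 2 < cos \<alpha>" by (simp add: cos_60)
  have "cos (pi / 2 - \<alpha>) < cos \<alpha>" using assms by (intro cos_monotone_0_pi) auto
  thus "sin \<alpha> < cos \<alpha>" by (simp add: cos_diff)
qed

text \<open>A point \<open>z\<close> of norm above 1 on one segment has
  \<open>\<bar>Re z\<bar> > 1 / 2\<close>, and the ball of this radius about \<open>Re z\<close>
  misses the other segment, which lies across the imaginary axis.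
  \<open>mapping_out_local_bound\<close> then gives the factor \<open>4 * h\<close>. The unit
  segments are the exceptional parts.\<close>

lemma two_seg_defect:
  assumes a: "0 < \<alpha>" "\<alpha> < pi / 4" and b: "3 * pi / 4 < \<beta>" "\<beta> < pi" and l: "1 \<le> l" "1 \<le> k"
    and h: "l * sin \<alpha> \<le> h" "k * sin \<beta> \<le> h"
  shows "hcap (seg \<alpha> l) + hcap (seg \<beta> k) - hcap (seg \<alpha> l \<union> seg \<beta> k)
    \<le> 4 * h * (hcap (seg \<alpha> l) + hcap (seg \<beta> k)) + hcap (seg \<alpha> 1) + hcap (seg \<beta> 1)"
proof -
  have \<alpha>: "0 < \<alpha>" "\<alpha> < pi" and \<beta>: "0 < \<beta>" "\<beta> < pi" using a b by auto
  have l0: "0 < l" "0 < k" using l by auto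
  obtain gA bA where mA: "mapping_out (seg \<alpha> l) gA bA" using seg_mapping_out[OF \<alpha> l0(1)] by blast
  obtain gB bB where mB: "mapping_out (seg \<beta> k) gB bB" using seg_mapping_out[OF \<beta> l0(2)] by blast
  obtain gC bC where mC: "mapping_out (seg \<alpha> l \<union> seg \<beta> k) gC bC" using two_seg_mapping_out[OF \<alpha> \<beta> l0] by blast
  obtain gA1 bA1 where mA1: "mapping_out (seg \<alpha> 1) gA1 bA1" using seg_mapping_out[OF \<alpha> zero_less_one] by blast
  obtain gB1 bB1 where mB1: "mapping_out (seg \<beta> 1) gB1 bB1" using seg_mapping_out[OF \<beta> zero_less_one] by blast
  have h0: "0 \<le> h" using h(1) sin_gt_zero[OF \<alpha>] l0 by (smt (verit) mult_pos_pos)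
  note sa = small_angle[OF a]
  have sb: "1 / 2 < - cos \<beta>" "sin \<beta> < - cos \<beta>"
    using small_angle[of "pi - \<beta>"] b by auto
  have uA: "Im z - Im (gA z) \<le> h" if "Im z > 0" "z \<notin> seg \<alpha> l" for z
    by (rule mapping_out_height[OF mA _ h0 that]) (use seg_bounds(1)[OF \<alpha>] h(1) in force)
  have uB: "Im z - Im (gB z) \<le> h" if "Im z > 0" "z \<notin> seg \<beta> k" for z
    by (rule mapping_out_height[OF mB _ h0 that]) (use seg_bounds(1)[OF \<beta>] h(2) in force)
  have reA: "Re z = norm z * cos \<alpha>" "Im z = norm z * sin \<alpha>" "0 < norm z" "Re z > 0" if "z \<in> seg \<alpha> l" for z
  proof -
    note z = seg_bounds(2,3)[OF \<alpha> that]
    show "Re z = norm z * cos \<alpha>" by (subst z(1)) simp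
    thus "Re z > 0" using z(2) sa(1) by simp
    show "Im z = norm z * sin \<alpha>" by (subst z(1)) simp
    show "0 < norm z" by (rule z(2))
  qed
  have reB: "Re z = norm z * cos \<beta>" "Im z = norm z * sin \<beta>" "0 < norm z" "Re z < 0" if "z \<in> seg \<beta> k" for z
  proof -
    note z = seg_bounds(2,3)[OF \<beta> that]
    show "Re z = norm z * cos \<beta>" by (subst z(1)) simp
    thus "Re z < 0" using z(2) sb(1) by (simp add: mult_pos_neg)
    show "Im z = norm z * sin \<beta>" by (subst z(1)) simp
    show "0 < norm z" by (rule z(2))
  qed
  have local: "Im z - Im (g z) \<le> 4 * h * Im z"
    if m: "mapping_out S g b" and u: "\<And>z. Im z > 0 \<Longrightarrow> z \<notin> S \<Longrightarrow> Im z - Im (g z) \<le> h"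
      and S: "\<And>w. w \<in> S \<Longrightarrow> \<bar>Re z\<bar> \<le> \<bar>Re z - Re w\<bar>" and z: "0 < Im z" "Im z < \<bar>Re z\<bar>" "1 / 2 < \<bar>Re z\<bar>"
    for S g b z
  proof -
    have "Im z - Im (g z) \<le> h * (2 * Im z / \<bar>Re z\<bar>)"
    proof (rule mapping_out_local_bound[OF m u h0 _ z(1,2)])
      show "ball (complex_of_real (Re z)) \<bar>Re z\<bar> \<inter> S = {}"
      proof (rule equals0I)
        fix w assume w: "w \<in> ball (complex_of_real (Re z)) \<bar>Re z\<bar> \<inter> S"
        have "\<bar>Re (complex_of_real (Re z) - w)\<bar> \<le> dist (complex_of_real (Re z)) w"
          unfolding dist_norm by (rule abs_Re_le_cmod)
        thus False using w S[of w] by simp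
      qed
    qed
    also have "\<dots> \<le> h * (2 * Im z / (1 / 2))"
      using z h0 by (intro mult_left_mono divide_left_mono) auto
    finally show ?thesis by simp
  qed
  have "bA + bB - bC \<le> (4 * h) * (bA + bB) + bA1 + bB1"
  proof (rule mapping_out_defect_bound[OF mA mB mC mA1 mB1])
    show "seg \<alpha> 1 \<subseteq> seg \<alpha> l" "seg \<beta> 1 \<subseteq> seg \<beta> k" using l by (auto simp: seg_def)
    show "0 \<le> 4 * h" using h0 by simp
    show "z \<notin> seg \<beta> k \<and> Im z - Im (gB z) \<le> 4 * h * Im z" if z: "z \<in> seg \<alpha> l" "z \<notin> seg \<alpha> 1" for z
    proof
      show "z \<notin> seg \<beta> k" using reA(4)[OF z(1)] reB(4)[of z] by auto
      have "Arg z = \<alpha>" "z \<noteq> 0" using z(1) mem_seg[OF \<alpha>] by auto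
      hence n: "norm z > 1" using z(2) mem_seg[OF \<alpha>] by auto
      have "1 * (1 / 2) < norm z * cos \<alpha>" using n sa by (intro mult_strict_mono) auto
      moreover have "norm z * sin \<alpha> < norm z * cos \<alpha>" using n sa by (intro mult_strict_left_mono) auto
      moreover have "0 < norm z * sin \<alpha>" using n sin_gt_zero[OF \<alpha>] by (intro mult_pos_pos) auto
      moreover have "\<bar>Re z\<bar> \<le> \<bar>Re z - Re w\<bar>" if "w \<in> seg \<beta> k" for w
        using reA(4)[OF z(1)] reB(4)[OF that] by simp
      ultimately show "Im z - Im (gB z) \<le> 4 * h * Im z"
        using reA[OF z(1)] by (intro local[OF mB uB]) auto
    qed
    show "z \<notin> seg \<alpha> l \<and> Im z - Im (gA z) \<le> 4 * h * Im z" if z: "z \<in> seg \<beta> k" "z \<notin> seg \<beta> 1" for z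
    proof
      show "z \<notin> seg \<alpha> l" using reB(4)[OF z(1)] reA(4)[of z] by auto
      have "Arg z = \<beta>" "z \<noteq> 0" using z(1) mem_seg[OF \<beta>] by auto
      hence n: "norm z > 1" using z(2) mem_seg[OF \<beta>] by auto
      have "1 * (1 / 2) < norm z * (- cos \<beta>)" using n sb by (intro mult_strict_mono) auto
      moreover have "norm z * sin \<beta> < norm z * (- cos \<beta>)" using n sb by (intro mult_strict_left_mono) auto
      moreover have "0 < norm z * sin \<beta>" using n sin_gt_zero[OF \<beta>] by (intro mult_pos_pos) auto
      moreover have "\<bar>Re z\<bar> \<le> \<bar>Re z - Re w\<bar>" if "w \<in> seg \<alpha> l" for w
        using reB(4)[OF z(1)] reA(4)[OF that] by simp
      ultimately show "Im z - Im (gA z) \<le> 4 * h * Im z"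
        using reB[OF z(1)] by (intro local[OF mA uA]) auto
    qed
  qed
  thus ?thesis using hcap_eq[OF mA] hcap_eq[OF mB] hcap_eq[OF mC] hcap_eq[OF mA1] hcap_eq[OF mB1] by simp
qed

text \<open>The unit segment has capacity between \<open>m / 4\<close> and \<open>5 * m\<close>, so
  at fixed capacity the squared length is of order \<open>1 / m\<close>. With a sine of at most
  \<open>pi * m\<close> the height is of order at most \<open>sqrt m\<close>.\<close>

lemma seg_flat:
  assumes s: "0 < s" "s < 1" and l: "0 < l" and m: "m = min s (1 - s)"
  shows "hcap (seg (pi * s) 1) \<le> 5 * m"
    and "(l * sin (pi * s))\<^sup>2 \<le> 4 * hcap (seg (pi * s) l) * pi\<^sup>2 * m"
    and "m \<le> hcap (seg (pi * s) l) / 5 \<Longrightarrow> 1 \<le> l"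
proof -
  define C where "C = hcap (seg (pi * s) 1)"
  have \<alpha>: "0 < pi * s" "pi * s < pi" using s by auto
  have sl: "hcap (seg (pi * s) l) = l\<^sup>2 * C" unfolding C_def by (rule hcap_seg[OF \<alpha> l])
  have m0: "0 < m" "m \<le> 1 / 2" using s by (auto simp: m min_def)
  have ms: "s * (1 - s) = m * (1 - m)" by (simp add: m min_def)
  have C: "m * (1 - m) / 2 \<le> C" "C \<le> 9 * (m * (1 - m) / 2)"
    using hcap_seg_bounds[OF s] unfolding ms C_def by auto
  have "m * (1 - m) \<le> m * 1" using m0 by (intro mult_left_mono) auto
  hence C5: "C \<le> 5 * m" using C(2) m0 by linarith
  thus "hcap (seg (pi * s) 1) \<le> 5 * m" by (simp add: C_def)
  have "m * (1 / 2) \<le> m * (1 - m)" using m0 by (intro mult_left_mono) auto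
  hence C4: "m \<le> 4 * C" using C(1) by linarith
  have "sin (pi * s) \<le> pi * m"
  proof (cases "s \<le> 1 - s")
    case True
    thus ?thesis using sin_x_le_x[of "pi * s"] s by (simp add: m)
  next
    case False
    have "sin (pi * s) = sin (pi * (1 - s))" using sin_pi_minus[of "pi * s"] by (simp add: right_diff_distrib)
    also have "\<dots> \<le> pi * (1 - s)" using s by (intro sin_x_le_x) simp
    finally show ?thesis using False by (simp add: m)
  qed
  hence "(sin (pi * s))\<^sup>2 \<le> (pi * m)\<^sup>2" using sin_gt_zero[OF \<alpha>] by (intro power_mono) auto
  hence "l\<^sup>2 * (sin (pi * s))\<^sup>2 \<le> l\<^sup>2 * (pi * m)\<^sup>2" by (intro mult_left_mono) auto
  also have "\<dots> = l\<^sup>2 * pi\<^sup>2 * m * m" by (simp add: power2_eq_square)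
  also have "\<dots> \<le> l\<^sup>2 * pi\<^sup>2 * m * (4 * C)" using C4 m0 by (intro mult_left_mono) auto
  finally show "(l * sin (pi * s))\<^sup>2 \<le> 4 * hcap (seg (pi * s) l) * pi\<^sup>2 * m"
    by (simp add: sl power_mult_distrib mult_ac)
  assume "m \<le> hcap (seg (pi * s) l) / 5"
  hence "C * 1 \<le> C * l\<^sup>2" using C5 by (simp add: sl mult.commute)
  moreover have "C > 0" using C4 m0 by simp
  ultimately have "1\<^sup>2 \<le> l\<^sup>2" by simp
  thus "1 \<le> l" using l by (intro power2_le_imp_le[of 1 l]) auto
qed

text \<open>Uniform in the lengths because the prescribed capacities control them. The upper half of
  the estimate is subadditivity, the lower half is \<open>two_seg_defect\<close>.\<close>

lemma two_seg_opposite_limit: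
  assumes B: "0 < B1" "0 < B2" and e: "0 < e"
  obtains \<delta> where "\<delta> > 0" "\<And>\<alpha> \<beta> l k. 0 < \<alpha> \<Longrightarrow> \<alpha> < \<delta> \<Longrightarrow> pi - \<delta> < \<beta> \<Longrightarrow> \<beta> < pi \<Longrightarrow> 0 < l \<Longrightarrow> 0 < k \<Longrightarrow>
     hcap (seg \<alpha> l) = B1 \<Longrightarrow> hcap (seg \<beta> k) = B2 \<Longrightarrow> \<bar>hcap (seg \<alpha> l \<union> seg \<beta> k) - (B1 + B2)\<bar> < e"
proof -
  \<comment> \<open>Chosen so that \<open>4 * h * (B1 + B2) = e / 2\<close>.\<close>
  define h where "h = e / (8 * (B1 + B2))"
  \<comment> \<open>The entries ensure in turn: angles within \<open>pi / 4\<close> of the real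
    axis, length at least 1 for each segment, heights at most \<open>h\<close>, and unit segments of
    capacity below \<open>e / 8\<close>.\<close>
  define \<mu> where "\<mu> = min (1 / 4) (min (B1 / 5) (min (B2 / 5) (min (h\<^sup>2 / (4 * (B1 + B2) * pi\<^sup>2)) (e / 40))))"
  have h: "h > 0" using B e by (simp add: h_def)
  have \<mu>: "\<mu> > 0" using B e h by (simp add: \<mu>_def)
  have \<mu>1: "\<mu> \<le> 1 / 4" "\<mu> \<le> B1 / 5" "\<mu> \<le> B2 / 5" "\<mu> \<le> h\<^sup>2 / (4 * (B1 + B2) * pi\<^sup>2)" "\<mu> \<le> e / 40"
    unfolding \<mu>_def by linarith+
  have "0 < 4 * (B1 + B2) * pi\<^sup>2" using B by simp
  hence \<mu>h: "4 * (B1 + B2) * pi\<^sup>2 * \<mu> \<le> h\<^sup>2" using \<mu>1(4) by (simp only: pos_le_divide_eq mult.commute)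
  have bound: "\<bar>hcap (seg \<alpha> l \<union> seg \<beta> k) - (B1 + B2)\<bar> < e"
    if \<alpha>: "0 < \<alpha>" "\<alpha> < pi * \<mu>" and \<beta>: "pi - pi * \<mu> < \<beta>" "\<beta> < pi" and l: "0 < l" "0 < k"
      and cap: "hcap (seg \<alpha> l) = B1" "hcap (seg \<beta> k) = B2" for \<alpha> \<beta> l k
  proof -
    define s where "s = \<alpha> / pi"
    define t where "t = \<beta> / pi"
    have st: "\<alpha> = pi * s" "\<beta> = pi * t" by (simp_all add: s_def t_def)
    have s: "0 < s" "s < \<mu>" using \<alpha> by (simp_all add: s_def pos_divide_less_eq mult.commute)
    have t: "t < 1" using \<beta>(2) by (simp add: t_def)
    have "pi * (1 - \<mu>) < pi * t" using \<beta>(1) unfolding st by (simp add: right_diff_distrib)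
    hence t2: "1 - \<mu> < t" by simp
    have s1: "s < 1" and t0: "0 < t" using s t2 \<mu>1(1) by auto
    have ms: "s = min s (1 - s)" and mt: "1 - t = min t (1 - t)" using s t2 \<mu>1(1) by auto
    note fs = seg_flat[OF s(1) s1 l(1) ms, folded st, unfolded cap]
    note ft = seg_flat[OF t0 t l(2) mt, folded st, unfolded cap]
    have l1: "1 \<le> l" "1 \<le> k" using fs(3) ft(3) s t2 \<mu>1 by auto
    have sq: "x \<le> h" if "x\<^sup>2 \<le> 4 * b * pi\<^sup>2 * m" "b \<le> B1 + B2" "0 < b" "0 < m" "m \<le> \<mu>" for x b m
    proof (rule power2_le_imp_le)
      have "4 * b * pi\<^sup>2 * m \<le> 4 * (B1 + B2) * pi\<^sup>2 * \<mu>"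
        using that by (intro mult_mono) auto
      thus "x\<^sup>2 \<le> h\<^sup>2" using that(1) \<mu>h by linarith
    qed (use h in simp)
    have h1: "l * sin \<alpha> \<le> h" by (rule sq[OF fs(2)]) (use B s in auto)
    have h2: "k * sin \<beta> \<le> h" by (rule sq[OF ft(2)]) (use B t t2 in auto)
    have "pi * \<mu> \<le> pi * (1 / 4)" using \<mu>1(1) by (intro mult_left_mono) auto
    hence ab: "\<alpha> < pi / 4" "3 * pi / 4 < \<beta>" using \<alpha> \<beta> by linarith+
    have "B1 + B2 - hcap (seg \<alpha> l \<union> seg \<beta> k) \<le> 4 * h * (B1 + B2) + hcap (seg \<alpha> 1) + hcap (seg \<beta> 1)"
      using two_seg_defect[OF \<alpha>(1) ab \<beta>(2) l1 h1 h2] unfolding cap .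
    also have "4 * h * (B1 + B2) = e / 2" using B by (simp add: h_def field_simps)
    finally have def: "B1 + B2 - hcap (seg \<alpha> l \<union> seg \<beta> k) \<le> e / 2 + hcap (seg \<alpha> 1) + hcap (seg \<beta> 1)" .
    have sm: "s < e / 40" "1 - t < e / 40" using s(2) t2 \<mu>1(5) by linarith+
    have "hcap (seg \<alpha> 1) < e / 8" using fs(1) sm(1) by linarith
    moreover have "hcap (seg \<beta> 1) < e / 8"
    proof (rule le_less_trans[OF ft(1)])
      show "5 * (1 - t) < e / 8" using sm(2) by simp
    qed
    ultimately have low: "B1 + B2 - hcap (seg \<alpha> l \<union> seg \<beta> k) < e" using def e by linarith
    have \<alpha>': "0 < \<alpha>" "\<alpha> < pi" and \<beta>': "0 < \<beta>" "\<beta> < pi" using \<alpha> \<beta> ab by auto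
    obtain gA bA where mA: "mapping_out (seg \<alpha> l) gA bA" using seg_mapping_out[OF \<alpha>' l(1)] by blast
    obtain gB bB where mB: "mapping_out (seg \<beta> k) gB bB" using seg_mapping_out[OF \<beta>' l(2)] by blast
    obtain gC bC where mC: "mapping_out (seg \<alpha> l \<union> seg \<beta> k) gC bC" using two_seg_mapping_out[OF \<alpha>' \<beta>' l] by blast
    have "hcap (seg \<alpha> l \<union> seg \<beta> k) \<le> B1 + B2"
      using mapping_out_cap_subadditive[OF mA mB mC] hcap_eq[OF mA] hcap_eq[OF mB] hcap_eq[OF mC] cap by simp
    thus ?thesis using low e by (simp add: abs_less_iff)
  qed
  show thesis by (rule that[of "pi * \<mu>"]) (use \<mu> bound in auto)
qed

section \<open>The joint capacity of two slits\<close>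

lemma joint_hcap_bounds:
  assumes cfg: "two_slit_config \<gamma>1 \<gamma>2 T p \<alpha>1 \<alpha>2 b1 b2" and t: "0 < t" "t \<le> T"
  shows "hcap (\<gamma>1 ` {0<..t}) \<le> joint_hcap \<gamma>1 \<gamma>2 t" "hcap (\<gamma>2 ` {0<..t}) \<le> joint_hcap \<gamma>1 \<gamma>2 t"
    "joint_hcap \<gamma>1 \<gamma>2 t \<le> hcap (\<gamma>1 ` {0<..t}) + hcap (\<gamma>2 ` {0<..t})"
proof -
  have s: "simple_slit \<gamma>1 t" "simple_slit \<gamma>2 t"
    using cfg t unfolding two_slit_config_def by (auto intro: simple_slit_mono)
  have "{0<..t} \<subseteq> {0<..T}" using t by auto
  hence dis: "\<gamma>1 ` {0<..t} \<inter> \<gamma>2 ` {0<..t} = {}" using two_slit_config_start(3)[OF cfg] by blast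
  have st: "\<gamma>1 0 = \<gamma>2 0" using two_slit_config_start(1,2)[OF cfg] by simp
  obtain g1 c1 where m1: "mapping_out (\<gamma>1 ` {0<..t}) g1 c1" using simple_slit_mapping_out[OF s(1)] by blast
  obtain g2 c2 where m2: "mapping_out (\<gamma>2 ` {0<..t}) g2 c2" using simple_slit_mapping_out[OF s(2)] by blast
  obtain g c where m: "mapping_out (\<gamma>1 ` {0<..t} \<union> \<gamma>2 ` {0<..t}) g c"
    using two_slits_mapping_out[OF s st dis] by blast
  note h = hcap_eq[OF m1] hcap_eq[OF m2] hcap_eq[OF m]
  show "hcap (\<gamma>1 ` {0<..t}) \<le> joint_hcap \<gamma>1 \<gamma>2 t"
    using mapping_out_mono[OF m1 m] h by (simp add: joint_hcap_def)
  show "hcap (\<gamma>2 ` {0<..t}) \<le> joint_hcap \<gamma>1 \<gamma>2 t"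
    using mapping_out_mono[OF m2 m] h by (simp add: joint_hcap_def)
  show "joint_hcap \<gamma>1 \<gamma>2 t \<le> hcap (\<gamma>1 ` {0<..t}) + hcap (\<gamma>2 ` {0<..t})"
    using mapping_out_cap_subadditive[OF m1 m2 m] h by (simp add: joint_hcap_def)
qed

text \<open>The lower bound by monotonicity and the upper bound by subadditivity have the same limit
  when one rate is 0.\<close>

lemma joint_derivative_degenerate:
  assumes cfg: "two_slit_config \<gamma>1 \<gamma>2 T p \<alpha>1 \<alpha>2 b1 b2" and 0: "b1 = 0 \<or> b2 = 0"
  shows "(joint_hcap \<gamma>1 \<gamma>2 has_real_derivative max b1 b2) (at 0 within {0..T})"
proof (rule derivative_from_ratio)
  have b: "0 \<le> b1" "0 \<le> b2" using cfg by (auto simp: two_slit_config_def)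
  show "joint_hcap \<gamma>1 \<gamma>2 0 = 0" by (simp add: joint_hcap_def hcap_zero)
  fix t :: "nat \<Rightarrow> real" assume t: "\<And>n. 0 < t n \<and> t n \<le> T" "t \<longlonglongrightarrow> 0"
  have d1: "((\<lambda>t. hcap (\<gamma>1 ` {0<..t})) has_real_derivative b1) (at 0 within {0..T})"
    and d2: "((\<lambda>t. hcap (\<gamma>2 ` {0<..t})) has_real_derivative b2) (at 0 within {0..T})"
    using cfg by (auto simp: two_slit_config_def)
  have r1: "(\<lambda>n. hcap (\<gamma>1 ` {0<..t n}) / t n) \<longlonglongrightarrow> b1"
    by (rule tendsto_ratio_from_derivative[OF d1 _ t]) (simp add: hcap_zero)
  have r2: "(\<lambda>n. hcap (\<gamma>2 ` {0<..t n}) / t n) \<longlonglongrightarrow> b2"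
    by (rule tendsto_ratio_from_derivative[OF d2 _ t]) (simp add: hcap_zero)
  show "(\<lambda>n. joint_hcap \<gamma>1 \<gamma>2 (t n) / t n) \<longlonglongrightarrow> max b1 b2"
  proof (rule tendsto_sandwich)
    show "(\<lambda>n. max (hcap (\<gamma>1 ` {0<..t n}) / t n) (hcap (\<gamma>2 ` {0<..t n}) / t n)) \<longlonglongrightarrow> max b1 b2"
      by (intro tendsto_intros r1 r2)
    have "(\<lambda>n. hcap (\<gamma>1 ` {0<..t n}) / t n + hcap (\<gamma>2 ` {0<..t n}) / t n) \<longlonglongrightarrow> b1 + b2"
      by (intro tendsto_intros r1 r2)
    moreover have "b1 + b2 = max b1 b2" using 0 b by auto
    ultimately show "(\<lambda>n. hcap (\<gamma>1 ` {0<..t n}) / t n + hcap (\<gamma>2 ` {0<..t n}) / t n) \<longlonglongrightarrow> max b1 b2" by simp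
    show "\<forall>\<^sub>F n in sequentially. max (hcap (\<gamma>1 ` {0<..t n}) / t n) (hcap (\<gamma>2 ` {0<..t n}) / t n) \<le> joint_hcap \<gamma>1 \<gamma>2 (t n) / t n"
    proof (intro always_eventually allI)
      fix n
      have tn: "0 < t n" "t n \<le> T" using t(1)[of n] by auto
      show "max (hcap (\<gamma>1 ` {0<..t n}) / t n) (hcap (\<gamma>2 ` {0<..t n}) / t n) \<le> joint_hcap \<gamma>1 \<gamma>2 (t n) / t n"
        using joint_hcap_bounds(1,2)[OF cfg tn] tn by (simp add: divide_right_mono)
    qed
    show "\<forall>\<^sub>F n in sequentially. joint_hcap \<gamma>1 \<gamma>2 (t n) / t n \<le> hcap (\<gamma>1 ` {0<..t n}) / t n + hcap (\<gamma>2 ` {0<..t n}) / t n"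
    proof (intro always_eventually allI)
      fix n
      have tn: "0 < t n" "t n \<le> T" using t(1)[of n] by auto
      show "joint_hcap \<gamma>1 \<gamma>2 (t n) / t n \<le> hcap (\<gamma>1 ` {0<..t n}) / t n + hcap (\<gamma>2 ` {0<..t n}) / t n"
        using joint_hcap_bounds(3)[OF cfg tn] tn by (simp add: divide_right_mono flip: add_divide_distrib)
    qed
  qed
qed

text \<open>For different directions each tip lies off the other segment. Hence the union strictly
  contains both segments, and strict subadditivity applies at a tip.\<close>

lemma two_seg_hcap:
  assumes a: "0 < \<alpha>" "\<alpha> < pi" "0 < \<beta>" "\<beta> < pi" and l: "0 < l" "0 < k"
  shows "max (hcap (seg \<alpha> l)) (hcap (seg \<beta> k)) \<le> hcap (seg \<alpha> l \<union> seg \<beta> k)"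
    and "hcap (seg \<alpha> l \<union> seg \<beta> k) < hcap (seg \<alpha> l) + hcap (seg \<beta> k)"
    and "hcap (seg \<alpha> l \<union> seg \<beta> k) = max (hcap (seg \<alpha> l)) (hcap (seg \<beta> k)) \<longleftrightarrow> \<alpha> = \<beta>"
proof -
  obtain gA bA where mA: "mapping_out (seg \<alpha> l) gA bA" using seg_mapping_out[OF a(1,2) l(1)] by blast
  obtain gB bB where mB: "mapping_out (seg \<beta> k) gB bB" using seg_mapping_out[OF a(3,4) l(2)] by blast
  obtain gC bC where mC: "mapping_out (seg \<alpha> l \<union> seg \<beta> k) gC bC" using two_seg_mapping_out[OF a l] by blast
  note h = hcap_eq[OF mA] hcap_eq[OF mB] hcap_eq[OF mC]
  have pos: "0 < bA" "0 < bB" using hcap_seg_pos[OF a(1,2) l(1)] hcap_seg_pos[OF a(3,4) l(2)] h by auto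
  show "max (hcap (seg \<alpha> l)) (hcap (seg \<beta> k)) \<le> hcap (seg \<alpha> l \<union> seg \<beta> k)"
    using mapping_out_mono[OF mA mC] mapping_out_mono[OF mB mC] unfolding h by simp
  have tipA: "of_real l * cis \<alpha> \<in> seg \<alpha> l" and tipB: "of_real k * cis \<beta> \<in> seg \<beta> k"
    using l by (auto simp: seg_def)
  have same: "bC = max bA bB" if "\<alpha> = \<beta>"
  proof -
    have "seg \<alpha> l \<union> seg \<beta> k = seg \<alpha> l \<or> seg \<alpha> l \<union> seg \<beta> k = seg \<beta> k"
      using that by (cases "l \<le> k") (auto simp: seg_def)
    hence "bC = bA \<or> bC = bB" using h by auto
    thus ?thesis using mapping_out_mono[OF mA mC] mapping_out_mono[OF mB mC] by auto
  qed
  have dis: "seg \<alpha> l \<inter> seg \<beta> k = {}" if "\<alpha> \<noteq> \<beta>"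
    using that by (auto simp: mem_seg a)
  show "hcap (seg \<alpha> l \<union> seg \<beta> k) < hcap (seg \<alpha> l) + hcap (seg \<beta> k)"
  proof (cases "\<alpha> = \<beta>")
    case True
    thus ?thesis using same pos unfolding h by simp
  next
    case False
    \<comment> \<open>Points just beyond the tip on the same ray: the norm keeps them off the first
      segment, the argument off the second.\<close>
    define x where "x = (\<lambda>n. of_real (l * (1 + inverse (real (Suc n)))) * cis \<alpha>)"
    have "bC < bA + bB"
    proof (rule mapping_out_cap_strict_subadditive[OF mA mB mC _ _ tipA])
      show "Im (x n) > 0 \<and> x n \<notin> seg \<alpha> l \<union> seg \<beta> k" for n
      proof
        define r where "r = l * (1 + inverse (real (Suc n)))"
        have "l * 1 < r" unfolding r_def using l by (intro mult_strict_left_mono) auto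
        hence r: "l < r" "0 < r" using l by auto
        have x: "x n = of_real r * cis \<alpha>" by (simp only: x_def r_def)
        show "Im (x n) > 0" unfolding x using r sin_gt_zero[OF a(1,2)] by simp
        have "Arg (x n) = \<alpha>" unfolding x by (rule Arg_of_real_mult_cis[OF r(2) a(1,2)])
        moreover have "norm (x n) = r" unfolding x using r by (simp add: norm_mult)
        ultimately show "x n \<notin> seg \<alpha> l \<union> seg \<beta> k" using False r by (simp add: mem_seg a)
      qed
      have "x \<longlonglongrightarrow> of_real (l * (1 + 0)) * cis \<alpha>"
        unfolding x_def by (intro tendsto_intros LIMSEQ_inverse_real_of_nat)
      thus "x \<longlonglongrightarrow> of_real l * cis \<alpha>" by simp
      show "of_real l * cis \<alpha> \<notin> seg \<beta> k" using dis[OF False] tipA by blast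
    qed (use tipB in blast)
    thus ?thesis unfolding h .
  qed
  show "hcap (seg \<alpha> l \<union> seg \<beta> k) = max (hcap (seg \<alpha> l)) (hcap (seg \<beta> k)) \<longleftrightarrow> \<alpha> = \<beta>"
  proof
    assume eq: "hcap (seg \<alpha> l \<union> seg \<beta> k) = max (hcap (seg \<alpha> l)) (hcap (seg \<beta> k))"
    show "\<alpha> = \<beta>"
    proof (rule ccontr)
      assume ne: "\<alpha> \<noteq> \<beta>"
      have "bA < bC" by (rule mapping_out_strict_mono[OF mA mC]) (use dis[OF ne] tipB in blast)
      moreover have "bB < bC" by (rule mapping_out_strict_mono[OF mB mC]) (use dis[OF ne] tipA in blast)
      ultimately show False using eq unfolding h by simp
    qed
  qed (use same h in simp)
qed

theorem theorem20:
  fixes \<gamma>1 \<gamma>2 :: "real \<Rightarrow> complex" and T p \<alpha>1 \<alpha>2 b1 b2 :: real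
  assumes "two_slit_config \<gamma>1 \<gamma>2 T p \<alpha>1 \<alpha>2 b1 b2"
  shows "(\<exists>c'. (joint_hcap \<gamma>1 \<gamma>2 has_real_derivative c') (at 0 within {0..T})
            \<and> ((b1 = 0 \<or> b2 = 0) \<longrightarrow> c' = max b1 b2)
            \<and> ((0 < b1 \<and> 0 < b2) \<longrightarrow>
                  max b1 b2 \<le> c' \<and> c' < b1 + b2
                \<and> (c' = max b1 b2 \<longleftrightarrow> \<alpha>1 = \<alpha>2)))
       \<and> (\<forall>B1>0. \<forall>B2>0. \<forall>\<epsilon>>0. \<exists>\<delta>>0.
            \<forall>g1 g2 S q a1 a2 d.
              two_slit_config g1 g2 S q a1 a2 B1 B2 \<and> a1 < \<delta> \<and> pi - \<delta> < a2
              \<and> (joint_hcap g1 g2 has_real_derivative d) (at 0 within {0..S})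
              \<longrightarrow> \<bar>d - (B1 + B2)\<bar> < \<epsilon>)"
proof
  have b: "0 \<le> b1" "0 \<le> b2" and a: "0 < \<alpha>1" "\<alpha>1 < pi" "0 < \<alpha>2" "\<alpha>2 < pi"
    using assms by (auto simp: two_slit_config_def)
  show "\<exists>c'. (joint_hcap \<gamma>1 \<gamma>2 has_real_derivative c') (at 0 within {0..T})
            \<and> ((b1 = 0 \<or> b2 = 0) \<longrightarrow> c' = max b1 b2)
            \<and> ((0 < b1 \<and> 0 < b2) \<longrightarrow>
                  max b1 b2 \<le> c' \<and> c' < b1 + b2
                \<and> (c' = max b1 b2 \<longleftrightarrow> \<alpha>1 = \<alpha>2))"
  proof (cases "b1 = 0 \<or> b2 = 0")
    case True
    thus ?thesis using joint_derivative_degenerate[OF assms True] by auto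
  next
    case False
    hence b': "0 < b1" "0 < b2" using b by auto
    from joint_hcap_blowup[OF assms b'] obtain l1 l2 where l: "l1 > 0" "l2 > 0"
      and h: "hcap (seg \<alpha>1 l1) = b1" "hcap (seg \<alpha>2 l2) = b2"
      and d: "(joint_hcap \<gamma>1 \<gamma>2 has_real_derivative hcap (seg \<alpha>1 l1 \<union> seg \<alpha>2 l2)) (at 0 within {0..T})"
      by blast
    show ?thesis
      using d two_seg_hcap[OF a l] False unfolding h by blast
  qed
  show "\<forall>B1>0. \<forall>B2>0. \<forall>\<epsilon>>0. \<exists>\<delta>>0.
            \<forall>g1 g2 S q a1 a2 d.
              two_slit_config g1 g2 S q a1 a2 B1 B2 \<and> a1 < \<delta> \<and> pi - \<delta> < a2
              \<and> (joint_hcap g1 g2 has_real_derivative d) (at 0 within {0..S})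
              \<longrightarrow> \<bar>d - (B1 + B2)\<bar> < \<epsilon>"
  proof (intro allI impI)
    fix B1 B2 \<epsilon> :: real assume B: "0 < B1" "0 < B2" and \<epsilon>: "0 < \<epsilon>"
    from two_seg_opposite_limit[OF B \<epsilon>] obtain \<delta> where \<delta>: "\<delta> > 0"
      "\<And>\<alpha> \<beta> l k. 0 < \<alpha> \<Longrightarrow> \<alpha> < \<delta> \<Longrightarrow> pi - \<delta> < \<beta> \<Longrightarrow> \<beta> < pi \<Longrightarrow> 0 < l \<Longrightarrow> 0 < k \<Longrightarrow>
         hcap (seg \<alpha> l) = B1 \<Longrightarrow> hcap (seg \<beta> k) = B2 \<Longrightarrow> \<bar>hcap (seg \<alpha> l \<union> seg \<beta> k) - (B1 + B2)\<bar> < \<epsilon>"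
      by blast
    have "\<bar>d - (B1 + B2)\<bar> < \<epsilon>"
      if cfg: "two_slit_config g1 g2 S q a1 a2 B1 B2" and a12: "a1 < \<delta>" "pi - \<delta> < a2"
        and d: "(joint_hcap g1 g2 has_real_derivative d) (at 0 within {0..S})" for g1 g2 S q a1 a2 d
    proof -
      have a: "0 < a1" "a2 < pi" and S: "0 < S"
        using cfg by (auto simp: two_slit_config_def simple_slit_def)
      from joint_hcap_blowup[OF cfg B] obtain l1 l2 where l: "l1 > 0" "l2 > 0"
        and h: "hcap (seg a1 l1) = B1" "hcap (seg a2 l2) = B2"
        and d': "(joint_hcap g1 g2 has_real_derivative hcap (seg a1 l1 \<union> seg a2 l2)) (at 0 within {0..S})"
        by blast
      \<comment> \<open>\<open>d\<close> is an arbitrary derivative; it agrees with the one from the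
        blow-up since both are limits of the same quotients along this sequence.\<close>
      define t where "t = (\<lambda>n. S * inverse (real (Suc n)))"
      have "S * inverse (real (Suc n)) \<le> S * 1" for n
        using S by (intro mult_left_mono) (auto simp: inverse_le_1_iff)
      hence t1: "0 < t n \<and> t n \<le> S" for n using S by (simp add: t_def)
      have "t \<longlonglongrightarrow> S * 0" unfolding t_def by (intro tendsto_intros LIMSEQ_inverse_real_of_nat)
      hence t2: "t \<longlonglongrightarrow> 0" by simp
      have j0: "joint_hcap g1 g2 0 = 0" by (simp add: joint_hcap_def hcap_zero)
      have "d = hcap (seg a1 l1 \<union> seg a2 l2)"
        by (rule LIMSEQ_unique[OF tendsto_ratio_from_derivative[OF d j0 t1 t2] tendsto_ratio_from_derivative[OF d' j0 t1 t2]])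
      thus ?thesis using \<delta>(2)[OF a(1) a12 a(2) l h] by simp
    qed
    thus "\<exists>\<delta>>0. \<forall>g1 g2 S q a1 a2 d.
              two_slit_config g1 g2 S q a1 a2 B1 B2 \<and> a1 < \<delta> \<and> pi - \<delta> < a2
              \<and> (joint_hcap g1 g2 has_real_derivative d) (at 0 within {0..S})
              \<longrightarrow> \<bar>d - (B1 + B2)\<bar> < \<epsilon>"
      using \<delta>(1) by blast
  qed
qed

end
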